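(* Let $\mathscr{P}$ be a $C^*$-planar algebra, let $x\in\mathscr{P}_{2,\pm}$ be $\mathfrak{F}$-positive, and let $r$ be the spectral radius of $x$. Let $p_{\max}\in\mathscr{P}_{1,\pm}$ be the maximal range projection of the positive elements $y\in\mathscr{P}_{1,\pm}$ with $y*\widehat{x}=ry$. Then: (1) If there exists a non-zero positive element $z\in\mathscr{P}_{1,\mp}$ such that $\widehat{x}*z\le r z$ and $\mathcal{R}(z)\le\overline{p_{\max}}$, then $\widehat{x}*z=rz$. (2) If there exists a non-zero positive element $z\in\mathscr{P}_{1,\mp}$ such that $rz\le\widehat{x}*z$ and $\mathcal{R}(\widehat{x}*z)\le\overline{p_{\max}}$, then $\widehat{x}*z=rz$. (3) If there exists a non-zero positive element $z\in\mathscr{P}_{1,\mp}$ such that $\widehat{x}*z=\widetilde{r}z$ (with $\widetilde{r}$ a scalar) and $\mathcal{R}(z)\le\overline{p_{\max}}$, then $\widetilde{r}=r$.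
   Context: $C^*$-planar algebra: a (shaded) planar algebra in the sense of Jones is a family $\mathscr{P}=\{\mathscr{P}_{n,\pm}\}_{n\ge 0}$ of complex vector spaces on which shaded planar tangles act multilinearly, compatibly with isotopy and composition of tangles. Elements of $\mathscr{P}_{n,\pm}$ are boxes with $n$ strings attached on top and $n$ on the bottom; the region at the left (marked) side is unshaded for $+$ and shaded for $-$. It is a $C^*$-planar algebra if each $\mathscr{P}_{n,\pm}$ is a finite-dimensional unital $C^*$-algebra (unit $I$) for the vertical stacking product ($xy$ is drawn with $y$ above $x$), the involution $*$ is compatible with reflection of tangles in a horizontal line, and there are positive faithful traces $tr_{n,\pm}$ with $tr_{n,\pm}(x)=tr_{0,\pm}$(closure of $x$), the closure joining each top string to the corresponding bottom string. Fourier transform: $\mathfrak{F}:\mathscr{P}_{2,\pm}\to\mathscr{P}_{2,\mp}$, $\widehat{x}=\mathfrak{F}(x)$, is the $90^\circ$ rotation: the top-left, top-right, bottom-left, bottom-right boundary points of $\widehat{x}$ are connected respectively to the bottom-left, top-left, bottom-right, top-right points of $x$. Convolution: for $y\in\mathscr{P}_{1,\pm}$ and $u\in\mathscr{P}_{2,\mp}$, $y*u\in\mathscr{P}_{1,\pm}$ is obtained by placing $y$ to the left of $u$ and joining the top (bottom) end of $y$ to the top-left (bottom-left) point of $u$; for $z\in\mathscr{P}_{1,\mp}$, $u*z\in\mathscr{P}_{1,\mp}$ is obtained by placing $z$ to the right of $u$ and joining its top (bottom) end to the top-right (bottom-right) point of $u$. $\overline{y}\in\mathscr{P}_{1,\mp}$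 is the $180^\circ$ rotation of $y\in\mathscr{P}_{1,\pm}$. $\mathcal{R}(a)$ is the range projection of $a$. An element is positive if it is of the form $aa^*$. $x\in\mathscr{P}_{2,\pm}$ is $\mathfrak{F}$-positive if $\widehat{x}$ is positive in $\mathscr{P}_{2,\mp}$. Put $\mathcal{E}=\{y\in\mathscr{P}_{1,\pm}:y*\widehat{x}=ry\}$, $\mathcal{E}^+$ its set of positive elements, $\mathscr{Q}=\{\mathcal{R}(y):y\in\mathcal{E}^+\}$; $\mathscr{Q}$ is closed under $\vee$ and $p_{\max}=\bigvee_{q\in\mathscr{Q}}q$ is its maximal element. *)

theory Defs
  imports "HOL-Complex_Analysis.Winding_Numbers" "HOL-Algebra.Group"
begin

section \<open>Shaded planar tangles\<close>

text \<open>\<^term>\<open>Plus\<close>: the region at the marked (left) side of a disc is unshaded; \<^term>\<open>Minus\<close>: it is shaded.\<close>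

datatype sign = Plus | Minus

fun flip :: "sign \<Rightarrow> sign" where
  "flip Plus = Minus"
| "flip Minus = Plus"

text \<open>
  A disc of a tangle is a closed Jordan domain in the plane together with its boundary points,
  listed clockwise starting from the distinguished (marked) boundary interval. An \<open>n\<close>-box has \<open>2n\<close>
  boundary points; drawn as a rectangle with the distinguished interval on the left, the list is
  \<open>top 0, \<dots>, top (n-1), bottom (n-1), \<dots>, bottom 0\<close>, where \<open>0\<close> is leftmost.
\<close>

record disc =
  region :: "complex set"
  marks :: "complex list"
  shade :: sign

definition disc_param :: "disc \<Rightarrow> (real \<Rightarrow> complex) \<Rightarrow> real list \<Rightarrow> bool" where
  "disc_param d c ts \<longleftrightarrow>
     simple_path c \<and> pathfinish c = pathstart c \<and>
     region d = path_image c \<union> inside (path_image c) \<and>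
     (\<forall>w\<in>inside (path_image c). winding_number c w = -1) \<and>
     sorted_wrt (<) ts \<and> set ts \<subseteq> {0<..<1} \<and> marks d = map c ts"
  \<comment> \<open>\<open>c\<close> runs clockwise round the boundary once and starts inside the distinguished interval\<close>

definition half_marks :: "disc \<Rightarrow> nat" where
  "half_marks d = length (marks d) div 2"

definition box_type :: "nat \<Rightarrow> sign \<Rightarrow> disc \<Rightarrow> bool" where
  "box_type n s d \<longleftrightarrow> length (marks d) = 2 * n \<and> shade d = s"

definition top_mark :: "disc \<Rightarrow> nat \<Rightarrow> complex" where
  "top_mark d i = marks d ! i"

definition bot_mark :: "disc \<Rightarrow> nat \<Rightarrow> complex" where
  "bot_mark d i = marks d ! (length (marks d) - 1 - i)"

text \<open>
  \<open>strings\<close> is the union of all strings and \<open>shaded\<close> the union of all shaded regions.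
  Strings are topological arcs and simple closed curves; in the plane this gives the same
  isotopy classes of tangles as smooth strings.
\<close>

record tangle =
  outer_disc :: disc
  inner_discs :: "disc set"
  strings :: "complex set"
  shaded :: "complex set"

definition discs :: "tangle \<Rightarrow> disc set" where
  "discs T = insert (outer_disc T) (inner_discs T)"

definition all_marks :: "tangle \<Rightarrow> complex set" where
  "all_marks T = (\<Union>d\<in>discs T. set (marks d))"

definition between_discs :: "tangle \<Rightarrow> complex set" where
  "between_discs T = region (outer_disc T) - (\<Union>d\<in>inner_discs T. interior (region d))"

text \<open>The regions of a tangle are the connected components of the following set.\<close>

definition off_strings :: "tangle \<Rightarrow> complex set" where
  "off_strings T = between_discs T - strings T"

text \<open>
  In the shading conditions, \<open>shaded T\<close> being clopen in \<open>off_strings T\<close> says that it is a union of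
  regions; the closure condition says that the two sides of a string have different shades.
\<close>

definition planar_tangle :: "tangle \<Rightarrow> bool" where
  "planar_tangle T \<longleftrightarrow>
     finite (inner_discs T) \<and>
     (\<forall>d\<in>inner_discs T. region d \<subseteq> interior (region (outer_disc T))) \<and>
     (\<forall>d\<in>inner_discs T. \<forall>d'\<in>inner_discs T. d \<noteq> d' \<longrightarrow> region d \<inter> region d' = {}) \<and>
     (\<exists>C. finite C \<and> (\<forall>c\<in>C. simple_path c) \<and>
          (\<forall>c\<in>C. \<forall>c'\<in>C. c \<noteq> c' \<longrightarrow> path_image c \<inter> path_image c' = {}) \<and>
          strings T = (\<Union>c\<in>C. path_image c) \<and>
          all_marks T = (\<Union>c\<in>{c\<in>C. arc c}. {pathstart c, pathfinish c})) \<and>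
     strings T \<subseteq> between_discs T \<and>
     strings T \<inter> (\<Union>d\<in>discs T. frontier (region d)) = all_marks T \<and>
     openin (top_of_set (off_strings T)) (shaded T) \<and>
     closedin (top_of_set (off_strings T)) (shaded T) \<and>
     strings T \<subseteq> closure (shaded T) \<inter> closure (off_strings T - shaded T) \<and>
     (\<forall>d\<in>discs T. even (length (marks d)) \<and>
        (\<exists>c ts. disc_param d c ts \<and> (c 0 \<in> shaded T \<longleftrightarrow> shade d = Minus)))"

definition compose_tangle :: "tangle \<Rightarrow> disc \<Rightarrow> tangle \<Rightarrow> tangle" where
  "compose_tangle T d S =
     \<lparr>outer_disc = outer_disc T,
      inner_discs = (inner_discs T - {d}) \<union> inner_discs S,
      strings = strings T \<union> strings S,
      shaded = shaded T \<union> shaded S\<rparr>"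
  \<comment> \<open>used when the outer disc of \<open>S\<close> is the inner disc \<open>d\<close> of \<open>T\<close>\<close>

definition plane_isotopy :: "(complex \<Rightarrow> complex) \<Rightarrow> bool" where
  "plane_isotopy h \<longleftrightarrow>
     homotopic_with_canon (\<lambda>g. \<exists>g'. homeomorphism UNIV UNIV g g') UNIV UNIV id h"
  \<comment> \<open>\<open>h\<close> is the end of an ambient isotopy of the plane\<close>

definition map_disc :: "(complex \<Rightarrow> complex) \<Rightarrow> disc \<Rightarrow> disc" where
  "map_disc h d = \<lparr>region = h ` region d, marks = map h (marks d), shade = shade d\<rparr>"

definition map_tangle :: "(complex \<Rightarrow> complex) \<Rightarrow> tangle \<Rightarrow> tangle" where
  "map_tangle h T =
     \<lparr>outer_disc = map_disc h (outer_disc T),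
      inner_discs = map_disc h ` inner_discs T,
      strings = h ` strings T,
      shaded = h ` shaded T\<rparr>"

text \<open>
  Reflection in a horizontal line reverses the orientation and keeps the distinguished intervals,
  so the list of boundary points is reversed.
\<close>

definition reflect_disc :: "disc \<Rightarrow> disc" where
  "reflect_disc d = \<lparr>region = cnj ` region d, marks = rev (map cnj (marks d)), shade = shade d\<rparr>"

definition reflect_tangle :: "tangle \<Rightarrow> tangle" where
  "reflect_tangle T =
     \<lparr>outer_disc = reflect_disc (outer_disc T),
      inner_discs = reflect_disc ` inner_discs T,
      strings = cnj ` strings T,
      shaded = cnj ` shaded T\<rparr>"

section \<open>The tangles of the basic operations\<close>

definition joined :: "tangle \<Rightarrow> complex \<Rightarrow> complex \<Rightarrow> bool" where
  "joined T p q \<longleftrightarrow> connected_component (strings T) p q"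

definition no_closed_strings :: "tangle \<Rightarrow> bool" where
  "no_closed_strings T \<longleftrightarrow> (\<forall>p\<in>strings T. \<exists>m\<in>all_marks T. joined T p m)"

definition stacking_tangle :: "nat \<Rightarrow> sign \<Rightarrow> tangle \<Rightarrow> disc \<Rightarrow> disc \<Rightarrow> bool" where
  "stacking_tangle n s T lower upper \<longleftrightarrow>
     planar_tangle T \<and> no_closed_strings T \<and>
     inner_discs T = {lower, upper} \<and> lower \<noteq> upper \<and>
     box_type n s (outer_disc T) \<and> box_type n s lower \<and> box_type n s upper \<and>
     (\<forall>i<n. joined T (bot_mark (outer_disc T) i) (bot_mark lower i) \<and>
            joined T (top_mark lower i) (bot_mark upper i) \<and>
            joined T (top_mark upper i) (top_mark (outer_disc T) i))"

text \<open>
  The last clause says that the region at the left of the box is the outermost one, that is, the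
  box is closed up on its right.
\<close>

definition closure_tangle :: "nat \<Rightarrow> sign \<Rightarrow> tangle \<Rightarrow> disc \<Rightarrow> bool" where
  "closure_tangle n s T d \<longleftrightarrow>
     planar_tangle T \<and> no_closed_strings T \<and>
     inner_discs T = {d} \<and> box_type 0 s (outer_disc T) \<and> box_type n s d \<and>
     (\<forall>i<n. joined T (top_mark d i) (bot_mark d i)) \<and>
     (\<exists>c ts. disc_param d c ts \<and>
        (\<forall>w\<in>frontier (region (outer_disc T)). connected_component (off_strings T) (c 0) w))"

definition fourier_tangle :: "sign \<Rightarrow> tangle \<Rightarrow> disc \<Rightarrow> bool" where
  "fourier_tangle s T d \<longleftrightarrow>
     planar_tangle T \<and> no_closed_strings T \<and>
     inner_discs T = {d} \<and> box_type 2 (flip s) (outer_disc T) \<and> box_type 2 s d \<and>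
     joined T (top_mark (outer_disc T) 0) (bot_mark d 0) \<and>
     joined T (top_mark (outer_disc T) 1) (top_mark d 0) \<and>
     joined T (bot_mark (outer_disc T) 0) (bot_mark d 1) \<and>
     joined T (bot_mark (outer_disc T) 1) (top_mark d 1)"

definition left_convolution_tangle :: "sign \<Rightarrow> tangle \<Rightarrow> disc \<Rightarrow> disc \<Rightarrow> bool" where
  "left_convolution_tangle s T dy du \<longleftrightarrow>
     planar_tangle T \<and> no_closed_strings T \<and>
     inner_discs T = {dy, du} \<and> dy \<noteq> du \<and>
     box_type 1 s (outer_disc T) \<and> box_type 1 s dy \<and> box_type 2 (flip s) du \<and>
     joined T (top_mark dy 0) (top_mark du 0) \<and>
     joined T (bot_mark dy 0) (bot_mark du 0) \<and>
     joined T (top_mark du 1) (top_mark (outer_disc T) 0) \<and>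
     joined T (bot_mark du 1) (bot_mark (outer_disc T) 0)"

definition right_convolution_tangle :: "sign \<Rightarrow> tangle \<Rightarrow> disc \<Rightarrow> disc \<Rightarrow> bool" where
  "right_convolution_tangle s T du dz \<longleftrightarrow>
     planar_tangle T \<and> no_closed_strings T \<and>
     inner_discs T = {du, dz} \<and> du \<noteq> dz \<and>
     box_type 1 s (outer_disc T) \<and> box_type 2 s du \<and> box_type 1 s dz \<and>
     joined T (top_mark dz 0) (top_mark du 1) \<and>
     joined T (bot_mark dz 0) (bot_mark du 1) \<and>
     joined T (top_mark du 0) (top_mark (outer_disc T) 0) \<and>
     joined T (bot_mark du 0) (bot_mark (outer_disc T) 0)"

definition rotation_tangle :: "sign \<Rightarrow> tangle \<Rightarrow> disc \<Rightarrow> bool" where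
  "rotation_tangle s T d \<longleftrightarrow>
     planar_tangle T \<and> no_closed_strings T \<and>
     inner_discs T = {d} \<and> box_type 1 (flip s) (outer_disc T) \<and> box_type 1 s d \<and>
     joined T (top_mark (outer_disc T) 0) (bot_mark d 0) \<and>
     joined T (bot_mark (outer_disc T) 0) (top_mark d 0)"

section \<open>Finite-dimensional \<open>C\<^sup>*\<close>-algebras\<close>

record 'v star_algebra = "'v monoid" +
  star :: "'v \<Rightarrow> 'v"
  nrm :: "'v \<Rightarrow> real"

text \<open>
  The carrier is a subspace of an ambient complex vector space. Completeness of the norm is
  automatic in finite dimension.
\<close>

locale fin_dim_cstar_algebra =
  vector_space cscale + monoid A
  for cscale :: "complex \<Rightarrow> 'v::ab_group_add \<Rightarrow> 'v"
    and A :: "('v, 'm) star_algebra_scheme" (structure) +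
  assumes subspace_carrier: "subspace (carrier A)"
    and finite_dimensional: "\<exists>B. finite B \<and> span B = carrier A"
    and mult_add_left: "\<lbrakk>x \<in> carrier A; y \<in> carrier A; z \<in> carrier A\<rbrakk> \<Longrightarrow> (x + y) \<otimes> z = x \<otimes> z + y \<otimes> z"
    and mult_add_right: "\<lbrakk>x \<in> carrier A; y \<in> carrier A; z \<in> carrier A\<rbrakk> \<Longrightarrow> z \<otimes> (x + y) = z \<otimes> x + z \<otimes> y"
    and mult_scale_left: "\<lbrakk>x \<in> carrier A; y \<in> carrier A\<rbrakk> \<Longrightarrow> cscale a x \<otimes> y = cscale a (x \<otimes> y)"
    and mult_scale_right: "\<lbrakk>x \<in> carrier A; y \<in> carrier A\<rbrakk> \<Longrightarrow> x \<otimes> cscale a y = cscale a (x \<otimes> y)"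
    and star_closed: "x \<in> carrier A \<Longrightarrow> star A x \<in> carrier A"
    and star_star: "x \<in> carrier A \<Longrightarrow> star A (star A x) = x"
    and star_add: "\<lbrakk>x \<in> carrier A; y \<in> carrier A\<rbrakk> \<Longrightarrow> star A (x + y) = star A x + star A y"
    and star_scale: "x \<in> carrier A \<Longrightarrow> star A (cscale a x) = cscale (cnj a) (star A x)"
    and star_mult: "\<lbrakk>x \<in> carrier A; y \<in> carrier A\<rbrakk> \<Longrightarrow> star A (x \<otimes> y) = star A y \<otimes> star A x"
    and nrm_eq_0: "x \<in> carrier A \<Longrightarrow> nrm A x = 0 \<longleftrightarrow> x = 0"
    and nrm_triangle: "\<lbrakk>x \<in> carrier A; y \<in> carrier A\<rbrakk> \<Longrightarrow> nrm A (x + y) \<le> nrm A x + nrm A y"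
    and nrm_scale: "x \<in> carrier A \<Longrightarrow> nrm A (cscale a x) = cmod a * nrm A x"
    and nrm_mult: "\<lbrakk>x \<in> carrier A; y \<in> carrier A\<rbrakk> \<Longrightarrow> nrm A (x \<otimes> y) \<le> nrm A x * nrm A y"
    and cstar_identity: "x \<in> carrier A \<Longrightarrow> nrm A (star A x \<otimes> x) = (nrm A x)\<^sup>2"

definition alg_positive :: "('v, 'm) star_algebra_scheme \<Rightarrow> 'v \<Rightarrow> bool" where
  "alg_positive A x \<longleftrightarrow> (\<exists>a\<in>carrier A. x = a \<otimes>\<^bsub>A\<^esub> star A a)"

definition alg_le :: "('v::ab_group_add, 'm) star_algebra_scheme \<Rightarrow> 'v \<Rightarrow> 'v \<Rightarrow> bool" where
  "alg_le A x y \<longleftrightarrow> alg_positive A (y - x)"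

definition projections :: "('v, 'm) star_algebra_scheme \<Rightarrow> 'v set" where
  "projections A = {p \<in> carrier A. p \<otimes>\<^bsub>A\<^esub> p = p \<and> star A p = p}"

definition range_projection :: "('v::ab_group_add, 'm) star_algebra_scheme \<Rightarrow> 'v \<Rightarrow> 'v" where
  "range_projection A a =
     (THE p. p \<in> projections A \<and> p \<otimes>\<^bsub>A\<^esub> a = a \<and>
             (\<forall>q\<in>projections A. q \<otimes>\<^bsub>A\<^esub> a = a \<longrightarrow> alg_le A p q))"

definition projection_join :: "('v::ab_group_add, 'm) star_algebra_scheme \<Rightarrow> 'v set \<Rightarrow> 'v" where
  "projection_join A Q =
     (THE p. p \<in> projections A \<and> (\<forall>q\<in>Q. alg_le A q p) \<and>
             (\<forall>p'\<in>projections A. (\<forall>q\<in>Q. alg_le A q p') \<longrightarrow> alg_le A p p'))"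

definition spectrum ::
    "(complex \<Rightarrow> 'v \<Rightarrow> 'v) \<Rightarrow> ('v::ab_group_add, 'm) star_algebra_scheme \<Rightarrow> 'v \<Rightarrow> complex set" where
  "spectrum cscale A x = {l. x - cscale l \<one>\<^bsub>A\<^esub> \<notin> Units A}"

text \<open>
  Inserting \<open>0\<close> matters only in the zero algebra, where the spectrum is empty and the spectral
  radius is \<open>0\<close>.
\<close>

definition spectral_radius ::
    "(complex \<Rightarrow> 'v \<Rightarrow> 'v) \<Rightarrow> ('v::ab_group_add, 'm) star_algebra_scheme \<Rightarrow> 'v \<Rightarrow> real" where
  "spectral_radius cscale A x = Sup (insert 0 (cmod ` spectrum cscale A x))"

section \<open>\<open>C\<^sup>*\<close>-planar algebras\<close>

text \<open>
  \<open>V n s\<close> are the spaces of the planar algebra, and \<open>Z T\<close> is the multilinear map of the tangle \<open>T\<close>.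
  The inputs of \<open>Z T\<close> are labellings \<open>f\<close> of the inner discs; values of \<open>f\<close> elsewhere are irrelevant.
\<close>

definition labelling :: "(nat \<Rightarrow> sign \<Rightarrow> 'v set) \<Rightarrow> tangle \<Rightarrow> (disc \<Rightarrow> 'v) \<Rightarrow> bool" where
  "labelling V T f \<longleftrightarrow> (\<forall>d\<in>inner_discs T. f d \<in> V (half_marks d) (shade d))"

locale planar_algebra =
  vector_space cscale
  for cscale :: "complex \<Rightarrow> 'v::ab_group_add \<Rightarrow> 'v"
    and V :: "nat \<Rightarrow> sign \<Rightarrow> 'v set"
    and Z :: "tangle \<Rightarrow> (disc \<Rightarrow> 'v) \<Rightarrow> 'v" +
  assumes subspace_V: "subspace (V n s)"
    and Z_closed: "\<lbrakk>planar_tangle T; labelling V T f\<rbrakk>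
      \<Longrightarrow> Z T f \<in> V (half_marks (outer_disc T)) (shade (outer_disc T))"
    and Z_cong: "\<lbrakk>planar_tangle T; labelling V T f; \<forall>d\<in>inner_discs T. f d = g d\<rbrakk> \<Longrightarrow> Z T f = Z T g"
    and Z_add: "\<lbrakk>planar_tangle T; labelling V T f; d \<in> inner_discs T; v \<in> V (half_marks d) (shade d)\<rbrakk>
      \<Longrightarrow> Z T (f(d := f d + v)) = Z T f + Z T (f(d := v))"
    and Z_scale: "\<lbrakk>planar_tangle T; labelling V T f; d \<in> inner_discs T\<rbrakk>
      \<Longrightarrow> Z T (f(d := cscale a (f d))) = cscale a (Z T f)"
    and Z_isotopy: "\<lbrakk>planar_tangle T; plane_isotopy h; labelling V (map_tangle h T) f\<rbrakk>
      \<Longrightarrow> Z (map_tangle h T) f = Z T (\<lambda>d. f (map_disc h d))"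
    and Z_compose: "\<lbrakk>planar_tangle T; planar_tangle S; outer_disc S \<in> inner_discs T;
        labelling V (compose_tangle T (outer_disc S) S) f\<rbrakk>
      \<Longrightarrow> Z (compose_tangle T (outer_disc S) S) f = Z T (f(outer_disc S := Z S f))"

text \<open>
  The connection pattern of each of the basic tangles determines it up to isotopy, so by isotopy
  invariance all tangles with that pattern act in the same way. Accordingly, an operation is
  identified as the common action of all tangles with the pattern.
\<close>

locale cstar_planar_algebra =
  planar_algebra cscale "\<lambda>n s. carrier (A n s)" Z
  for cscale :: "complex \<Rightarrow> 'v::ab_group_add \<Rightarrow> 'v"
    and A :: "nat \<Rightarrow> sign \<Rightarrow> 'v star_algebra"
    and Z :: "tangle \<Rightarrow> (disc \<Rightarrow> 'v) \<Rightarrow> 'v"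
    and tr :: "nat \<Rightarrow> sign \<Rightarrow> 'v \<Rightarrow> complex" +
  assumes cstar: "fin_dim_cstar_algebra cscale (A n s)"
    and mult_stacking: "\<lbrakk>stacking_tangle n s T lower upper; x \<in> carrier (A n s); y \<in> carrier (A n s)\<rbrakk>
      \<Longrightarrow> x \<otimes>\<^bsub>A n s\<^esub> y = Z T (\<lambda>d. if d = lower then x else y)"
    and star_reflection: "\<lbrakk>planar_tangle T; labelling (\<lambda>n s. carrier (A n s)) T f\<rbrakk>
      \<Longrightarrow> star (A (half_marks (outer_disc T)) (shade (outer_disc T))) (Z T f) =
          Z (reflect_tangle T) (\<lambda>d. star (A (half_marks d) (shade d)) (f (reflect_disc d)))"
    and tr_add: "\<lbrakk>x \<in> carrier (A n s); y \<in> carrier (A n s)\<rbrakk> \<Longrightarrow> tr n s (x + y) = tr n s x + tr n s y"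
    and tr_scale: "x \<in> carrier (A n s) \<Longrightarrow> tr n s (cscale a x) = a * tr n s x"
    and tr_comm: "\<lbrakk>x \<in> carrier (A n s); y \<in> carrier (A n s)\<rbrakk>
      \<Longrightarrow> tr n s (x \<otimes>\<^bsub>A n s\<^esub> y) = tr n s (y \<otimes>\<^bsub>A n s\<^esub> x)"
    and tr_positive: "alg_positive (A n s) x \<Longrightarrow> tr n s x \<in> \<real>\<^sub>\<ge>\<^sub>0"
    and tr_faithful: "\<lbrakk>alg_positive (A n s) x; tr n s x = 0\<rbrakk> \<Longrightarrow> x = 0"
    and tr_closure: "\<lbrakk>closure_tangle n s T d; x \<in> carrier (A n s)\<rbrakk>
      \<Longrightarrow> tr n s x = tr 0 s (Z T (\<lambda>_. x))"

definition is_fourier_transform ::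
    "(nat \<Rightarrow> sign \<Rightarrow> 'v set) \<Rightarrow> (tangle \<Rightarrow> (disc \<Rightarrow> 'v) \<Rightarrow> 'v) \<Rightarrow> (sign \<Rightarrow> 'v \<Rightarrow> 'v) \<Rightarrow> bool" where
  "is_fourier_transform V Z F \<longleftrightarrow>
     (\<forall>s T d. fourier_tangle s T d \<longrightarrow> (\<forall>x\<in>V 2 s. F s x = Z T (\<lambda>_. x)))"

text \<open>In the next three definitions \<open>s\<close> is the sign of the 1-box argument.\<close>

definition is_left_convolution ::
    "(nat \<Rightarrow> sign \<Rightarrow> 'v set) \<Rightarrow> (tangle \<Rightarrow> (disc \<Rightarrow> 'v) \<Rightarrow> 'v) \<Rightarrow> (sign \<Rightarrow> 'v \<Rightarrow> 'v \<Rightarrow> 'v) \<Rightarrow> bool" where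
  "is_left_convolution V Z conv \<longleftrightarrow>
     (\<forall>s T dy du. left_convolution_tangle s T dy du \<longrightarrow>
        (\<forall>y\<in>V 1 s. \<forall>u\<in>V 2 (flip s). conv s y u = Z T (\<lambda>d. if d = dy then y else u)))"

definition is_right_convolution ::
    "(nat \<Rightarrow> sign \<Rightarrow> 'v set) \<Rightarrow> (tangle \<Rightarrow> (disc \<Rightarrow> 'v) \<Rightarrow> 'v) \<Rightarrow> (sign \<Rightarrow> 'v \<Rightarrow> 'v \<Rightarrow> 'v) \<Rightarrow> bool" where
  "is_right_convolution V Z conv \<longleftrightarrow>
     (\<forall>s T du dz. right_convolution_tangle s T du dz \<longrightarrow>
        (\<forall>u\<in>V 2 s. \<forall>z\<in>V 1 s. conv s u z = Z T (\<lambda>d. if d = du then u else z)))"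

definition is_rotation ::
    "(nat \<Rightarrow> sign \<Rightarrow> 'v set) \<Rightarrow> (tangle \<Rightarrow> (disc \<Rightarrow> 'v) \<Rightarrow> 'v) \<Rightarrow> (sign \<Rightarrow> 'v \<Rightarrow> 'v) \<Rightarrow> bool" where
  "is_rotation V Z rot \<longleftrightarrow>
     (\<forall>s T d. rotation_tangle s T d \<longrightarrow> (\<forall>y\<in>V 1 s. rot s y = Z T (\<lambda>_. y)))"

text \<open>\<open>A\<close> is the algebra of 1-boxes and \<open>L y\<close> stands for the convolution of \<open>y\<close> with the
  Fourier transform of \<open>x\<close>.\<close>

definition max_range_projection ::
    "(complex \<Rightarrow> 'v \<Rightarrow> 'v) \<Rightarrow> ('v::ab_group_add, 'm) star_algebra_scheme \<Rightarrow> ('v \<Rightarrow> 'v) \<Rightarrow> real \<Rightarrow> 'v" where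
  "max_range_projection cscale A L r =
     projection_join A (range_projection A `
       {y \<in> carrier A. L y = cscale (of_real r) y \<and> alg_positive A y})"

end

theory Submission
  imports Defs
begin

text \<open>
  Write \<open>rot\<close> for the half turn of a 1-box, so that \<open>(y, z) \<mapsto> tr (y \<cdot> rot z)\<close> pairs 1-boxes of
  opposite shadings. The two convolutions with a 2-box \<open>u\<close> are adjoint for this pairing:
  \<open>tr ((y * u) \<cdot> rot z) = tr (rot (u * z) \<cdot> y)\<close>, because either side closes up to the same picture,
  a necklace of \<open>y\<close>, \<open>u\<close> and \<open>z\<close>, seen from two directions (\<open>conv_adjoint\<close>). If \<open>y\<close> is positive
  with \<open>y * xh = r y\<close> and \<open>w = xh * z - r z\<close>, it follows that \<open>tr (y \<cdot> rot w) = 0\<close>. When \<open>w\<close> or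
  \<open>- w\<close> is positive, faithfulness of the trace turns this into \<open>y \<cdot> rot w = 0\<close>. In finite dimension
  \<open>pmax\<close> is the range projection of a finite sum of such \<open>y\<close> (\<open>join_of_ranges\<close>); hence
  \<open>pmax \<cdot> rot w = 0\<close>, that is, the half turn of \<open>pmax\<close> annihilates \<open>w\<close> (\<open>pmax_kills\<close>). In each
  of the three claims this annihilation meets an element dominated by the half turn of \<open>pmax\<close>.

  \<^item> If \<open>xh * z \<le> r z\<close>, put \<open>w = r z - xh * z\<close>. As \<open>z\<close> is dominated by the half turn of \<open>pmax\<close>,
    \<open>z w = 0\<close>, so \<open>tr ((xh * z) w) = - tr (w w)\<close>. The left side is nonnegative, since
    \<open>tr ((a a\<^sup>* * b b\<^sup>*) \<cdot> d d\<^sup>*) = tr (a a\<^sup>* \<cdot> c c\<^sup>*)\<close> for the 2-box \<open>c\<close> made of \<open>d\<close> and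
    \<open>b\<^sup>*\<close> placed side by side (\<open>conv_right_positive\<close>); so \<open>w = 0\<close> (\<open>supersolution\<close>). This is
    where the positivity of \<open>xh\<close> enters.
  \<^item> If \<open>r z \<le> xh * z\<close>, put \<open>w = xh * z - r z\<close>. A spectral radius is nonnegative, so \<open>w \<le> xh * z\<close>,
    and \<open>w\<close> inherits the domination from \<open>xh * z\<close>; being also annihilated, it is zero
    (\<open>subsolution\<close>).
  \<^item> If \<open>xh * z = k z\<close> with \<open>k \<noteq> r\<close>, the adjointness gives \<open>(k - r) tr (y \<cdot> rot z) = 0\<close> and the
    annihilation argument applies to \<open>z\<close> itself (\<open>eigenvalue\<close>).

  The remaining work is topological. A planar algebra acts through tangles in the plane, so each
  identity between operations needs actual point sets: strings, shaded regions, discs with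
  parametrised boundaries. All tangles here are cut out of a few pictures. A picture is a continuous
  function on the plane whose zero set carries the strings and whose negative set is shaded; a
  tangle is obtained by choosing round discs. Substituting one tangle into another then just changes
  the set of discs (\<open>compose_draw\<close>), and an identity is proved by reading one closed tangle with
  two different sets of intermediate discs. The zero sets are a line (half turn, product), a circle
  (trace of a product), two circles side by side exchanged by a half turn (adjointness) and two
  concentric circles symmetric under reflection (positivity). Circles are parametrised rationally
  and all centres, squared radii and marks are rational, so that every incidence between discs and
  strings is decided by rational arithmetic.
\<close>

section \<open>Round discs\<close>

text \<open>
  For three points of a circle, a negative value says that a clockwise tour starting at the first
  point meets the second before the third. This is how the cyclic order of marks is checked by
  arithmetic on coordinates.
\<close>

definition orient :: "complex \<Rightarrow> complex \<Rightarrow> complex \<Rightarrow> real" where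
  "orient p q w = Im (cnj (q - p) * (w - p))"

lemma inside_sphere: "0 < r \<Longrightarrow> inside (sphere (z::complex) r) = ball z r"
  using inside_frontier_eq_interior[of "cball z r"] by simp

text \<open>
  The chords from \<open>1\<close> to points of the unit circle have half the argument: a chord is a real
  multiple of \<open>\<i> cis (- \<pi> t)\<close>, so the imaginary part reduces to the sign of a sine.
\<close>

lemma Im_clockwise:
  assumes "0 < a" "a < 1" "0 < b" "b < 1"
  shows "Im (cnj (cis (- (2 * pi * a)) - 1) * (cis (- (2 * pi * b)) - 1)) < 0 \<longleftrightarrow> a < b"
proof -
  have half: "cis (- (2 * x)) - 1 = - 2 * \<i> * sin x * cis (- x)" for x :: real
  proof -
    have "cos (2*x) - 1 = - 2 * sin x * sin x" "sin (2*x) = 2 * sin x * cos x"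
      using cos_double_sin[of x] sin_double[of x] by (simp_all add: power2_eq_square)
    then show ?thesis by (auto simp: complex_eq_iff)
  qed
  have a2: "cis (- (2 * pi * t)) - 1 = - 2 * \<i> * sin (pi * t) * cis (- (pi * t))" for t :: real
    using half[of "pi * t"] by (simp add: mult.assoc)
  have "cnj (cis (- (2 * pi * a)) - 1) * (cis (- (2 * pi * b)) - 1)
      = of_real (4 * sin (pi * a) * sin (pi * b)) * cis (pi * a - pi * b)"
    unfolding a2 by (simp add: cis_cnj cis_mult algebra_simps)
  then have "Im (cnj (cis (- (2 * pi * a)) - 1) * (cis (- (2 * pi * b)) - 1))
      = 4 * sin (pi * a) * sin (pi * b) * sin (pi * (a - b))"
    by (simp add: right_diff_distrib)
  moreover have "0 < sin (pi * a)" "0 < sin (pi * b)"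
    using assms by (auto intro!: sin_gt_zero)
  moreover have "sin (pi * (a - b)) < 0 \<longleftrightarrow> a < b"
  proof
    assume l: "a < b"
    have "pi * (b - a) < pi * 1" using assms by (intro mult_strict_left_mono) auto
    then have "0 < sin (pi * (b - a))" using l by (intro sin_gt_zero) auto
    then show "sin (pi * (a - b)) < 0"
      using sin_minus[of "pi * (b - a)"] by (simp add: algebra_simps)
  next
    assume l: "sin (pi * (a - b)) < 0"
    show "a < b"
    proof (rule ccontr)
      assume "\<not> a < b"
      moreover have "pi * (a - b) \<le> pi * 1" using assms by (intro mult_left_mono) auto
      ultimately have "0 \<le> sin (pi * (a - b))" by (intro sin_ge_zero) auto
      then show False using l by simp
    qed
  qed
  ultimately show ?thesis by (simp add: mult_less_0_iff zero_less_mult_iff)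
qed

text \<open>
  A round disc with marks in clockwise order admits the parametrisation demanded of discs, starting
  at any boundary point that is not a mark: run once round the circle. This isolates all winding
  numbers and arguments; later only coordinates are compared.
\<close>

lemma disc_param_round:
  assumes R: "0 < R" and q: "q \<in> sphere z R"
    and ms: "set ms \<subseteq> sphere z R - {q}"
    and srt: "sorted_wrt (\<lambda>m m'. orient q m m' < 0) ms"
  shows "\<exists>c ts. disc_param \<lparr>region = cball z R, marks = ms, shade = sh\<rparr> c ts \<and> c 0 = q"
proof -
  define \<theta> where "\<theta> = Arg (q - z)"
  have nq: "cmod (q - z) = R" using q by (simp add: dist_norm norm_minus_commute)
  have qz: "q - z = R * cis \<theta>"
    using rcis_cmod_Arg[of "q - z"] nq by (simp add: \<theta>_def rcis_def)
  define c where "c = part_circlepath z R \<theta> (\<theta> - 2 * pi)"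
  have c_eq: "c t = z + (q - z) * cis (- (2 * pi * t))" for t
  proof -
    have "linepath \<theta> (\<theta> - 2 * pi) t = \<theta> + - (2 * pi * t)"
      by (simp add: linepath_def algebra_simps)
    then have "c t = z + R * cis (\<theta> + - (2 * pi * t))"
      by (simp only: c_def part_circlepath_def cis_conv_exp mult.commute)
    then show ?thesis by (simp only: qz cis_mult[symmetric] mult.assoc)
  qed
  have c0: "c 0 = q" by (simp add: c_eq)
  have simple: "simple_path c"
    using R pi_gt_zero by (simp add: c_def simple_path_part_circlepath)
  have loop: "pathfinish c = pathstart c"
    by (simp add: pathfinish_def pathstart_def c_eq cis_conv_exp)
       (simp add: exp_minus mult.commute)
  have time: "\<exists>t. 0 < t \<and> t < 1 \<and> c t = m" if m: "m \<in> sphere z R - {q}" for m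
  proof -
    define u where "u = (m - z) / (q - z)"
    have "cmod (m - z) = R" using m by (simp add: dist_norm norm_minus_commute)
    then have u1: "cmod u = 1" using nq R by (simp add: u_def norm_divide)
    define t where "t = 1 - Arg2pi u / (2 * pi)"
    have A: "0 \<le> Arg2pi u" "Arg2pi u < 2 * pi" using Arg2pi by auto
    have u_eq: "u = exp (\<i> * Arg2pi u)" using Arg2pi_eq[of u] u1 by simp
    have "u \<noteq> 1" using m R nq by (auto simp: u_def)
    then have "Arg2pi u \<noteq> 0" using u_eq by auto
    then have "0 < t" "t < 1" using A by (auto simp: t_def field_simps)
    moreover have "cis (- (2 * pi * t)) = u"
    proof -
      have "- (2 * pi * t) = Arg2pi u + - (2 * pi)" by (simp add: t_def field_simps)
      then have "cis (- (2 * pi * t)) = cis (Arg2pi u) * cis (- (2 * pi))"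
        by (simp only: cis_mult)
      then show ?thesis using u_eq by (simp add: cis_conv_exp exp_minus mult.commute)
    qed
    then have "c t = m" using R nq by (auto simp: c_eq u_def)
    ultimately show ?thesis by blast
  qed
  define tm where "tm m = (SOME t. 0 < t \<and> t < 1 \<and> c t = m)" for m
  have tm: "0 < tm m" "tm m < 1" "c (tm m) = m" if "m \<in> sphere z R - {q}" for m
    using someI_ex[OF time[OF that]] by (auto simp: tm_def)
  have orient_c: "orient q (c a) (c b) < 0 \<longleftrightarrow> a < b" if "0 < a" "a < 1" "0 < b" "b < 1" for a b
  proof -
    have "cnj (c a - q) * (c b - q)
        = cnj ((q - z) * (cis (- (2 * pi * a)) - 1)) * ((q - z) * (cis (- (2 * pi * b)) - 1))"
      by (simp add: c_eq algebra_simps)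
    also have "\<dots> = of_real ((cmod (q - z))\<^sup>2) *
        (cnj (cis (- (2 * pi * a)) - 1) * (cis (- (2 * pi * b)) - 1))"
      by (simp only: complex_norm_square complex_cnj_mult mult_ac)
    finally have "orient q (c a) (c b)
        = R\<^sup>2 * Im (cnj (cis (- (2 * pi * a)) - 1) * (cis (- (2 * pi * b)) - 1))"
      unfolding orient_def nq by simp
    then show ?thesis using Im_clockwise[OF that] R by (simp add: mult_less_0_iff)
  qed
  have "sorted_wrt (\<lambda>m m'. tm m < tm m') ms"
  proof (rule sorted_wrt_mono_rel[OF _ srt])
    fix m m' assume mm: "m \<in> set ms" "m' \<in> set ms" "orient q m m' < 0"
    then have "m \<in> sphere z R - {q}" "m' \<in> sphere z R - {q}" using ms by auto
    then show "tm m < tm m'" using orient_c[of "tm m" "tm m'"] tm[of m] tm[of m'] mm(3) by simp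
  qed
  then have sorted: "sorted_wrt (<) (map tm ms)" by (simp add: sorted_wrt_map)
  have pim: "path_image c = sphere z R"
  proof
    show "path_image c \<subseteq> sphere z R"
      using R by (auto simp: path_image_def c_eq dist_norm norm_mult nq)
    show "sphere z R \<subseteq> path_image c"
    proof
      fix m assume "m \<in> sphere z R"
      then show "m \<in> path_image c"
        using time[of m] c0 by (cases "m = q") (force simp: path_image_def)+
    qed
  qed
  have wind: "winding_number c w = -1" if w: "w \<in> ball z R" for w
  proof -
    have rev: "c = reversepath (part_circlepath z R (\<theta> - 2 * pi) \<theta>)" by (simp add: c_def)
    let ?p = "part_circlepath z R (\<theta> - 2 * pi) \<theta>"
    have pimp: "path_image ?p = sphere z R" using pim unfolding rev by (simp only: path_image_reversepath)
    have wp: "w \<notin> path_image ?p" using w by (auto simp: pimp)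
    have cp: "z \<notin> path_image ?p" using R by (auto simp: pimp)
    have "winding_number ?p constant_on ball z R"
      by (rule winding_number_constant) (use loop in \<open>auto simp: pimp rev\<close>)
    then have "winding_number ?p w = winding_number ?p z"
      using w R by (metis constant_on_def centre_in_ball)
    also have "\<dots> = 1"
    proof -
      have "contour_integral ?p (\<lambda>w. 1 / (w - z)) = 2 * pi * \<i>"
      proof -
        have "((\<lambda>x. \<i> * of_real R * 1 / of_real R) has_integral (2*pi) * \<i>) {\<theta> - 2*pi..\<theta>}"
          using has_integral_const_real[of "\<i>" "\<theta> - 2 * pi" \<theta>] R
          by (simp add: scaleR_conv_of_real)
        have "((\<lambda>w. 1 / (w - z)) has_contour_integral (2 * pi * \<i>)) ?p"
        proof (subst has_contour_integral_part_circlepath_iff)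
          show "\<theta> - 2 * pi < \<theta>" by simp
          have "((\<lambda>t. \<i>) has_integral (2*pi) * \<i>) {\<theta> - 2*pi..\<theta>}"
            using has_integral_const_real[of "\<i>" "\<theta> - 2 * pi" \<theta>]
            by (simp add: scaleR_conv_of_real)
          then show "((\<lambda>t. 1 / (z + R * cis t - z) * R * \<i> * cis t) has_integral 2 * pi * \<i>) {\<theta> - 2 * pi..\<theta>}"
            using R by simp
        qed
        then show ?thesis by (rule contour_integral_unique)
      qed
      then show ?thesis using winding_number_valid_path[OF _ cp] by simp
    qed
    finally show ?thesis
      using winding_number_reversepath[OF _ wp] unfolding rev by (simp del: reversepath_part_circlepath)
  qed
  have "disc_param \<lparr>region = cball z R, marks = ms, shade = sh\<rparr> c (map tm ms)"
  proof -
    have ins: "inside (path_image c) = ball z R" using R by (simp add: pim inside_sphere)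
    have "set (map tm ms) \<subseteq> {0<..<1}" using tm(1,2) ms by fastforce
    moreover have "map c (map tm ms) = ms"
      using tm(3) ms by (intro nth_equalityI) (auto simp: subset_iff)
    moreover have "cball z R = path_image c \<union> inside (path_image c)"
      unfolding ins unfolding pim by auto
    ultimately show ?thesis
      using simple loop sorted wind unfolding disc_param_def by (simp add: ins)
  qed
  then show ?thesis using c0 by blast
qed

section \<open>Tangles cut out of a picture\<close>

definition btw :: "disc \<Rightarrow> disc set \<Rightarrow> complex set" where
  "btw D I = region D - (\<Union>d\<in>I. interior (region d))"

definition draw :: "(complex \<Rightarrow> real) \<Rightarrow> disc \<Rightarrow> disc set \<Rightarrow> tangle" where
  "draw g D I = \<lparr>outer_disc = D, inner_discs = I,
     strings = {p \<in> btw D I. g p = 0}, shaded = {p \<in> btw D I. g p < 0}\<rparr>"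

lemma draw_simps [simp]:
  "outer_disc (draw g D I) = D" "inner_discs (draw g D I) = I"
  "strings (draw g D I) = {p \<in> btw D I. g p = 0}" "shaded (draw g D I) = {p \<in> btw D I. g p < 0}"
  "between_discs (draw g D I) = btw D I" "off_strings (draw g D I) = {p \<in> btw D I. g p \<noteq> 0}"
  by (auto simp: draw_def between_discs_def btw_def off_strings_def)

text \<open>
  The strings meet the boundary circle exactly in the marks, and some start of a parametrisation
  lies off the strings on the side whose sign is the shade of the disc.
\<close>

definition adapted :: "(complex \<Rightarrow> real) \<Rightarrow> disc \<Rightarrow> bool" where
  "adapted g d \<longleftrightarrow>
     (\<exists>z R. 0 < R \<and> region d = cball z R \<and> set (marks d) = {p \<in> sphere z R. g p = 0}) \<and>
     even (length (marks d)) \<and>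
     (\<exists>c ts. disc_param d c ts \<and> c 0 \<in> frontier (region d) \<and> g (c 0) \<noteq> 0 \<and> (g (c 0) < 0 \<longleftrightarrow> shade d = Minus))"

definition nested :: "disc \<Rightarrow> disc set \<Rightarrow> bool" where
  "nested D I \<longleftrightarrow> finite I \<and> (\<forall>d\<in>I. region d \<subseteq> interior (region D)) \<and>
     (\<forall>d\<in>I. \<forall>d'\<in>I. d \<noteq> d' \<longrightarrow> region d \<inter> region d' = {})"

text \<open>
  The strings between the discs are the arcs \<open>\<gamma> j ` {u..v}\<close> for \<open>(j, u, v) \<in> S\<close>: \<open>j\<close> names a
  component of the zero set and \<open>[u, v]\<close> a range of its parameter. Arcs on one component are
  separated, and their end points are the marks of all discs.
\<close>

definition drawing ::
    "(complex \<Rightarrow> real) \<Rightarrow> ('j \<Rightarrow> real \<Rightarrow> complex) \<Rightarrow> disc \<Rightarrow> disc set \<Rightarrow> ('j \<times> real \<times> real) set \<Rightarrow> bool" where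
  "drawing g \<gamma> D I S \<longleftrightarrow>
     nested D I \<and> (\<forall>d\<in>insert D I. adapted g d) \<and>
     finite S \<and> (\<forall>(j,u,v)\<in>S. u < v) \<and>
     (\<forall>(j,u,v)\<in>S. \<forall>(j',u',v')\<in>S. j = j' \<longrightarrow> (u,v) = (u',v') \<or> v < u' \<or> v' < u) \<and>
     {p \<in> btw D I. g p = 0} = (\<Union>(j,u,v)\<in>S. \<gamma> j ` {u..v}) \<and>
     (\<Union>d\<in>insert D I. set (marks d)) = (\<Union>(j,u,v)\<in>S. {\<gamma> j u, \<gamma> j v})"

text \<open>
  The change of sign at every zero makes the two sides of a string have different shades.
\<close>

locale picture =
  fixes g :: "complex \<Rightarrow> real" and \<gamma> :: "'j \<Rightarrow> real \<Rightarrow> complex"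
  assumes cont: "continuous_on UNIV g"
    and sign_change: "g p = 0 \<Longrightarrow> p \<in> closure {p. g p < 0} \<and> p \<in> closure {p. 0 < g p}"
    and curve_cont: "continuous_on UNIV (\<gamma> j)"
    and curve_inj: "\<gamma> i a = \<gamma> j b \<Longrightarrow> i = j \<and> a = b"
begin

lemma
  assumes "drawing g \<gamma> D I S"
  shows drawing_planar: "planar_tangle (draw g D I)"
    and drawing_joined: "(j, u, v) \<in> S \<Longrightarrow> joined (draw g D I) (\<gamma> j u) (\<gamma> j v)"
    and drawing_joined': "(j, u, v) \<in> S \<Longrightarrow> joined (draw g D I) (\<gamma> j v) (\<gamma> j u)"
    and drawing_no_closed: "no_closed_strings (draw g D I)"
proof -
  note A = assms[unfolded drawing_def]
  have nst: "nested D I" using A by (elim conjE)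
  have "\<forall>d\<in>insert D I. adapted g d" using A by (elim conjE)
  then have ad: "\<And>d. d \<in> insert D I \<Longrightarrow> adapted g d" by blast
  have finS: "finite S" using A by (elim conjE)
  have lt': "\<forall>(j,u,v)\<in>S. u < v" using A by (elim conjE)
  have sep': "\<forall>(j,u,v)\<in>S. \<forall>(j',u',v')\<in>S. j = j' \<longrightarrow> (u,v) = (u',v') \<or> v < u' \<or> v' < u"
    using A by (elim conjE)
  have str: "{p \<in> btw D I. g p = 0} = (\<Union>(j,u,v)\<in>S. \<gamma> j ` {u..v})" using A by (elim conjE)
  have mk: "(\<Union>d\<in>insert D I. set (marks d)) = (\<Union>(j,u,v)\<in>S. {\<gamma> j u, \<gamma> j v})"
    using A by (elim conjE)
  have fin: "finite I" and inn: "\<And>d. d \<in> I \<Longrightarrow> region d \<subseteq> interior (region D)"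
    and dis: "\<And>d d'. \<lbrakk>d \<in> I; d' \<in> I; d \<noteq> d'\<rbrakk> \<Longrightarrow> region d \<inter> region d' = {}"
    using nst unfolding nested_def by auto
  have lt: "u < v" if "(j,u,v) \<in> S" for j u v using lt' that by auto
  have sep: "(u,v) = (u',v') \<or> v < u' \<or> v' < u" if "(j,u,v) \<in> S" "(j,u',v') \<in> S" for j u v u' v'
    using bspec[OF sep' that(1)] that(2) by auto
  let ?T = "draw g D I"
  have rd: "\<exists>z R. 0 < R \<and> region d = cball z R \<and> set (marks d) = {p \<in> sphere z R. g p = 0}"
    if "d \<in> insert D I" for d
    using ad[OF that] by (auto simp: adapted_def)
  have fr: "frontier (region d) \<inter> {p. g p = 0} = set (marks d)" if "d \<in> insert D I" for d
    using rd[OF that] by auto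
  \<comment> \<open>boundaries of discs are part of the space between the discs, as the discs are nested strictly\<close>
  have frb: "frontier (region d) \<subseteq> btw D I" if d: "d \<in> insert D I" for d
  proof -
    have sub: "frontier (region d) \<subseteq> region d" "frontier (region d) \<inter> interior (region d) = {}"
      using rd[OF d] by auto
    show ?thesis
    proof (cases "d = D")
      case True
      then show ?thesis using sub inn interior_subset by (fastforce simp: btw_def)
    next
      case False
      then have dI: "d \<in> I" using d by simp
      have "region d \<subseteq> region D" using inn[OF dI] interior_subset by blast
      moreover have "frontier (region d) \<inter> interior (region d') = {}" if "d' \<in> I" for d'
        using sub dis[OF dI that] interior_subset[of "region d'"] by (cases "d' = d") blast+
      ultimately show ?thesis using sub by (fastforce simp: btw_def)
    qed
  qed
  have am: "all_marks ?T = (\<Union>d\<in>insert D I. set (marks d))"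
    by (simp add: all_marks_def discs_def)
  define P where "P = (\<lambda>(j,u,v). \<gamma> j \<circ> linepath u v)"
  have pim: "path_image (P (j,u,v)) = \<gamma> j ` {u..v}" if "(j,u,v) \<in> S" for j u v
    using lt[OF that] by (simp add: P_def path_image_compose closed_segment_eq_real_ivl)
  have arcP: "arc (P (j,u,v))" if s: "(j,u,v) \<in> S" for j u v
    unfolding arc_def
  proof
    show "path (P (j,u,v))" unfolding P_def prod.case path_def
      by (rule continuous_on_compose) (auto intro: continuous_on_subset[OF curve_cont] continuous_on_linepath)
    show "inj_on (P (j,u,v)) {0..1}"
    proof (rule inj_onI)
      fix a b assume "P (j,u,v) a = P (j,u,v) b"
      then have "linepath u v a = linepath u v b" using curve_inj by (simp add: P_def)
      then have "a * (v - u) = b * (v - u)" by (simp add: linepath_def algebra_simps)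
      then show "a = b" using lt[OF s] by simp
    qed
  qed
  have ends: "pathstart (P (j,u,v)) = \<gamma> j u" "pathfinish (P (j,u,v)) = \<gamma> j v" for j u v
    by (auto simp: P_def pathstart_compose pathfinish_compose)
  have conS: "\<gamma> j ` {u..v} \<subseteq> strings ?T" if "(j,u,v) \<in> S" for j u v
    using str that by (simp only: draw_simps) blast
  have jn: "joined ?T (\<gamma> j a) (\<gamma> j b)" if s: "(j,u,v) \<in> S" and ab: "a \<in> {u..v}" "b \<in> {u..v}" for j u v a b
    unfolding joined_def connected_component_def
  proof (intro exI conjI)
    show "connected (\<gamma> j ` {u..v})"
      by (intro connected_continuous_image continuous_on_subset[OF curve_cont]) auto
    show "\<gamma> j ` {u..v} \<subseteq> strings ?T" by (rule conS[OF s])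
  qed (use ab in auto)
  show "joined ?T (\<gamma> j u) (\<gamma> j v)" "joined ?T (\<gamma> j v) (\<gamma> j u)" if "(j,u,v) \<in> S" for j u v
    using jn[OF that, of u v] jn[OF that, of v u] lt[OF that] by auto
  show "no_closed_strings ?T" unfolding no_closed_strings_def
  proof
    fix p assume "p \<in> strings ?T"
    then obtain j u v t where s: "(j,u,v) \<in> S" "t \<in> {u..v}" "p = \<gamma> j t"
      unfolding draw_simps str by auto
    then have "joined ?T p (\<gamma> j u)" using jn[OF s(1), of t u] by auto
    moreover have "\<gamma> j u \<in> all_marks ?T" using s(1) unfolding am mk by blast
    ultimately show "\<exists>m\<in>all_marks ?T. joined ?T p m" by blast
  qed
  \<comment> \<open>points of the open arcs lie in an open subset of the space between the discs, where the global change of sign is visible; end points are limits of these\<close>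
  have inner_limit: "strings ?T \<subseteq> closure {p \<in> btw D I. P' (g p)}"
    if P': "\<And>p. g p = 0 \<Longrightarrow> p \<in> closure {p. P' (g p)}" for P'
  proof -
    have "\<gamma> j ` {u..v} \<subseteq> closure {p \<in> btw D I. P' (g p)}" if s: "(j,u,v) \<in> S" for j u v
    proof -
      have int: "\<gamma> j ` {u<..<v} \<subseteq> closure {p \<in> btw D I. P' (g p)}"
      proof
        fix p assume "p \<in> \<gamma> j ` {u<..<v}"
        then obtain t where t: "u < t" "t < v" "p = \<gamma> j t" by auto
        have "p \<in> strings ?T" by (rule subsetD[OF conS[OF s]]) (use t in auto)
        then have pb: "p \<in> btw D I" and gp: "g p = 0" by auto
        have nm: "p \<notin> (\<Union>d\<in>insert D I. set (marks d))"
        proof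
          assume "p \<in> (\<Union>d\<in>insert D I. set (marks d))"
          then obtain j' u' v' where s': "(j',u',v') \<in> S" and e: "p = \<gamma> j' u' \<or> p = \<gamma> j' v'"
            unfolding mk by auto
          from e have jj: "j' = j" and "t = u' \<or> t = v'"
            using curve_inj[of j t j'] unfolding t(3) by metis+
          then show False using sep[OF s s'[unfolded jj]] lt[OF s'] t(1,2) by auto
        qed
        define U where "U = interior (region D) - (\<Union>d\<in>I. region d)"
        have opU: "open U" unfolding U_def
          using fin rd by (intro open_Diff closed_UN open_interior ballI) force+
        have nfr: "p \<notin> frontier (region d)" if "d \<in> insert D I" for d
          using fr[OF that] gp nm that by blast
        have "p \<in> interior (region D)"
          using pb nfr[of D] rd[of D] by (auto simp: btw_def)
        moreover have "p \<notin> region d" if "d \<in> I" for d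
          using pb that nfr[of d] rd[of d] by (auto simp: btw_def)
        ultimately have "p \<in> U" by (simp add: U_def)
        then have "p \<in> closure (U \<inter> {p. P' (g p)})"
          using open_Int_closure_subset[OF opU] P'[OF gp] by blast
        moreover have "U \<subseteq> btw D I" unfolding U_def btw_def using interior_subset by blast
        ultimately show "p \<in> closure {p \<in> btw D I. P' (g p)}"
          by (rule_tac subsetD[OF closure_mono]) auto
      qed
      have "{u..v} = closure {u<..<v}" using lt[OF s] by simp
      then show ?thesis
        using image_closure_subset[OF continuous_on_subset[OF curve_cont] closed_closure int] by simp
    qed
    then show ?thesis unfolding draw_simps str by (intro UN_least) (simp split: prod.split, blast)
  qed
  show "planar_tangle ?T" unfolding planar_tangle_def
  proof (intro conjI)
    show "finite (inner_discs ?T)" using fin by simp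
    show "\<forall>d\<in>inner_discs ?T. region d \<subseteq> interior (region (outer_disc ?T))" using inn by simp
    show "\<forall>d\<in>inner_discs ?T. \<forall>d'\<in>inner_discs ?T. d \<noteq> d' \<longrightarrow> region d \<inter> region d' = {}"
      using dis by simp
    show "\<exists>C. finite C \<and> (\<forall>c\<in>C. simple_path c) \<and>
          (\<forall>c\<in>C. \<forall>c'\<in>C. c \<noteq> c' \<longrightarrow> path_image c \<inter> path_image c' = {}) \<and>
          strings ?T = (\<Union>c\<in>C. path_image c) \<and>
          all_marks ?T = (\<Union>c\<in>{c\<in>C. arc c}. {pathstart c, pathfinish c})"
    proof (intro exI conjI)
      show "finite (P ` S)" using finS by simp
      show "\<forall>c\<in>P ` S. simple_path c" using arcP arc_imp_simple_path by auto
      have "path_image (P s) \<inter> path_image (P s') = {}" if ss: "s \<in> S" "s' \<in> S" "P s \<noteq> P s'" for s s'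
      proof -
        obtain j u v j' u' v' where e: "s = (j,u,v)" "s' = (j',u',v')" by (metis prod_cases3)
        have "\<gamma> j ` {u..v} \<inter> \<gamma> j' ` {u'..v'} = {}"
        proof (rule ccontr)
          assume "\<gamma> j ` {u..v} \<inter> \<gamma> j' ` {u'..v'} \<noteq> {}"
          then obtain a b where ab: "a \<in> {u..v}" "b \<in> {u'..v'}" "\<gamma> j a = \<gamma> j' b" by blast
          then have jj: "j' = j" "a = b" using curve_inj[OF ab(3)] by auto
          then show False using sep[of j u v u' v'] ss e ab by auto
        qed
        then show ?thesis using pim ss e by metis
      qed
      then show "\<forall>c\<in>P ` S. \<forall>c'\<in>P ` S. c \<noteq> c' \<longrightarrow> path_image c \<inter> path_image c' = {}" by blast
      have "(\<Union>c\<in>P ` S. path_image c) = (\<Union>s\<in>S. path_image (P s))" by simp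
      also have "\<dots> = (\<Union>(j,u,v)\<in>S. \<gamma> j ` {u..v})"
        by (rule SUP_cong) (auto simp: pim split: prod.splits)
      finally show "strings ?T = (\<Union>c\<in>P ` S. path_image c)" using str by simp
      have "(\<Union>c\<in>{c\<in>P ` S. arc c}. {pathstart c, pathfinish c}) = (\<Union>s\<in>S. {pathstart (P s), pathfinish (P s)})"
        using arcP by auto
      also have "\<dots> = (\<Union>(j,u,v)\<in>S. {\<gamma> j u, \<gamma> j v})"
        by (rule SUP_cong) (auto simp: ends split: prod.splits)
      finally show "all_marks ?T = (\<Union>c\<in>{c\<in>P ` S. arc c}. {pathstart c, pathfinish c})"
        using am mk by simp
    qed
    show "strings ?T \<subseteq> between_discs ?T" by auto
    have "(\<Union>d\<in>insert D I. set (marks d)) = (\<Union>d\<in>insert D I. frontier (region d) \<inter> {p. g p = 0})"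
      using fr by (intro SUP_cong) auto
    then show "strings ?T \<inter> (\<Union>d\<in>discs ?T. frontier (region d)) = all_marks ?T"
      unfolding am using frb by (simp add: discs_def) blast
    have "{p \<in> btw D I. g p < 0} = {p \<in> btw D I. g p \<noteq> 0} \<inter> {p. g p < 0}" by auto
    moreover have "open {p. g p < 0}"
      using cont open_Collect_less[of g "\<lambda>_. 0"] by simp
    ultimately show "openin (top_of_set (off_strings ?T)) (shaded ?T)"
      by (auto simp: openin_open)
    have "{p \<in> btw D I. g p < 0} = {p \<in> btw D I. g p \<noteq> 0} \<inter> {p. g p \<le> 0}" by auto
    moreover have "closed {p. g p \<le> 0}"
      using cont closed_Collect_le[of g "\<lambda>_. 0"] by simp
    ultimately show "closedin (top_of_set (off_strings ?T)) (shaded ?T)"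
      by (auto simp: closedin_closed)
    have "off_strings ?T - shaded ?T = {p \<in> btw D I. 0 < g p}" by auto
    then show "strings ?T \<subseteq> closure (shaded ?T) \<inter> closure (off_strings ?T - shaded ?T)"
      using inner_limit[of "\<lambda>x. x < 0"] inner_limit[of "\<lambda>x. 0 < x"] sign_change by simp
    show "\<forall>d\<in>discs ?T. even (length (marks d)) \<and>
        (\<exists>c ts. disc_param d c ts \<and> (c 0 \<in> shaded ?T \<longleftrightarrow> shade d = Minus))"
    proof
      fix d assume "d \<in> discs ?T"
      then have d: "d \<in> insert D I" by (simp add: discs_def)
      obtain c ts where c: "disc_param d c ts" "g (c 0) < 0 \<longleftrightarrow> shade d = Minus"
          "c 0 \<in> frontier (region d)"
        using ad[OF d] by (auto simp: adapted_def)
      have "c 0 \<in> btw D I" using frb[OF d] c(3) by blast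
      then show "even (length (marks d)) \<and>
        (\<exists>c ts. disc_param d c ts \<and> (c 0 \<in> shaded ?T \<longleftrightarrow> shade d = Minus))"
        using c ad[OF d] by (auto simp: adapted_def)
    qed
  qed
qed

lemma drawing_joined_all:
  "drawing g \<gamma> D I S \<Longrightarrow> \<forall>(j,u,v)\<in>S. joined (draw g D I) (\<gamma> j u) (\<gamma> j v) \<and> joined (draw g D I) (\<gamma> j v) (\<gamma> j u)"
  using drawing_joined drawing_joined' by fast

end

lemma drawing_nested: "drawing g \<gamma> D I S \<Longrightarrow> nested D I"
  by (simp add: drawing_def)

section \<open>Composition of tangles in one picture\<close>

text \<open>
  The outer disc of the inserted tangle disappears because its boundary belongs to both parts.
\<close>

lemma btw_plug:
  assumes "nested D I" "d \<in> I" "nested d J"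
  shows "btw D I \<union> btw d J = btw D (I - {d} \<union> J)"
proof -
  have I: "region e \<subseteq> interior (region D)" if "e \<in> I" for e using assms(1) that by (auto simp: nested_def)
  have J: "region e \<subseteq> interior (region d)" if "e \<in> J" for e using assms(3) that by (auto simp: nested_def)
  have dis: "region e \<inter> region d = {}" if "e \<in> I - {d}" for e
    using assms(1,2) that unfolding nested_def by blast
  show ?thesis
  proof (intro equalityI subsetI)
    fix p assume "p \<in> btw D I \<union> btw d J"
    then show "p \<in> btw D (I - {d} \<union> J)"
    proof
      assume p: "p \<in> btw D I"
      have "p \<notin> interior (region e)" if "e \<in> J" for e
        using J[OF that] p assms(2) interior_subset[of "region e"] by (auto simp: btw_def)
      then show ?thesis using p by (auto simp: btw_def)
    next
      assume p: "p \<in> btw d J"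
      have "p \<in> region D" using I[OF assms(2)] p interior_subset[of "region D"] by (auto simp: btw_def)
      moreover have "p \<notin> interior (region e)" if "e \<in> I - {d}" for e
        using dis[OF that] p interior_subset[of "region e"] by (auto simp: btw_def)
      ultimately show ?thesis using p by (auto simp: btw_def)
    qed
  next
    fix p assume p: "p \<in> btw D (I - {d} \<union> J)"
    show "p \<in> btw D I \<union> btw d J"
    proof (cases "p \<in> region d")
      case True
      then show ?thesis using p by (auto simp: btw_def)
    next
      case False
      then have "p \<notin> interior (region d)" using interior_subset by blast
      then show ?thesis using p by (auto simp: btw_def)
    qed
  qed
qed

lemma compose_draw:
  assumes "nested D I" "d \<in> I" "nested d J"
  shows "compose_tangle (draw g D I) d (draw g d J) = draw g D (I - {d} \<union> J)"
  using btw_plug[OF assms] by (auto simp: compose_tangle_def draw_def)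

text \<open>
  Only the signs of the function matter. This passes from a picture with two circles to the one with
  a single circle once the other circle is hidden inside a disc.
\<close>

lemma draw_cong:
  assumes "\<And>p. p \<in> btw D I \<Longrightarrow> sgn (g p) = sgn (g' p)"
  shows "draw g D I = draw g' D I"
proof -
  have "(g p = 0 \<longleftrightarrow> g' p = 0) \<and> (g p < 0 \<longleftrightarrow> g' p < 0)" if "p \<in> btw D I" for p
    using assms[OF that] by (auto simp: sgn_if split: if_splits)
  then show ?thesis by (auto simp: draw_def)
qed

lemma (in planar_algebra) Z_plug:
  assumes "planar_tangle (draw g D I)" "nested D I" "planar_tangle (draw g d J)" "nested d J"
    and "d \<in> I" "K = I - {d} \<union> J"
    and f: "\<And>e. e \<in> K \<Longrightarrow> f e \<in> V (half_marks e) (shade e)"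
  shows "Z (draw g D K) f = Z (draw g D I) (f(d := Z (draw g d J) f))"
  using Z_compose[OF assms(1,3)] compose_draw[OF assms(2,5,4), of g] assms(5,6) f
  by (simp add: labelling_def)

lemma (in planar_algebra) Z_draw_closed:
  assumes "planar_tangle (draw g D I)" "\<And>e. e \<in> I \<Longrightarrow> f e \<in> V (half_marks e) (shade e)"
  shows "Z (draw g D I) f \<in> V (half_marks D) (shade D)"
  using Z_closed[OF assms(1)] assms(2) by (simp add: labelling_def)

lemma (in planar_algebra) Z_draw_cong:
  assumes "planar_tangle (draw g D I)" "\<And>e. e \<in> I \<Longrightarrow> f e \<in> V (half_marks e) (shade e)"
    "\<And>e. e \<in> I \<Longrightarrow> f e = f' e"
  shows "Z (draw g D I) f = Z (draw g D I) f'"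
  using Z_cong[OF assms(1)] assms(2,3) by (simp add: labelling_def)

section \<open>Round discs and a rational circle\<close>

text \<open>
  The parameter \<open>N\<close> is the squared radius, which keeps the data rational.
\<close>

definition rdisc :: "complex \<Rightarrow> real \<Rightarrow> complex list \<Rightarrow> sign \<Rightarrow> disc" where
  "rdisc z N ms s = \<lparr>region = cball z (sqrt N), marks = ms, shade = s\<rparr>"

lemma rdisc_simps [simp]:
  "region (rdisc z N ms s) = cball z (sqrt N)" "marks (rdisc z N ms s) = ms" "shade (rdisc z N ms s) = s"
  by (auto simp: rdisc_def)

lemma half_marks_rdisc [simp]: "half_marks (rdisc z N ms s) = length ms div 2"
  by (simp add: half_marks_def)

lemma dist_sqrt: "dist z p = sqrt ((Re p - Re z)\<^sup>2 + (Im p - Im z)\<^sup>2)"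
  by (simp only: dist_norm cmod_def minus_complex.sel power2_commute[of "Re z"] power2_commute[of "Im z"])

lemma mem_sqrt:
  "p \<in> ball z (sqrt N) \<longleftrightarrow> (Re p - Re z)\<^sup>2 + (Im p - Im z)\<^sup>2 < N"
  "p \<in> cball z (sqrt N) \<longleftrightarrow> (Re p - Re z)\<^sup>2 + (Im p - Im z)\<^sup>2 \<le> N"
  "p \<in> sphere z (sqrt N) \<longleftrightarrow> (Re p - Re z)\<^sup>2 + (Im p - Im z)\<^sup>2 = N"
  by (simp_all only: mem_ball mem_cball mem_sphere dist_sqrt real_sqrt_less_iff real_sqrt_le_iff real_sqrt_eq_iff)

lemma adapted_rdisc:
  assumes "0 < N" "even (length ms)" "q \<in> sphere z (sqrt N)" "g q \<noteq> 0" "g q < 0 \<longleftrightarrow> s = Minus"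
    and ms: "set ms = {p \<in> sphere z (sqrt N). g p = 0}"
    and srt: "sorted_wrt (\<lambda>m m'. orient q m m' < 0) ms"
  shows "adapted g (rdisc z N ms s)"
proof -
  have sub: "set ms \<subseteq> sphere z (sqrt N) - {q}" unfolding ms using assms(4) by blast
  have N: "0 < sqrt N" using assms(1) by simp
  obtain c ts where c: "disc_param (rdisc z N ms s) c ts" "c 0 = q"
    using disc_param_round[OF N assms(3) sub srt, of s] unfolding rdisc_def by blast
  have fr: "frontier (region (rdisc z N ms s)) = sphere z (sqrt N)" using N by simp
  show ?thesis
    unfolding adapted_def
  proof (intro conjI exI)
    show "0 < sqrt N" by (rule N)
    show "region (rdisc z N ms s) = cball z (sqrt N)" by simp
    show "set (marks (rdisc z N ms s)) = {p \<in> sphere z (sqrt N). g p = 0}" unfolding rdisc_simps by (rule ms)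
    show "even (length (marks (rdisc z N ms s)))" using assms(2) by simp
    show "disc_param (rdisc z N ms s) c ts" by (rule c)
    show "c 0 \<in> frontier (region (rdisc z N ms s))" unfolding fr c(2) by (rule assms(3))
    show "g (c 0) \<noteq> 0" "(g (c 0) < 0) = (shade (rdisc z N ms s) = Minus)"
      unfolding c(2) using assms(4,5) by simp_all
  qed
qed

lemma dist_square: "(dist z p)\<^sup>2 = (Re p - Re z)\<^sup>2 + (Im p - Im z)\<^sup>2"
  unfolding dist_sqrt by (rule real_sqrt_pow2) simp

text \<open>
  The inclusion says \<open>d + \<surd>N < \<surd>N'\<close> for the distance \<open>d\<close> of the centres. Squaring twice gives a
  condition on \<open>d\<^sup>2\<close>, \<open>N\<close> and \<open>N'\<close> without roots, decidable by rational arithmetic; the next lemma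
  treats \<open>\<surd>N + \<surd>N' < d\<close> in the same way.
\<close>

lemma cball_sqrt_subset:
  assumes "0 < N" "N < N'"
    and D: "(Re z - Re z')\<^sup>2 + (Im z - Im z')\<^sup>2 < N + N'"
      "4 * N * N' < (N + N' - ((Re z - Re z')\<^sup>2 + (Im z - Im z')\<^sup>2))\<^sup>2"
  shows "cball z (sqrt N) \<subseteq> ball z' (sqrt N')"
proof
  fix p assume p: "p \<in> cball z (sqrt N)"
  define m where "m = sqrt N * sqrt N'"
  have "m\<^sup>2 = N * N'" using assms(1,2) by (simp add: m_def power_mult_distrib)
  then have "(2 * m)\<^sup>2 < (N + N' - ((Re z - Re z')\<^sup>2 + (Im z - Im z')\<^sup>2))\<^sup>2"
    using D(2) by (simp add: power_mult_distrib)
  then have "2 * m < N + N' - ((Re z - Re z')\<^sup>2 + (Im z - Im z')\<^sup>2)"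
    by (rule power_less_imp_less_base) (use D(1) in simp)
  moreover have "(sqrt N' - sqrt N)\<^sup>2 = N + N' - 2 * m"
    using assms(1,2) by (simp add: m_def power2_diff)
  ultimately have "(dist z' z)\<^sup>2 < (sqrt N' - sqrt N)\<^sup>2"
    unfolding dist_square by linarith
  then have "dist z' z < sqrt N' - sqrt N"
    by (rule power_less_imp_less_base) (use assms(2) in simp)
  then show "p \<in> ball z' (sqrt N')"
    using p dist_triangle[of z' p z] by simp
qed

lemma cball_sqrt_disjoint:
  assumes "0 \<le> N" "0 \<le> N'"
    and D: "N + N' < (Re z - Re z')\<^sup>2 + (Im z - Im z')\<^sup>2"
      "4 * N * N' < ((Re z - Re z')\<^sup>2 + (Im z - Im z')\<^sup>2 - N - N')\<^sup>2"
  shows "cball z (sqrt N) \<inter> cball z' (sqrt N') = {}"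
proof (rule disjoint_cballI)
  define m where "m = sqrt N * sqrt N'"
  have "m\<^sup>2 = N * N'" using assms(1,2) by (simp add: m_def power_mult_distrib)
  then have "(2 * m)\<^sup>2 < ((Re z - Re z')\<^sup>2 + (Im z - Im z')\<^sup>2 - N - N')\<^sup>2"
    using D(2) by (simp add: power_mult_distrib)
  then have "2 * m < (Re z - Re z')\<^sup>2 + (Im z - Im z')\<^sup>2 - N - N'"
    by (rule power_less_imp_less_base) (use D(1) in simp)
  moreover have "(sqrt N + sqrt N')\<^sup>2 = N + N' + 2 * m"
    using assms(1,2) by (simp add: m_def power2_sum)
  ultimately have "(sqrt N + sqrt N')\<^sup>2 < (dist z' z)\<^sup>2"
    unfolding dist_square by linarith
  then show "sqrt N + sqrt N' < dist z z'"
    unfolding dist_commute[of z z'] by (rule power_less_imp_less_base) simp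
qed

lemma rdisc_in:
  assumes "0 < N" "N < N'" "(Re z - Re z')\<^sup>2 + (Im z - Im z')\<^sup>2 < N + N'"
    "4 * N * N' < (N + N' - ((Re z - Re z')\<^sup>2 + (Im z - Im z')\<^sup>2))\<^sup>2"
  shows "region (rdisc z N ms s) \<subseteq> interior (region (rdisc z' N' ms' s'))"
  using cball_sqrt_subset[OF assms] by simp

lemma rdisc_off:
  assumes "0 \<le> N" "0 \<le> N'" "N + N' < (Re z - Re z')\<^sup>2 + (Im z - Im z')\<^sup>2"
    "4 * N * N' < ((Re z - Re z')\<^sup>2 + (Im z - Im z')\<^sup>2 - N - N')\<^sup>2"
  shows "region (rdisc z N ms s) \<inter> region (rdisc z' N' ms' s') = {}"
  using cball_sqrt_disjoint[OF assms] by simp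

text \<open>
  Stereographic projection from \<open>- r\<close>, which is the only point of the circle that is not reached
  and corresponds to the parameter \<open>\<infinity>\<close>. Rational parameters give rational points.
\<close>

definition circ :: "real \<Rightarrow> real \<Rightarrow> complex" where
  "circ r t = Complex (r * (1 - t\<^sup>2) / (1 + t\<^sup>2)) (2 * r * t / (1 + t\<^sup>2))"

lemma one_plus_sq [simp]: "1 + (t::real)\<^sup>2 \<noteq> 0" "0 < 1 + (t::real)\<^sup>2"
  using zero_le_power2[of t] by linarith+

lemma circ_on: "(Re (circ r t))\<^sup>2 + (Im (circ r t))\<^sup>2 = r\<^sup>2"
proof -
  have "(r * (1 - t\<^sup>2))\<^sup>2 + (2 * r * t)\<^sup>2 = r\<^sup>2 * (1 + t\<^sup>2)\<^sup>2" by algebra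
  moreover have "(Re (circ r t))\<^sup>2 + (Im (circ r t))\<^sup>2
      = ((r * (1 - t\<^sup>2))\<^sup>2 + (2 * r * t)\<^sup>2) / (1 + t\<^sup>2)\<^sup>2"
    unfolding circ_def complex.sel power_divide add_divide_distrib ..
  ultimately show ?thesis by (simp only: nonzero_mult_div_cancel_right power_not_zero one_plus_sq not_False_eq_True)
qed

lemma circ_shift: "r + Re (circ r t) = 2 * r / (1 + t\<^sup>2)" "Im (circ r t) = t * (r + Re (circ r t))"
proof -
  have "r * (1 + t\<^sup>2) + r * (1 - t\<^sup>2) = 2 * r" by algebra
  then have "r + r * (1 - t\<^sup>2) / (1 + t\<^sup>2) = 2 * r / (1 + t\<^sup>2)"
    using one_plus_sq(1)[of t] by (metis add_divide_distrib nonzero_mult_div_cancel_right)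
  then show e: "r + Re (circ r t) = 2 * r / (1 + t\<^sup>2)" by (simp only: circ_def complex.sel)
  show "Im (circ r t) = t * (r + Re (circ r t))" unfolding e by (simp add: circ_def)
qed

lemma circ_inj: "r \<noteq> 0 \<Longrightarrow> circ r a = circ r b \<Longrightarrow> a = b"
proof -
  assume r: "r \<noteq> 0" and e: "circ r a = circ r b"
  have "r + Re (circ r b) \<noteq> 0" using r one_plus_sq(1)[of b] by (simp only: circ_shift(1)) simp
  moreover have "a * (r + Re (circ r b)) = b * (r + Re (circ r b))"
    using circ_shift(2)[of r a] circ_shift(2)[of r b] e by metis
  ultimately show "a = b" by simp
qed

lemma on_circle_iff:
  assumes "0 < r"
  shows "(Re p)\<^sup>2 + (Im p)\<^sup>2 = r\<^sup>2 \<longleftrightarrow> (\<exists>t. p = circ r t) \<or> p = of_real (- r)"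
proof
  assume p: "(Re p)\<^sup>2 + (Im p)\<^sup>2 = r\<^sup>2"
  show "(\<exists>t. p = circ r t) \<or> p = of_real (- r)"
  proof (cases "r + Re p = 0")
    case True
    then have "Re p = - r" by linarith
    then show ?thesis using p by (simp add: complex_eq_iff)
  next
    case False
    define t where "t = Im p / (r + Re p)"
    have im: "Im p = t * (r + Re p)" using False by (simp add: t_def)
    have "t\<^sup>2 * (r + Re p) * (r + Re p) = (r - Re p) * (r + Re p)"
      using p unfolding im by (simp add: power2_eq_square algebra_simps)
    then have t2: "t\<^sup>2 * (r + Re p) = r - Re p" using False by simp
    have "(Re p * (1 + t\<^sup>2)) * (r + Re p) = (r * (1 - t\<^sup>2)) * (r + Re p)"
      using t2 by algebra
    then have "Re p * (1 + t\<^sup>2) = r * (1 - t\<^sup>2)" using False by simp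
    moreover have "(1 + t\<^sup>2) * (r + Re p) = 2 * r" using t2 by algebra
    then have "Im p * (1 + t\<^sup>2) = 2 * r * t" unfolding im by algebra
    ultimately have "p = circ r t"
      by (simp add: complex_eq_iff circ_def eq_divide_eq)
    then show ?thesis by blast
  qed
qed (auto simp: circ_on)

lemma continuous_circ: "continuous_on A (circ r)"
  unfolding circ_def Complex_eq by (intro continuous_intros ballI) simp_all

text \<open>
  The four possible positions of a disc relative to a curve \<open>c\<close> and the point \<open>w\<close> that \<open>c\<close>
  omits: the disc contains a bounded range of parameters, a neighbourhood of infinity, nothing, or
  the whole curve.
\<close>

definition cuts :: "disc \<Rightarrow> (real \<Rightarrow> complex) \<Rightarrow> complex \<Rightarrow> real \<Rightarrow> real \<Rightarrow> bool" where
  "cuts d c w a b \<longleftrightarrow> (\<forall>t. (c t \<in> region d \<longleftrightarrow> a \<le> t \<and> t \<le> b) \<and> (c t \<in> interior (region d) \<longleftrightarrow> a < t \<and> t < b))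
     \<and> w \<notin> region d"

definition cocuts :: "disc \<Rightarrow> (real \<Rightarrow> complex) \<Rightarrow> complex \<Rightarrow> real \<Rightarrow> real \<Rightarrow> bool" where
  "cocuts d c w a b \<longleftrightarrow> (\<forall>t. (c t \<in> region d \<longleftrightarrow> t \<le> a \<or> b \<le> t) \<and> (c t \<in> interior (region d) \<longleftrightarrow> t < a \<or> b < t))
     \<and> w \<in> interior (region d)"

definition misses :: "disc \<Rightarrow> (real \<Rightarrow> complex) \<Rightarrow> complex \<Rightarrow> bool" where
  "misses d c w \<longleftrightarrow> (\<forall>t. c t \<notin> region d) \<and> w \<notin> region d"

definition swallows :: "disc \<Rightarrow> (real \<Rightarrow> complex) \<Rightarrow> complex \<Rightarrow> bool" where
  "swallows d c w \<longleftrightarrow> (\<forall>t. c t \<in> interior (region d)) \<and> w \<in> interior (region d)"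

text \<open>
  The power of a point of the circle with respect to a second circle is a quadratic polynomial in
  the parameter over \<open>1 + t\<^sup>2\<close>; its leading coefficient is the power of the omitted point.
\<close>

lemma circ_power:
  "(Re (circ r t) - x)\<^sup>2 + (Im (circ r t) - y)\<^sup>2 - N
    = (((r + x)\<^sup>2 + y\<^sup>2 - N) * t\<^sup>2 - 4 * r * y * t + ((r - x)\<^sup>2 + y\<^sup>2 - N)) / (1 + t\<^sup>2)"
proof -
  have "(Re (circ r t) - x)\<^sup>2 + (Im (circ r t) - y)\<^sup>2 - N
      = r\<^sup>2 - 2 * Re (circ r t) * x - 2 * Im (circ r t) * y + x\<^sup>2 + y\<^sup>2 - N"
    using circ_on[of r t] by (simp add: power2_eq_square algebra_simps)
  also have "\<dots> = (r\<^sup>2 * (1 + t\<^sup>2) - 2 * (r * (1 - t\<^sup>2)) * x - 2 * (2 * r * t) * y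
      + (x\<^sup>2 + y\<^sup>2 - N) * (1 + t\<^sup>2)) / (1 + t\<^sup>2)"
  proof -
    have "r\<^sup>2 - 2 * (a / c) * x - 2 * (b / c) * y + x\<^sup>2 + y\<^sup>2 - N
        = (r\<^sup>2 * c - 2 * a * x - 2 * b * y + (x\<^sup>2 + y\<^sup>2 - N) * c) / c" if "c \<noteq> 0" for a b c :: real
      using that by (simp add: field_simps)
    from this[OF one_plus_sq(1)] show ?thesis unfolding circ_def complex.sel .
  qed
  also have "r\<^sup>2 * (1 + t\<^sup>2) - 2 * (r * (1 - t\<^sup>2)) * x - 2 * (2 * r * t) * y + (x\<^sup>2 + y\<^sup>2 - N) * (1 + t\<^sup>2)
     = ((r + x)\<^sup>2 + y\<^sup>2 - N) * t\<^sup>2 - 4 * r * y * t + ((r - x)\<^sup>2 + y\<^sup>2 - N)" by algebra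
  finally show ?thesis .
qed

text \<open>
  The quadratic polynomial of the power has leading coefficient \<open>k\<close> and roots \<open>a\<close> and \<open>b\<close>.
\<close>

definition meets :: "real \<Rightarrow> complex \<Rightarrow> real \<Rightarrow> real \<Rightarrow> real \<Rightarrow> real \<Rightarrow> bool" where
  "meets r z N k a b \<longleftrightarrow> (r + Re z)\<^sup>2 + (Im z)\<^sup>2 - N = k \<and> (r - Re z)\<^sup>2 + (Im z)\<^sup>2 - N = k * a * b \<and>
     4 * r * Im z = k * (a + b)"

lemma meets_power:
  assumes "meets r z N k a b"
  shows "(Re (circ r t) - Re z)\<^sup>2 + (Im (circ r t) - Im z)\<^sup>2 - N = k * ((t - a) * (t - b)) / (1 + t\<^sup>2)"
proof -
  have "k * t\<^sup>2 - k * (a + b) * t + k * a * b = k * ((t - a) * (t - b))"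
    by (simp add: power2_eq_square algebra_simps)
  then show ?thesis using assms by (simp add: circ_power meets_def)
qed

lemma meets_infinity:
  assumes "meets r z N k a b"
  shows "(Re (of_real (- r)) - Re z)\<^sup>2 + (Im (of_real (- r)) - Im z)\<^sup>2 - N = k"
  using assms by (simp add: meets_def power2_eq_square algebra_simps)

lemma quad_sign:
  assumes "a < (b::real)"
  shows "(t - a) * (t - b) < 0 \<longleftrightarrow> a < t \<and> t < b" "(t - a) * (t - b) \<le> 0 \<longleftrightarrow> a \<le> t \<and> t \<le> b"
    "0 < (t - a) * (t - b) \<longleftrightarrow> t < a \<or> b < t" "0 \<le> (t - a) * (t - b) \<longleftrightarrow> t \<le> a \<or> b \<le> t"
  using assms by (auto simp: mult_less_0_iff mult_le_0_iff zero_less_mult_iff zero_le_mult_iff)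

lemma meets_cuts:
  assumes m: "meets r z N k a b" and "0 < k" "a < b"
  shows "cuts (rdisc z N ms s) (circ r) (of_real (- r)) a b"
proof -
  have "(Re (circ r t) - Re z)\<^sup>2 + (Im (circ r t) - Im z)\<^sup>2 < N \<longleftrightarrow> a < t \<and> t < b"
    "(Re (circ r t) - Re z)\<^sup>2 + (Im (circ r t) - Im z)\<^sup>2 \<le> N \<longleftrightarrow> a \<le> t \<and> t \<le> b" for t
  proof -
    have "k * ((t - a) * (t - b)) / (1 + t\<^sup>2) < 0 \<longleftrightarrow> (t - a) * (t - b) < 0"
      "k * ((t - a) * (t - b)) / (1 + t\<^sup>2) \<le> 0 \<longleftrightarrow> (t - a) * (t - b) \<le> 0"
      using assms(2) one_plus_sq(2)[of t]
      by (simp_all only: pos_divide_less_eq pos_divide_le_eq mult_zero_left)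
         (auto simp: mult_less_0_iff mult_le_0_iff)
    then show "(Re (circ r t) - Re z)\<^sup>2 + (Im (circ r t) - Im z)\<^sup>2 < N \<longleftrightarrow> a < t \<and> t < b"
      "(Re (circ r t) - Re z)\<^sup>2 + (Im (circ r t) - Im z)\<^sup>2 \<le> N \<longleftrightarrow> a \<le> t \<and> t \<le> b"
      using meets_power[OF m, of t] quad_sign[OF assms(3), of t] by linarith+
  qed
  then show ?thesis
    using meets_infinity[OF m] assms(2) unfolding cuts_def rdisc_simps interior_cball mem_sqrt by auto
qed

lemma meets_cocuts:
  assumes m: "meets r z N k a b" and "k < 0" "a < b"
  shows "cocuts (rdisc z N ms s) (circ r) (of_real (- r)) a b"
proof -
  have "(Re (circ r t) - Re z)\<^sup>2 + (Im (circ r t) - Im z)\<^sup>2 < N \<longleftrightarrow> t < a \<or> b < t"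
    "(Re (circ r t) - Re z)\<^sup>2 + (Im (circ r t) - Im z)\<^sup>2 \<le> N \<longleftrightarrow> t \<le> a \<or> b \<le> t" for t
  proof -
    have "k * ((t - a) * (t - b)) / (1 + t\<^sup>2) < 0 \<longleftrightarrow> 0 < (t - a) * (t - b)"
      "k * ((t - a) * (t - b)) / (1 + t\<^sup>2) \<le> 0 \<longleftrightarrow> 0 \<le> (t - a) * (t - b)"
      using assms(2) one_plus_sq(2)[of t]
      by (simp_all only: pos_divide_less_eq pos_divide_le_eq mult_zero_left)
         (auto simp: mult_less_0_iff mult_le_0_iff zero_less_mult_iff zero_le_mult_iff)
    then show "(Re (circ r t) - Re z)\<^sup>2 + (Im (circ r t) - Im z)\<^sup>2 < N \<longleftrightarrow> t < a \<or> b < t"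
      "(Re (circ r t) - Re z)\<^sup>2 + (Im (circ r t) - Im z)\<^sup>2 \<le> N \<longleftrightarrow> t \<le> a \<or> b \<le> t"
      using meets_power[OF m, of t] quad_sign[OF assms(3), of t] by linarith+
  qed
  then show ?thesis
    using meets_infinity[OF m] assms(2) unfolding cocuts_def rdisc_simps interior_cball mem_sqrt by auto
qed

text \<open>
  The power of the omitted point plays the part of the leading coefficient.
\<close>

lemma cuts_rdisc:
  assumes "0 < (r + Re z)\<^sup>2 + (Im z)\<^sup>2 - N" "a < b"
    "(r - Re z)\<^sup>2 + (Im z)\<^sup>2 - N = ((r + Re z)\<^sup>2 + (Im z)\<^sup>2 - N) * a * b"
    "4 * r * Im z = ((r + Re z)\<^sup>2 + (Im z)\<^sup>2 - N) * (a + b)"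
  shows "cuts (rdisc z N ms s) (circ r) (of_real (- r)) a b"
  by (rule meets_cuts[OF _ assms(1,2)]) (simp only: meets_def assms(3,4) simp_thms)

lemma cocuts_rdisc:
  assumes "(r + Re z)\<^sup>2 + (Im z)\<^sup>2 - N < 0" "a < b"
    "(r - Re z)\<^sup>2 + (Im z)\<^sup>2 - N = ((r + Re z)\<^sup>2 + (Im z)\<^sup>2 - N) * a * b"
    "4 * r * Im z = ((r + Re z)\<^sup>2 + (Im z)\<^sup>2 - N) * (a + b)"
  shows "cocuts (rdisc z N ms s) (circ r) (of_real (- r)) a b"
  by (rule meets_cocuts[OF _ assms(1,2)]) (simp only: meets_def assms(3,4) simp_thms)

lemma circ_mem:
  "circ r t \<in> cball 0 (sqrt (r\<^sup>2))" "of_real (- r) \<in> cball (0::complex) (sqrt (r\<^sup>2))"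
  "circ r t \<notin> ball 0 (sqrt (r\<^sup>2))" "of_real (- r) \<notin> ball (0::complex) (sqrt (r\<^sup>2))"
  using circ_on[of r t] unfolding mem_sqrt by auto

text \<open>
  These three positions relative to the whole circle are inclusions or disjointness of round discs.
\<close>

lemma swallows_rdisc:
  assumes "0 < r" "r\<^sup>2 < N" "(Re z)\<^sup>2 + (Im z)\<^sup>2 < r\<^sup>2 + N"
    "4 * r\<^sup>2 * N < (r\<^sup>2 + N - ((Re z)\<^sup>2 + (Im z)\<^sup>2))\<^sup>2"
  shows "swallows (rdisc z N ms s) (circ r) (of_real (- r))"
proof -
  have "cball 0 (sqrt (r\<^sup>2)) \<subseteq> ball z (sqrt N)"
    by (rule cball_sqrt_subset) (use assms in simp_all)
  then show ?thesis
    unfolding swallows_def rdisc_simps interior_cball using circ_mem(1,2)[of r] by blast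
qed

lemma misses_rdisc:
  assumes "0 \<le> N" "r\<^sup>2 + N < (Re z)\<^sup>2 + (Im z)\<^sup>2"
    "4 * r\<^sup>2 * N < ((Re z)\<^sup>2 + (Im z)\<^sup>2 - r\<^sup>2 - N)\<^sup>2"
  shows "misses (rdisc z N ms s) (circ r) (of_real (- r))"
proof -
  have "cball 0 (sqrt (r\<^sup>2)) \<inter> cball z (sqrt N) = {}"
    by (rule cball_sqrt_disjoint) (use assms in simp_all)
  then show ?thesis
    unfolding misses_def rdisc_simps using circ_mem(1,2)[of r] by blast
qed

lemma misses_rdisc_inside:
  assumes "0 < N" "N < r\<^sup>2" "(Re z)\<^sup>2 + (Im z)\<^sup>2 < N + r\<^sup>2"
    "4 * N * r\<^sup>2 < (N + r\<^sup>2 - ((Re z)\<^sup>2 + (Im z)\<^sup>2))\<^sup>2"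
  shows "misses (rdisc z N ms s) (circ r) (of_real (- r))"
proof -
  have "cball z (sqrt N) \<subseteq> ball 0 (sqrt (r\<^sup>2))"
    by (rule cball_sqrt_subset) (use assms in simp_all)
  then show ?thesis
    unfolding misses_def rdisc_simps using circ_mem(3,4)[of r] by blast
qed

text \<open>
  The common content of the four positions: the parameters at which the curve meets the boundary.
\<close>

definition crossing :: "disc \<Rightarrow> (real \<Rightarrow> complex) \<Rightarrow> complex \<Rightarrow> real set \<Rightarrow> bool" where
  "crossing d c w S \<longleftrightarrow> (\<forall>t. c t \<in> frontier (region d) \<longleftrightarrow> t \<in> S) \<and> w \<notin> frontier (region d)"

lemma frontier_rdisc: "0 < N \<Longrightarrow> frontier (region (rdisc z N ms s)) = region (rdisc z N ms s) - interior (region (rdisc z N ms s))"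
  by auto

lemma crossing_general:
  assumes F: "frontier (region d) = region d - interior (region d)"
  shows "a < b \<Longrightarrow> cuts d c w a b \<Longrightarrow> crossing d c w {a, b}"
    "a < b \<Longrightarrow> cocuts d c w a b \<Longrightarrow> crossing d c w {a, b}"
    "misses d c w \<Longrightarrow> crossing d c w {}" "swallows d c w \<Longrightarrow> crossing d c w {}"
proof -
  have I: "crossing d c w S" if "\<And>t. c t \<in> region d \<and> c t \<notin> interior (region d) \<longleftrightarrow> t \<in> S"
    "w \<notin> region d \<or> w \<in> interior (region d)" for S
    unfolding crossing_def F using that by blast
  show "crossing d c w {a, b}" if ab: "a < b" and c: "cuts d c w a b"
  proof (rule I)
    fix t
    have "c t \<in> region d \<longleftrightarrow> a \<le> t \<and> t \<le> b" "c t \<in> interior (region d) \<longleftrightarrow> a < t \<and> t < b"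
      using c unfolding cuts_def by blast+
    then show "c t \<in> region d \<and> c t \<notin> interior (region d) \<longleftrightarrow> t \<in> {a, b}" using ab by auto
  qed (use c in \<open>simp add: cuts_def\<close>)
  show "crossing d c w {a, b}" if ab: "a < b" and c: "cocuts d c w a b"
  proof (rule I)
    fix t
    have "c t \<in> region d \<longleftrightarrow> t \<le> a \<or> b \<le> t" "c t \<in> interior (region d) \<longleftrightarrow> t < a \<or> b < t"
      using c unfolding cocuts_def by blast+
    then show "c t \<in> region d \<and> c t \<notin> interior (region d) \<longleftrightarrow> t \<in> {a, b}" using ab by auto
  qed (use c in \<open>simp add: cocuts_def\<close>)
  show "crossing d c w {}" if "misses d c w" using that by (intro I) (auto simp: misses_def)
  show "crossing d c w {}" if "swallows d c w" using that by (intro I) (auto simp: swallows_def)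
qed

lemmas crossing_cuts = crossing_general(1)[OF frontier_rdisc]
lemmas crossing_cocuts = crossing_general(2)[OF frontier_rdisc]
lemmas crossing_misses = crossing_general(3)[OF frontier_rdisc]
lemmas crossing_swallows = crossing_general(4)[OF frontier_rdisc]

lemma cutsD: "cuts d c w a b \<Longrightarrow> (c t \<in> region d) = (a \<le> t \<and> t \<le> b) \<and>
    (c t \<in> interior (region d)) = (a < t \<and> t < b) \<and> (w \<in> region d) = False \<and> (w \<in> interior (region d)) = False"
  using interior_subset[of "region d"] unfolding cuts_def by blast

lemma cocutsD: "cocuts d c w a b \<Longrightarrow> (c t \<in> region d) = (t \<le> a \<or> b \<le> t) \<and>
    (c t \<in> interior (region d)) = (t < a \<or> b < t) \<and> (w \<in> region d) = True \<and> (w \<in> interior (region d)) = True"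
  using interior_subset[of "region d"] unfolding cocuts_def by blast

lemma missesD: "misses d c w \<Longrightarrow> (c t \<in> region d) = False \<and>
    (c t \<in> interior (region d)) = False \<and> (w \<in> region d) = False \<and> (w \<in> interior (region d)) = False"
  using interior_subset[of "region d"] unfolding misses_def by blast

lemma swallowsD: "swallows d c w \<Longrightarrow> (c t \<in> region d) = True \<and>
    (c t \<in> interior (region d)) = True \<and> (w \<in> region d) = True \<and> (w \<in> interior (region d)) = True"
  using interior_subset[of "region d"] unfolding swallows_def by blast

section \<open>Shading signs and changes of sign\<close>

lemma flip_flip [simp]: "flip (flip s) = s"
  by (cases s) auto

lemma flip_neq [simp]: "flip s \<noteq> s" "s \<noteq> flip s"
  by (cases s; simp)+

text \<open>
  A factor \<open>eps s\<close> in front of a function makes the region where the function is positive carry the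
  shade \<open>s\<close>, so one picture serves both shadings.
\<close>

definition eps :: "sign \<Rightarrow> real" where
  "eps s = (case s of Plus \<Rightarrow> 1 | Minus \<Rightarrow> -1)"

lemma eps_neq_0 [simp]: "eps s \<noteq> 0"
  by (simp add: eps_def split: sign.split)

lemma eps_flip [simp]: "eps (flip s) = - eps s"
  by (cases s) (auto simp: eps_def)

lemma eps_eps [simp]: "eps s * (eps s * x) = x"
  by (cases s) (auto simp: eps_def)

lemma eps_positive: "0 < eps s * x \<Longrightarrow> x \<noteq> 0 \<and> (x < 0 \<longleftrightarrow> s = Minus)"
  by (cases s) (auto simp: eps_def)

text \<open>
  A change of sign is detected along a straight segment issuing from the zero.
\<close>

lemma closure_along:
  fixes p v :: complex
  assumes "0 < e" "\<And>t. 0 < t \<Longrightarrow> t < e \<Longrightarrow> p + of_real t * v \<in> S"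
  shows "p \<in> closure S"
proof -
  define t where "t n = e / 2 * inverse (real (Suc n))" for n
  have "0 < t n \<and> t n < e" for n
  proof -
    have "inverse (real (Suc n)) \<le> 1" by (simp add: field_simps)
    then have "t n \<le> e / 2 * 1" unfolding t_def using assms(1) by (intro mult_left_mono) auto
    then show ?thesis using assms(1) by (simp add: t_def)
  qed
  then have "p + of_real (t n) * v \<in> S" for n using assms(2) by blast
  moreover have "(\<lambda>n. p + of_real (t n) * v) \<longlonglongrightarrow> p + of_real (e / 2 * 0) * v"
    unfolding t_def by (intro tendsto_intros LIMSEQ_inverse_real_of_nat)
  ultimately show ?thesis unfolding closure_sequential
    by (intro exI[of _ "\<lambda>n. p + of_real (t n) * v"]) simp
qed

text \<open>
  For a product of two functions it suffices that one of them changes sign where the other is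
  nonzero; thus disjoint curves can be treated one at a time.
\<close>

lemma sign_change_mult:
  fixes f h :: "complex \<Rightarrow> real"
  assumes "p \<in> closure {p. f p < 0} \<and> p \<in> closure {p. 0 < f p}" "continuous_on UNIV h" "h p \<noteq> 0"
  shows "p \<in> closure {p. f p * h p < 0} \<and> p \<in> closure {p. 0 < f p * h p}"
proof -
  define U where "U = {x. 0 < h x * sgn (h p)}"
  have U: "open U" "p \<in> U" unfolding U_def using assms(2,3)
    by (auto intro!: open_Collect_less continuous_intros simp: abs_sgn[symmetric])
  have cl: "p \<in> closure (U \<inter> S)" if "p \<in> closure S" for S
    using open_Int_closure_subset[OF U(1)] U(2) that by blast
  have sub: "U \<inter> {p. f p < 0} \<subseteq> {x. 0 < h p \<and> f x * h x < 0 \<or> h p < 0 \<and> 0 < f x * h x}"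
    "U \<inter> {p. 0 < f p} \<subseteq> {x. 0 < h p \<and> 0 < f x * h x \<or> h p < 0 \<and> f x * h x < 0}"
    using assms(3) by (auto simp: U_def sgn_if mult_less_0_iff zero_less_mult_iff)
  show ?thesis
    using cl[of "{p. f p < 0}"] cl[of "{p. 0 < f p}"] closure_mono[OF sub(1)] closure_mono[OF sub(2)] assms(1,3)
    by (cases "0 < h p") auto
qed

lemma sign_change_eps:
  assumes "p \<in> closure {p. f p < 0} \<and> p \<in> closure {p. 0 < f p}"
  shows "p \<in> closure {p. eps s * f p < 0} \<and> p \<in> closure {p. 0 < eps s * f p}"
  using assms by (cases s) (auto simp: eps_def)

text \<open>
  Reduces the description of the strings to membership of curve points in the discs. The set \<open>P\<close>
  holds the zeros omitted by the curves, which have to be hidden inside discs.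
\<close>

lemma drawingI:
  assumes "nested D I" "\<And>d. d \<in> insert D I \<Longrightarrow> adapted g d" "finite S"
    and "\<forall>(j,u,v)\<in>S. u < v"
    and "\<forall>(j,u,v)\<in>S. \<forall>(j',u',v')\<in>S. j = j' \<longrightarrow> (u,v) = (u',v') \<or> v < u' \<or> v' < u"
    and zero: "\<And>p. g p = 0 \<longleftrightarrow> (\<exists>j t. p = \<gamma> j t) \<or> p \<in> P"
    and P: "\<And>p. p \<in> P \<Longrightarrow> p \<notin> btw D I"
    and str: "\<And>j t. \<gamma> j t \<in> btw D I \<longleftrightarrow> (\<exists>(j',u,v)\<in>S. j' = j \<and> u \<le> t \<and> t \<le> v)"
    and mk: "(\<Union>d\<in>insert D I. set (marks d)) = (\<Union>(j,u,v)\<in>S. {\<gamma> j u, \<gamma> j v})"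
  shows "drawing g \<gamma> D I S"
proof -
  have "{p \<in> btw D I. g p = 0} = (\<Union>(j,u,v)\<in>S. \<gamma> j ` {u..v})"
  proof (intro equalityI subsetI)
    fix p assume p: "p \<in> {p \<in> btw D I. g p = 0}"
    then obtain j t where jt: "p = \<gamma> j t" using zero P by blast
    then obtain j' u v where s: "(j',u,v) \<in> S" "j' = j" "u \<le> t" "t \<le> v" using str p by fast
    then have "p \<in> \<gamma> j ` {u..v}" using jt by simp
    then show "p \<in> (\<Union>(j,u,v)\<in>S. \<gamma> j ` {u..v})" using s(1,2) by blast
  next
    fix p assume "p \<in> (\<Union>(j,u,v)\<in>S. \<gamma> j ` {u..v})"
    then obtain j u v t where s: "(j,u,v) \<in> S" "u \<le> t" "t \<le> v" "p = \<gamma> j t" by auto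
    then have "p \<in> btw D I" using str by fast
    then show "p \<in> {p \<in> btw D I. g p = 0}" using zero s(4) by blast
  qed
  then show ?thesis unfolding drawing_def using assms(1-5) mk by (intro conjI) blast+
qed

section \<open>One line: products and the half turn\<close>

text \<open>
  The string is the imaginary axis; the half plane on its left has shade \<open>s\<close>.
\<close>

definition lineg :: "sign \<Rightarrow> complex \<Rightarrow> real" where
  "lineg s p = eps s * (- Re p)"

definition linec :: "unit \<Rightarrow> real \<Rightarrow> complex" where
  "linec j t = Complex 0 t"

definition sgnf :: "bool \<Rightarrow> sign \<Rightarrow> sign" where
  "sgnf f s = (if f then flip s else s)"

lemma sgnf_simps [simp]: "sgnf False s = s" "sgnf True s = flip s" "sgnf (\<not> f) s = flip (sgnf f s)"
  by (auto simp: sgnf_def)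

text \<open>
  The disc with diameter \<open>[a, b]\<close> on the string. It stands upright for \<open>f = False\<close>, with top \<open>b\<close>
  and the distinguished interval on the left; for \<open>f = True\<close> it is upside down, with top \<open>a\<close> and the
  distinguished interval on the right, where the shade is opposite.
\<close>

definition ldisc :: "bool \<Rightarrow> real \<Rightarrow> real \<Rightarrow> sign \<Rightarrow> disc" where
  "ldisc f a b s = rdisc (Complex 0 ((a + b) / 2)) (((b - a) / 2)\<^sup>2)
     (if f then [Complex 0 a, Complex 0 b] else [Complex 0 b, Complex 0 a]) (sgnf f s)"

lemma shade_ldisc [simp]: "shade (ldisc f a b s) = sgnf f s"
  by (simp add: ldisc_def)

lemma marks_ldisc:
  "marks (ldisc f a b s) = (if f then [Complex 0 a, Complex 0 b] else [Complex 0 b, Complex 0 a])"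
  by (simp add: ldisc_def)

lemma half_marks_ldisc [simp]: "half_marks (ldisc f a b s) = 1"
  by (simp add: ldisc_def)

lemma region_ldisc: "a < b \<Longrightarrow> region (ldisc f a b s) = cball (Complex 0 ((a + b) / 2)) ((b - a) / 2)"
  by (simp add: ldisc_def)

lemma ldisc_eq [simp]:
  "a < b \<Longrightarrow> a' < b' \<Longrightarrow> ldisc f a b s = ldisc f' a' b' s' \<longleftrightarrow> f = f' \<and> a = a' \<and> b = b' \<and> s = s'"
proof
  assume l: "a < b" "a' < b'" and e: "ldisc f a b s = ldisc f' a' b' s'"
  have "marks (ldisc f a b s) = marks (ldisc f' a' b' s')" "shade (ldisc f a b s) = shade (ldisc f' a' b' s')"
    unfolding e by simp_all
  then show "f = f' \<and> a = a' \<and> b = b' \<and> s = s'"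
    using l by (cases f; cases f'; cases s; cases s') (auto simp: marks_ldisc)
qed auto

lemma dist_line: "dist (Complex 0 a) (Complex 0 b) = \<bar>a - b\<bar>"
  by (simp add: dist_norm cmod_def power2_eq_square[symmetric])

lemma linec_ldisc:
  assumes "a < b"
  shows "linec j t \<in> region (ldisc f a b s) \<longleftrightarrow> a \<le> t \<and> t \<le> b"
    "linec j t \<in> interior (region (ldisc f a b s)) \<longleftrightarrow> a < t \<and> t < b"
  unfolding region_ldisc[OF assms] interior_cball linec_def mem_cball mem_ball dist_line
  by (auto simp: abs_le_iff abs_less_iff field_simps)

lemma ldisc_subset:
  assumes "A < a" "a < b" "b < B"
  shows "region (ldisc f a b s) \<subseteq> interior (region (ldisc f' A B s))"
proof -
  have "A < B" using assms by simp
  have "dist (Complex 0 ((a + b) / 2)) (Complex 0 ((A + B) / 2)) + (b - a) / 2 < (B - A) / 2"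
    unfolding dist_line using assms by (auto simp: abs_if field_simps)
  then show ?thesis
    unfolding region_ldisc[OF assms(2)] region_ldisc[OF \<open>A < B\<close>] interior_cball
    by (simp add: cball_subset_ball_iff dist_commute)
qed

lemma ldisc_disjoint:
  assumes "a < b" "b < c" "c < d"
  shows "region (ldisc f a b s) \<inter> region (ldisc f' c d s) = {}"
proof -
  have "dist (Complex 0 ((a + b) / 2)) (Complex 0 ((c + d) / 2)) > (b - a) / 2 + (d - c) / 2"
    unfolding dist_line using assms by (auto simp: abs_if field_simps)
  then show ?thesis
    unfolding region_ldisc[OF assms(1)] region_ldisc[OF assms(3)] by (intro disjoint_cballI) simp
qed

lemma picture_line: "picture (lineg s) linec"
proof
  show "continuous_on UNIV (lineg s)" unfolding lineg_def by (intro continuous_intros)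
  show "continuous_on UNIV (linec j)" for j unfolding linec_def Complex_eq by (intro continuous_intros)
  show "i = j \<and> a = b" if "linec i a = linec j b" for i j a b using that by (simp add: linec_def)
  fix p assume p: "lineg s p = 0"
  have "p \<in> closure {p. - Re p < 0}" "p \<in> closure {p. 0 < - Re p}"
    using p closure_along[of 1 p 1 "{p. - Re p < 0}"] closure_along[of 1 p "- 1" "{p. 0 < - Re p}"]
    by (auto simp: lineg_def)
  then show "p \<in> closure {p. lineg s p < 0} \<and> p \<in> closure {p. 0 < lineg s p}"
    unfolding lineg_def by (intro sign_change_eps) blast
qed

interpretation line: picture "lineg s" linec for s
  by (rule picture_line)

lemma lineg_zero: "lineg s p = 0 \<longleftrightarrow> (\<exists>j t. p = linec j t) \<or> p \<in> {}"
  by (auto simp: lineg_def linec_def complex_eq_iff)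

lemma adapted_ldisc:
  assumes "a < b"
  shows "adapted (lineg s) (ldisc f a b s)"
proof -
  have sph: "{p \<in> sphere (Complex 0 ((a + b) / 2)) (sqrt (((b - a) / 2)\<^sup>2)). lineg s p = 0}
      = {Complex 0 a, Complex 0 b}"
  proof (intro equalityI subsetI)
    fix p assume "p \<in> {p \<in> sphere (Complex 0 ((a + b) / 2)) (sqrt (((b - a) / 2)\<^sup>2)). lineg s p = 0}"
    then have p: "(Im p - (a + b) / 2)\<^sup>2 = ((b - a) / 2)\<^sup>2" "Re p = 0"
      unfolding mem_Collect_eq mem_sqrt by (auto simp: lineg_def)
    then have "Im p = a \<or> Im p = b" by (auto simp: power2_eq_iff field_simps)
    then show "p \<in> {Complex 0 a, Complex 0 b}" using p(2) by (auto simp: complex_eq_iff)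
  next
    fix p assume "p \<in> {Complex 0 a, Complex 0 b}"
    then show "p \<in> {p \<in> sphere (Complex 0 ((a + b) / 2)) (sqrt (((b - a) / 2)\<^sup>2)). lineg s p = 0}"
      unfolding mem_Collect_eq mem_sqrt by (auto simp: lineg_def power2_eq_square field_simps)
  qed
  show ?thesis
    unfolding ldisc_def
  proof (rule adapted_rdisc[where q = "Complex (if f then (b - a) / 2 else - (b - a) / 2) ((a + b) / 2)"])
    show "Complex (if f then (b - a) / 2 else - (b - a) / 2) ((a + b) / 2)
        \<in> sphere (Complex 0 ((a + b) / 2)) (sqrt (((b - a) / 2)\<^sup>2))"
      unfolding mem_sqrt by (cases f) (simp_all add: power_divide power2_commute)
    show "lineg s (Complex (if f then (b - a) / 2 else - (b - a) / 2) ((a + b) / 2)) \<noteq> 0"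
      using assms by (simp add: lineg_def)
    show "lineg s (Complex (if f then (b - a) / 2 else - (b - a) / 2) ((a + b) / 2)) < 0 \<longleftrightarrow> sgnf f s = Minus"
      using assms by (cases f; cases s; simp add: lineg_def eps_def)
    show "sorted_wrt (\<lambda>m m'. orient (Complex (if f then (b - a) / 2 else - (b - a) / 2) ((a + b) / 2)) m m' < 0)
       (if f then [Complex 0 a, Complex 0 b] else [Complex 0 b, Complex 0 a])"
    proof -
      have "(b - a) * (b - a) > 0" using assms by simp
      then show ?thesis by (simp add: orient_def field_simps)
    qed
    show "set (if f then [Complex 0 a, Complex 0 b] else [Complex 0 b, Complex 0 a])
      = {p \<in> sphere (Complex 0 ((a + b) / 2)) (sqrt (((b - a) / 2)\<^sup>2)). lineg s p = 0}"
      unfolding sph by auto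
  qed (use assms in auto)
qed

lemma line_one:
  assumes "A < a" "a < b" "b < B"
  shows "drawing (lineg s) linec (ldisc f A B s) {ldisc f' a b s} {((), A, a), ((), b, B)}"
proof (rule drawingI[OF _ _ _ _ _ lineg_zero])
  show "nested (ldisc f A B s) {ldisc f' a b s}"
    using ldisc_subset[OF assms] by (simp add: nested_def)
  show "linec j t \<in> btw (ldisc f A B s) {ldisc f' a b s}
      \<longleftrightarrow> (\<exists>(j', u, v)\<in>{((), A, a), ((), b, B)}. j' = j \<and> u \<le> t \<and> t \<le> v)" for j t
    using assms by (auto simp: btw_def linec_ldisc)
  show "(\<Union>d\<in>insert (ldisc f A B s) {ldisc f' a b s}. set (marks d))
      = (\<Union>(j, u, v)\<in>{((), A, a), ((), b, B)}. {linec j u, linec j v})"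
    by (auto simp: marks_ldisc linec_def)
qed (use assms in \<open>auto intro!: adapted_ldisc\<close>)

lemma line_two:
  assumes "A < a" "a < b" "b < c" "c < d" "d < B"
  shows "drawing (lineg s) linec (ldisc f A B s) {ldisc f' a b s, ldisc f'' c d s}
    {((), A, a), ((), b, c), ((), d, B)}"
proof (rule drawingI[OF _ _ _ _ _ lineg_zero])
  show "nested (ldisc f A B s) {ldisc f' a b s, ldisc f'' c d s}"
    using ldisc_subset[of A a b B f' s f] ldisc_subset[of A c d B f'' s f] assms
      ldisc_disjoint[of a b c d f' s f''] by (auto simp: nested_def)
  show "linec j t \<in> btw (ldisc f A B s) {ldisc f' a b s, ldisc f'' c d s}
      \<longleftrightarrow> (\<exists>(j', u, v)\<in>{((), A, a), ((), b, c), ((), d, B)}. j' = j \<and> u \<le> t \<and> t \<le> v)" for j t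
    using assms by (auto simp: btw_def linec_ldisc)
  show "(\<Union>d\<in>insert (ldisc f A B s) {ldisc f' a b s, ldisc f'' c d s}. set (marks d))
      = (\<Union>(j, u, v)\<in>{((), A, a), ((), b, c), ((), d, B)}. {linec j u, linec j v})"
    by (auto simp: marks_ldisc linec_def)
qed (use assms in \<open>auto intro!: adapted_ldisc\<close>)

text \<open>
  A box inside a box standing the other way is the half turn, without any string being bent.
\<close>

lemma line_rotation_tangle:
  assumes "A < a" "a < b" "b < B"
  shows "rotation_tangle (flip (sgnf f s)) (draw (lineg s) (ldisc f A B s) {ldisc (\<not> f) a b s}) (ldisc (\<not> f) a b s)"
proof -
  note D = line_one[OF assms, of s f "\<not> f"]
  note J = line.drawing_joined[OF D] line.drawing_joined'[OF D]
  have "joined (draw (lineg s) (ldisc f A B s) {ldisc (\<not> f) a b s}) (Complex 0 A) (Complex 0 a)"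
    "joined (draw (lineg s) (ldisc f A B s) {ldisc (\<not> f) a b s}) (Complex 0 B) (Complex 0 b)"
    using J(1)[of "()" A a] J(2)[of "()" b B] by (simp_all add: linec_def)
  then show ?thesis
    unfolding rotation_tangle_def
    using line.drawing_planar[OF D] line.drawing_no_closed[OF D]
    by (cases f) (auto simp: box_type_def top_mark_def bot_mark_def marks_ldisc)
qed

text \<open>
  Upside down, the box further up in the plane is the lower factor.
\<close>

lemma line_stacking_tangle:
  assumes "A < a" "a < b" "b < c" "c < d" "d < B"
  shows "stacking_tangle 1 (sgnf f s) (draw (lineg s) (ldisc f A B s) {ldisc f a b s, ldisc f c d s})
     (if f then ldisc f c d s else ldisc f a b s) (if f then ldisc f a b s else ldisc f c d s)"
proof -
  note D = line_two[OF assms, of s f f f]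
  note J = line.drawing_joined[OF D] line.drawing_joined'[OF D]
  have "joined (draw (lineg s) (ldisc f A B s) {ldisc f a b s, ldisc f c d s}) (Complex 0 A) (Complex 0 a)"
    "joined (draw (lineg s) (ldisc f A B s) {ldisc f a b s, ldisc f c d s}) (Complex 0 a) (Complex 0 A)"
    "joined (draw (lineg s) (ldisc f A B s) {ldisc f a b s, ldisc f c d s}) (Complex 0 b) (Complex 0 c)"
    "joined (draw (lineg s) (ldisc f A B s) {ldisc f a b s, ldisc f c d s}) (Complex 0 c) (Complex 0 b)"
    "joined (draw (lineg s) (ldisc f A B s) {ldisc f a b s, ldisc f c d s}) (Complex 0 d) (Complex 0 B)"
    "joined (draw (lineg s) (ldisc f A B s) {ldisc f a b s, ldisc f c d s}) (Complex 0 B) (Complex 0 d)"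
    using J(1)[of "()" A a] J(2)[of "()" A a] J(1)[of "()" b c] J(2)[of "()" b c] J(1)[of "()" d B] J(2)[of "()" d B]
    by (simp_all add: linec_def)
  then show ?thesis
    unfolding stacking_tangle_def
    using line.drawing_planar[OF D] line.drawing_no_closed[OF D] assms
    by (cases f) (auto simp: box_type_def top_mark_def bot_mark_def marks_ldisc)
qed

lemma image_btw:
  assumes "inj h" "\<And>d :: disc. interior (h ` region d) = h ` interior (region d)"
  shows "h ` btw D I = h ` region D - (\<Union>d\<in>I. interior (h ` region d))"
  unfolding btw_def assms(2) using assms(1) by (simp add: image_set_diff image_UN)

lemma image_level:
  assumes "\<And>p. g (h p) = g' p"
  shows "h ` {p \<in> S. P (g' p)} = {p \<in> h ` S. P (g p)}"
  using assms by auto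

lemma interior_cnj: "interior (cnj ` R) = cnj ` interior R"
  by (rule interior_injective_linear_image)
     (auto intro!: bounded_linear.linear bounded_linear_cnj simp: inj_def)

text \<open>
  A picture symmetric under complex conjugation turns a reflected tangle into another choice of
  discs, which is how the involution is computed.
\<close>

lemma reflect_draw:
  assumes "\<And>p. g (cnj p) = g p"
  shows "reflect_tangle (draw g D I) = draw g (reflect_disc D) (reflect_disc ` I)"
proof -
  have "cnj ` btw D I = btw (reflect_disc D) (reflect_disc ` I)"
    using image_btw[of cnj D I] interior_cnj by (simp add: btw_def reflect_disc_def inj_def)
  then show ?thesis
    using image_level[of g cnj g "btw D I" "\<lambda>x. x = 0"] image_level[of g cnj g "btw D I" "\<lambda>x. x < 0"] assms
    by (simp add: reflect_tangle_def draw_def)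
qed

lemma cnj_cball: "cnj ` cball z r = cball (cnj z) r"
proof (intro equalityI subsetI)
  fix p assume "p \<in> cnj ` cball z r"
  then show "p \<in> cball (cnj z) r"
    by (auto simp: dist_norm simp flip: complex_cnj_diff)
next
  fix p assume "p \<in> cball (cnj z) r"
  then have "cmod (cnj (cnj z - p)) \<le> r" unfolding complex_mod_cnj by (simp add: dist_norm)
  then have "cnj p \<in> cball z r" by (simp add: dist_norm)
  then show "p \<in> cnj ` cball z r" by (metis complex_cnj_cnj imageI)
qed

lemma reflect_rdisc: "reflect_disc (rdisc z N ms s) = rdisc (cnj z) N (rev (map cnj ms)) s"
  by (simp add: rdisc_def reflect_disc_def cnj_cball)

lemma reflect_ldisc: "reflect_disc (ldisc e a b s) = ldisc e (- b) (- a) s"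
proof -
  have e: "- ((a + b) / 2) = (- b - a) / 2" by (simp add: field_simps)
  show ?thesis unfolding ldisc_def reflect_rdisc by (simp add: complex_cnj e)
qed

abbreviation (input) boxes :: "(nat \<Rightarrow> sign \<Rightarrow> 'v star_algebra) \<Rightarrow> nat \<Rightarrow> sign \<Rightarrow> 'v set" where
  "boxes A \<equiv> \<lambda>n s. carrier (A n s)"

context cstar_planar_algebra
begin

lemma mnd: "monoid (A n s)" using cstar[of n s] by (simp add: fin_dim_cstar_algebra_def)

lemma one_closed [simp]: "\<one>\<^bsub>A n s\<^esub> \<in> carrier (A n s)" by (rule monoid.one_closed[OF mnd])

lemma mult_closed [simp]:
  "x \<in> carrier (A n s) \<Longrightarrow> y \<in> carrier (A n s) \<Longrightarrow> x \<otimes>\<^bsub>A n s\<^esub> y \<in> carrier (A n s)"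
  by (rule monoid.m_closed[OF mnd])

lemma star_closed [simp]: "x \<in> carrier (A n s) \<Longrightarrow> star (A n s) x \<in> carrier (A n s)"
  using fin_dim_cstar_algebra.star_closed[OF cstar] .

context
  fixes rot
  assumes rot: "is_rotation (boxes A) Z rot"
begin

lemma rot_tangle: "rotation_tangle s T d \<Longrightarrow> y \<in> carrier (A 1 s) \<Longrightarrow> rot s y = Z T (\<lambda>_. y)"
  using rot by (auto simp: is_rotation_def)

lemma rot_draw:
  assumes "A' < a" "a < b" "b < B" "f (ldisc (\<not> e) a b s) \<in> carrier (A 1 (flip (sgnf e s)))"
  shows "Z (draw (lineg s) (ldisc e A' B s) {ldisc (\<not> e) a b s}) f
    = rot (flip (sgnf e s)) (f (ldisc (\<not> e) a b s))"
proof -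
  note D = line_one[OF assms(1-3), of s e "\<not> e"]
  show ?thesis
    unfolding rot_tangle[OF line_rotation_tangle[OF assms(1-3)] assms(4)]
    by (rule Z_draw_cong[OF line.drawing_planar[OF D]]) (use assms(4) in auto)
qed

lemma rot_closed:
  assumes "y \<in> carrier (A 1 s)"
  shows "rot s y \<in> carrier (A 1 (flip s))"
proof -
  note D = line_one[of 0 1 2 3 "flip s" False True]
  have "Z (draw (lineg (flip s)) (ldisc False 0 3 (flip s)) {ldisc True 1 2 (flip s)}) (\<lambda>_. y)
    \<in> carrier (A (half_marks (ldisc False 0 3 (flip s))) (shade (ldisc False 0 3 (flip s))))"
    by (rule Z_draw_closed[OF line.drawing_planar[OF D]]) (use assms in auto)
  then show ?thesis using rot_draw[of 0 1 2 3 "\<lambda>_. y" False "flip s"] assms by simp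
qed

lemma mult_draw:
  assumes "A' < a" "a < b" "b < c" "c < d" "d < B"
    and f: "f (ldisc e a b s) \<in> carrier (A 1 (sgnf e s))" "f (ldisc e c d s) \<in> carrier (A 1 (sgnf e s))"
  shows "Z (draw (lineg s) (ldisc e A' B s) {ldisc e a b s, ldisc e c d s}) f
    = (if e then f (ldisc e c d s) \<otimes>\<^bsub>A 1 (sgnf e s)\<^esub> f (ldisc e a b s)
       else f (ldisc e a b s) \<otimes>\<^bsub>A 1 (sgnf e s)\<^esub> f (ldisc e c d s))"
proof -
  note D = line_two[OF assms(1-5), of s e e e]
  have ne: "ldisc e a b s \<noteq> ldisc e c d s" using assms by simp
  let ?lo = "if e then ldisc e c d s else ldisc e a b s" and ?up = "if e then ldisc e a b s else ldisc e c d s"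
  have "f ?lo \<otimes>\<^bsub>A 1 (sgnf e s)\<^esub> f ?up
      = Z (draw (lineg s) (ldisc e A' B s) {ldisc e a b s, ldisc e c d s}) (\<lambda>d'. if d' = ?lo then f ?lo else f ?up)"
    by (rule mult_stacking[OF line_stacking_tangle[OF assms(1-5)]]) (use f in auto)
  also have "\<dots> = Z (draw (lineg s) (ldisc e A' B s) {ldisc e a b s, ldisc e c d s}) f"
    by (rule Z_draw_cong[OF line.drawing_planar[OF D]]) (use f ne in auto)
  finally show ?thesis by auto
qed

text \<open>
  Three boxes are nested, each standing the other way, below an identity box. Undoing the
  nest from the inside or from the outside gives the products of \<open>y\<close> and of its double half turn with
  the identity.
\<close>

lemma rot_rot:
  assumes y: "y \<in> carrier (A 1 s)"
  shows "rot (flip s) (rot s y) = y"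
proof -
  let ?W = "ldisc False 0 20 s" and ?U = "ldisc False 10 18 s" and ?M1 = "ldisc False 1 8 s"
    and ?M2 = "ldisc True 2 7 s" and ?d = "ldisc False 3 6 s"
  define f where "f e = (if e = ?U then \<one>\<^bsub>A 1 s\<^esub> else if e = ?d then y
      else if e = ?M2 then rot s y else rot (flip s) (rot s y))" for e
  note T1 = line_two[of 0 1 8 10 18 20 s False False False]
  note T2 = line_two[of 0 2 7 10 18 20 s False True False]
  note R1 = line_one[of 1 2 7 8 s False True]
  note R2 = line_one[of 2 3 6 7 s True False]
  have ry: "rot s y \<in> carrier (A 1 (flip s))" "rot (flip s) (rot s y) \<in> carrier (A 1 s)"
    using rot_closed[OF y] rot_closed[OF rot_closed[OF y]] by simp_all
  have "y \<otimes>\<^bsub>A 1 s\<^esub> \<one>\<^bsub>A 1 s\<^esub> = Z (draw (lineg s) ?W {?d, ?U}) f"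
    using mult_draw[of 0 3 6 10 18 20 f False s] y by (simp add: f_def)
  also have "\<dots> = Z (draw (lineg s) ?W {?M2, ?U}) (f(?M2 := Z (draw (lineg s) ?M2 {?d}) f))"
    by (rule Z_plug[OF line.drawing_planar[OF T2] _ line.drawing_planar[OF R2]])
       (use T2 R2 y in \<open>auto simp: drawing_def f_def\<close>)
  also have "Z (draw (lineg s) ?M2 {?d}) f = rot s y"
    using rot_draw[of 2 3 6 7 f True s] y by (simp add: f_def)
  also have "Z (draw (lineg s) ?W {?M2, ?U}) (f(?M2 := rot s y)) = Z (draw (lineg s) ?W {?M2, ?U}) f"
    by (rule Z_draw_cong[OF line.drawing_planar[OF T2]]) (use y ry in \<open>auto simp: f_def\<close>)
  also have "\<dots> = Z (draw (lineg s) ?W {?M1, ?U}) (f(?M1 := Z (draw (lineg s) ?M1 {?M2}) f))"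
    by (rule Z_plug[OF line.drawing_planar[OF T1] _ line.drawing_planar[OF R1]])
       (use T1 R1 y ry in \<open>auto simp: drawing_def f_def\<close>)
  also have "Z (draw (lineg s) ?M1 {?M2}) f = rot (flip s) (rot s y)"
    using rot_draw[of 1 2 7 8 f False s] ry by (simp add: f_def)
  also have "Z (draw (lineg s) ?W {?M1, ?U}) (f(?M1 := rot (flip s) (rot s y)))
      = rot (flip s) (rot s y) \<otimes>\<^bsub>A 1 s\<^esub> \<one>\<^bsub>A 1 s\<^esub>"
    using mult_draw[of 0 1 8 10 18 20 "f(?M1 := rot (flip s) (rot s y))" False s] ry by (simp add: f_def)
  finally show ?thesis using y ry monoid.r_one[OF mnd] by simp
qed

text \<open>
  Two boxes on one line: in a box standing the other way the order of the factors is exchanged, and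
  each of them may instead be turned on its own.
\<close>

lemma rot_mult:
  assumes y: "y \<in> carrier (A 1 s)" and z: "z \<in> carrier (A 1 s)"
  shows "rot s (y \<otimes>\<^bsub>A 1 s\<^esub> z) = rot s z \<otimes>\<^bsub>A 1 (flip s)\<^esub> rot s y"
proof -
  define \<sigma> where "\<sigma> = flip s"
  have s: "s = flip \<sigma>" by (simp add: \<sigma>_def)
  let ?W = "ldisc False 0 20 \<sigma>" and ?W' = "ldisc True 1 19 \<sigma>" and ?lo = "ldisc True 3 6 \<sigma>"
    and ?up = "ldisc True 13 16 \<sigma>" and ?LO = "ldisc False 2 7 \<sigma>" and ?UP = "ldisc False 12 17 \<sigma>"
  define f where "f e = (if e = ?lo then z else if e = ?up then y else if e = ?LO then rot s z else rot s y)" for e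
  note T1 = line_one[of 0 1 19 20 \<sigma> False True]
  note S1 = line_two[of 1 3 6 13 16 19 \<sigma> True True True]
  note T2 = line_two[of 0 2 7 12 17 20 \<sigma> False False False]
  note T3 = line_two[of 0 3 6 12 17 20 \<sigma> False True False]
  note R1 = line_one[of 2 3 6 7 \<sigma> False True]
  note R2 = line_one[of 12 13 16 17 \<sigma> False True]
  have r: "rot s y \<in> carrier (A 1 \<sigma>)" "rot s z \<in> carrier (A 1 \<sigma>)"
    using rot_closed[OF y] rot_closed[OF z] by (simp_all add: \<sigma>_def)
  note yz = y[unfolded s] z[unfolded s]
  have "Z (draw (lineg \<sigma>) ?W {?lo, ?up}) f = Z (draw (lineg \<sigma>) ?W {?W'}) (f(?W' := Z (draw (lineg \<sigma>) ?W' {?lo, ?up}) f))"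
    by (rule Z_plug[OF line.drawing_planar[OF T1] _ line.drawing_planar[OF S1]])
       (use T1 S1 yz in \<open>auto simp: drawing_def f_def\<close>)
  also have "Z (draw (lineg \<sigma>) ?W' {?lo, ?up}) f = y \<otimes>\<^bsub>A 1 s\<^esub> z"
    using mult_draw[of 1 3 6 13 16 19 f True \<sigma>] yz by (simp add: f_def s)
  also have "Z (draw (lineg \<sigma>) ?W {?W'}) (f(?W' := y \<otimes>\<^bsub>A 1 s\<^esub> z)) = rot s (y \<otimes>\<^bsub>A 1 s\<^esub> z)"
    using rot_draw[of 0 1 19 20 "f(?W' := y \<otimes>\<^bsub>A 1 s\<^esub> z)" False \<sigma>] yz by (simp add: s)
  finally have "rot s (y \<otimes>\<^bsub>A 1 s\<^esub> z) = Z (draw (lineg \<sigma>) ?W {?lo, ?up}) f" by simp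
  also have "\<dots> = Z (draw (lineg \<sigma>) ?W {?lo, ?UP}) (f(?UP := Z (draw (lineg \<sigma>) ?UP {?up}) f))"
    by (rule Z_plug[OF line.drawing_planar[OF T3] _ line.drawing_planar[OF R2]])
       (use T3 R2 yz in \<open>auto simp: drawing_def f_def\<close>)
  also have "Z (draw (lineg \<sigma>) ?UP {?up}) f = rot s y"
    using rot_draw[of 12 13 16 17 f False \<sigma>] yz by (simp add: f_def s)
  also have "Z (draw (lineg \<sigma>) ?W {?lo, ?UP}) (f(?UP := rot s y)) = Z (draw (lineg \<sigma>) ?W {?lo, ?UP}) f"
    by (rule Z_draw_cong[OF line.drawing_planar[OF T3]]) (use yz r in \<open>auto simp: f_def\<close>)
  also have "\<dots> = Z (draw (lineg \<sigma>) ?W {?LO, ?UP}) (f(?LO := Z (draw (lineg \<sigma>) ?LO {?lo}) f))"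
    by (rule Z_plug[OF line.drawing_planar[OF T2] _ line.drawing_planar[OF R1]])
       (use T2 R1 yz r in \<open>auto simp: drawing_def f_def\<close>)
  also have "Z (draw (lineg \<sigma>) ?LO {?lo}) f = rot s z"
    using rot_draw[of 2 3 6 7 f False \<sigma>] yz by (simp add: f_def s)
  also have "Z (draw (lineg \<sigma>) ?W {?LO, ?UP}) (f(?LO := rot s z)) = rot s z \<otimes>\<^bsub>A 1 \<sigma>\<^esub> rot s y"
    using mult_draw[of 0 2 7 12 17 20 "f(?LO := rot s z)" False \<sigma>] r by (simp add: f_def)
  finally show ?thesis by (simp add: \<sigma>_def)
qed

text \<open>
  The two concentric discs of the half turn are symmetric under reflection.
\<close>

lemma rot_star:
  assumes y: "y \<in> carrier (A 1 s)"
  shows "rot s (star (A 1 s) y) = star (A 1 (flip s)) (rot s y)"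
proof -
  define \<sigma> where "\<sigma> = flip s"
  have s: "s = flip \<sigma>" by (simp add: \<sigma>_def)
  let ?W = "ldisc False (-2) 2 \<sigma>" and ?d = "ldisc True (-1) 1 \<sigma>"
  let ?T = "draw (lineg \<sigma>) ?W {?d}"
  note D = line_one[of "-2" "-1" 1 2 \<sigma> False True]
  have pl: "planar_tangle ?T" using line.drawing_planar[OF D] by simp
  have "reflect_tangle ?T = ?T"
    by (subst reflect_draw) (simp_all add: reflect_ldisc lineg_def)
  moreover have "star (A 1 \<sigma>) (Z ?T (\<lambda>_. y)) = Z (reflect_tangle ?T) (\<lambda>d. star (A (half_marks d) (shade d)) y)"
    using star_reflection[OF pl, of "\<lambda>_. y"] y by (simp add: labelling_def s)
  moreover have "Z ?T (\<lambda>d. star (A (half_marks d) (shade d)) y) = rot s (star (A 1 s) y)"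
    using rot_draw[of "-2" "-1" 1 2 "\<lambda>d. star (A (half_marks d) (shade d)) y" False \<sigma>] y by (simp add: s)
  moreover have "Z ?T (\<lambda>_. y) = rot s y"
    using rot_draw[of "-2" "-1" 1 2 "\<lambda>_. y" False \<sigma>] y by (simp add: s)
  ultimately show ?thesis by (simp add: \<sigma>_def)
qed

lemma rot_add:
  assumes "y \<in> carrier (A 1 s)" "z \<in> carrier (A 1 s)"
  shows "rot s (y + z) = rot s y + rot s z"
proof -
  let ?d = "ldisc True (-1) 1 (flip s)" and ?T = "draw (lineg (flip s)) (ldisc False (-2) 2 (flip s)) {ldisc True (-1) 1 (flip s)}"
  have pl: "planar_tangle ?T"
    using line.drawing_planar[OF line_one[of "-2" "-1" 1 2 "flip s" False True]] by simp
  have R: "Z ?T f = rot s (f ?d)" if "f ?d \<in> carrier (A 1 s)" for f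
    using rot_draw[of "-2" "-1" 1 2 f False "flip s"] that by simp
  have yz: "y + z \<in> carrier (A 1 s)" using subspace_add[OF subspace_V] assms by blast
  show ?thesis
    using Z_add[OF pl, of "\<lambda>_. y" ?d z] assms yz by (simp add: labelling_def R)
qed

lemma rot_scale:
  assumes "y \<in> carrier (A 1 s)"
  shows "rot s (cscale a y) = cscale a (rot s y)"
proof -
  let ?d = "ldisc True (-1) 1 (flip s)" and ?T = "draw (lineg (flip s)) (ldisc False (-2) 2 (flip s)) {ldisc True (-1) 1 (flip s)}"
  have pl: "planar_tangle ?T"
    using line.drawing_planar[OF line_one[of "-2" "-1" 1 2 "flip s" False True]] by simp
  have R: "Z ?T f = rot s (f ?d)" if "f ?d \<in> carrier (A 1 s)" for f
    using rot_draw[of "-2" "-1" 1 2 f False "flip s"] that by simp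
  have yz: "cscale a y \<in> carrier (A 1 s)" using subspace_scale[OF subspace_V] assms by blast
  show ?thesis
    using Z_scale[OF pl, of "\<lambda>_. y" ?d a] assms yz by (simp add: labelling_def R)
qed

end

end

section \<open>One circle: the trace of a product\<close>

lemma nested_1: "region a \<subseteq> interior (region D) \<Longrightarrow> nested D {a}"
  by (simp add: nested_def)

lemma nested_insert:
  assumes "nested D I" "region a \<subseteq> interior (region D)" "\<And>d. d \<in> I \<Longrightarrow> region a \<inter> region d = {}"
  shows "nested D (insert a I)"
  using assms unfolding nested_def by (auto simp: Int_commute)

text \<open>
  The string is the circle of radius 5 about the origin; its exterior has shade \<open>s\<close>.
\<close>

definition circleg :: "sign \<Rightarrow> complex \<Rightarrow> real" where
  "circleg s p = eps s * ((Re p)\<^sup>2 + (Im p)\<^sup>2 - 25)"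

lemma circle_sign_change:
  assumes "(Re p)\<^sup>2 + (Im p)\<^sup>2 = r\<^sup>2" "r \<noteq> 0"
  shows "p \<in> closure {p. (Re p)\<^sup>2 + (Im p)\<^sup>2 - r\<^sup>2 < 0} \<and> p \<in> closure {p. 0 < (Re p)\<^sup>2 + (Im p)\<^sup>2 - r\<^sup>2}"
proof -
  have sq: "(Re (p + of_real t * (c * p)))\<^sup>2 + (Im (p + of_real t * (c * p)))\<^sup>2 = (1 + t * c)\<^sup>2 * r\<^sup>2" for t c :: real
  proof -
    have "(Re (p + of_real t * (c * p)))\<^sup>2 + (Im (p + of_real t * (c * p)))\<^sup>2 = (1 + t * c)\<^sup>2 * ((Re p)\<^sup>2 + (Im p)\<^sup>2)"
      by (simp add: power2_eq_square algebra_simps)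
    then show ?thesis using assms(1) by simp
  qed
  have r: "0 < r\<^sup>2" using assms(2) by simp
  have "p + of_real t * (of_real (- 1) * p) \<in> {p. (Re p)\<^sup>2 + (Im p)\<^sup>2 - r\<^sup>2 < 0}" if "0 < t" "t < 1" for t
  proof -
    have "(1 - t)\<^sup>2 < 1" using that by (simp add: power2_eq_square mult_less_cancel_left1 mult_strict_mono' algebra_simps)
    then have "(1 - t)\<^sup>2 * r\<^sup>2 < 1 * r\<^sup>2" using r by (intro mult_strict_right_mono) auto
    then show ?thesis using sq[of t "- 1"] by simp
  qed
  moreover have "p + of_real t * (of_real 1 * p) \<in> {p. 0 < (Re p)\<^sup>2 + (Im p)\<^sup>2 - r\<^sup>2}" if "0 < t" "t < 1" for t
  proof -
    have "1 < (1 + t)\<^sup>2" using that by (simp add: one_less_power)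
    then have "1 * r\<^sup>2 < (1 + t)\<^sup>2 * r\<^sup>2" using r by (intro mult_strict_right_mono) auto
    then show ?thesis using sq[of t 1] by simp
  qed
  ultimately show ?thesis
    using closure_along[of 1 p "of_real (- 1) * p"] closure_along[of 1 p "of_real 1 * p"] by fastforce
qed

lemma picture_circle: "picture (circleg s) (\<lambda>_ :: unit. circ 5)"
proof
  show "continuous_on UNIV (circleg s)" unfolding circleg_def by (intro continuous_intros)
  show "continuous_on UNIV (circ 5)" by (rule continuous_circ)
  show "i = j \<and> a = b" if "circ 5 a = circ 5 b" for i j :: unit and a b using that circ_inj[of 5 a b] by simp
  fix p assume "circleg s p = 0"
  then have "(Re p)\<^sup>2 + (Im p)\<^sup>2 = 5\<^sup>2" by (simp add: circleg_def)
  then show "p \<in> closure {p. circleg s p < 0} \<and> p \<in> closure {p. 0 < circleg s p}"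
    unfolding circleg_def using circle_sign_change[of p 5] by (intro sign_change_eps) simp
qed

interpretation circle: picture "circleg s" "\<lambda>_ :: unit. circ 5" for s
  by (rule picture_circle)

lemma circleg_zero: "circleg s p = 0 \<longleftrightarrow> (\<exists>(j::unit) t. p = circ 5 t) \<or> p \<in> {of_real (- 5)}"
  using on_circle_iff[of 5 p] by (auto simp: circleg_def)

text \<open>
  A box is closed up on its right if its distinguished interval lies in the outermost region. It is
  enough that the vertical ray from the start point \<open>q\<close> upwards avoids the strings: the ray leaves
  the disc, as \<open>q\<close> is in the upper half of its boundary, and ends on the boundary of the outer disc.
\<close>

lemma outer_connected:
  assumes O: "region O' = cball z0 R0" "0 < R0" and E: "region E = cball z (sqrt N)" "region E \<subseteq> interior (region O')"
    and q: "q \<in> sphere z (sqrt N)" "Im z \<le> Im q"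
    and g: "\<And>p. g p = 0 \<Longrightarrow> p \<in> interior (region O')" "\<And>y. Im q \<le> y \<Longrightarrow> g (Complex (Re q) y) \<noteq> 0"
    and w: "w \<in> frontier (region O')"
  shows "connected_component (off_strings (draw g O' {E})) q w"
proof -
  define L where "L = {p. Re p = Re q} \<inter> {p. Im q \<le> Im p} \<inter> cball z0 R0"
  have sO: "frontier (region O') = sphere z0 R0" "interior (region O') = ball z0 R0" using O by auto
  have qE: "q \<in> region E" using q E(1) by auto
  have qO: "q \<in> ball z0 R0" using qE E(2) sO by auto
  have conv: "convex L" unfolding L_def
    by (intro convex_Int convex_cball convex_halfspace_Im_ge)
       (auto simp: convex_def simp flip: distrib_right)
  define y where "y = Im z0 + sqrt (R0\<^sup>2 - (Re q - Re z0)\<^sup>2)"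
  have lt: "(Re q - Re z0)\<^sup>2 + (Im q - Im z0)\<^sup>2 < R0\<^sup>2"
    using qO O(2) mem_sqrt(1)[of q z0 "R0\<^sup>2"] by simp
  have nn: "0 \<le> R0\<^sup>2 - (Re q - Re z0)\<^sup>2" using lt zero_le_power2[of "Im q - Im z0"] by linarith
  have ys: "Complex (Re q) y \<in> sphere z0 R0"
    using mem_sqrt(3)[of "Complex (Re q) y" z0 "R0\<^sup>2"] O(2) nn by (simp add: y_def)
  have "Im q - Im z0 \<le> sqrt (R0\<^sup>2 - (Re q - Re z0)\<^sup>2)"
    using lt by (intro real_le_rsqrt) linarith
  then have yq: "Im q \<le> y" by (simp add: y_def)
  have yL: "Complex (Re q) y \<in> L" using ys yq by (auto simp: L_def)
  have con: "connected (L \<union> sphere z0 R0)"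
  proof (rule connected_Un)
    show "connected L" using conv by (rule convex_connected)
    show "connected (sphere z0 R0)" by (rule connected_sphere) simp
    show "L \<inter> sphere z0 R0 \<noteq> {}" using yL ys by blast
  qed
  have "L \<union> sphere z0 R0 \<subseteq> off_strings (draw g O' {E})"
  proof
    fix p assume "p \<in> L \<union> sphere z0 R0"
    then show "p \<in> off_strings (draw g O' {E})"
    proof
      assume p: "p \<in> L"
      then have e: "p = Complex (Re q) (Im p)" "Im q \<le> Im p" by (auto simp: L_def complex_eq_iff)
      have "(Im q - Im z)\<^sup>2 \<le> (Im p - Im z)\<^sup>2" using e(2) q(2) by (intro power_mono) auto
      then have "N \<le> (Re p - Re z)\<^sup>2 + (Im p - Im z)\<^sup>2"
        using q(1) e(1) unfolding mem_sqrt by (metis add_left_mono complex.sel(1))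
      then have "p \<notin> ball z (sqrt N)" unfolding mem_sqrt by simp
      moreover have "g p \<noteq> 0" using g(2)[OF e(2)] e(1) by metis
      ultimately show ?thesis using p O(1) by (simp add: btw_def E(1) L_def)
    next
      assume p: "p \<in> sphere z0 R0"
      then have "p \<notin> interior (region O')" unfolding sO by simp
      then show ?thesis
        using p g(1) E(2) interior_subset[of "region E"] O(1) by (auto simp: btw_def)
    qed
  qed
  moreover have "q \<in> L" using qO by (auto simp: L_def)
  moreover have "w \<in> sphere z0 R0" using w sO by simp
  ultimately show ?thesis unfolding connected_component_def using con by blast
qed

lemma closed_on_right:
  assumes O: "region O' = cball z0 R0" "0 < R0" and d: "region (rdisc z N ms s) \<subseteq> interior (region O')"
    and ad: "adapted g (rdisc z N ms s)" and N: "0 < N" and q: "q \<in> sphere z (sqrt N)" "Im z \<le> Im q"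
    and g: "\<And>p. g p = 0 \<Longrightarrow> p \<in> interior (region O')" "\<And>y. Im q \<le> y \<Longrightarrow> g (Complex (Re q) y) \<noteq> 0"
    and srt: "sorted_wrt (\<lambda>m m'. orient q m m' < 0) ms"
  shows "\<exists>c ts. disc_param (rdisc z N ms s) c ts \<and>
    (\<forall>w\<in>frontier (region O'). connected_component (off_strings (draw g O' {rdisc z N ms s})) (c 0) w)"
proof -
  obtain z' R where r: "0 < R" "region (rdisc z N ms s) = cball z' R" "set ms = {p \<in> sphere z' R. g p = 0}"
    using ad unfolding adapted_def rdisc_simps(2) by blast
  have "sphere z' R = frontier (region (rdisc z N ms s))" unfolding r(2) using r(1) by simp
  then have "sphere z' R = sphere z (sqrt N)" using N by simp
  moreover have "g q \<noteq> 0" using g(2)[of "Im q"] by simp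
  ultimately have "set ms \<subseteq> sphere z (sqrt N) - {q}" using r(3) by auto
  then obtain c ts where "disc_param (rdisc z N ms s) c ts" "c 0 = q"
    using disc_param_round[OF _ q(1) _ srt, of s] N unfolding rdisc_def by auto
  then show ?thesis using outer_connected[where g = g, OF O rdisc_simps(1) d q g] by metis
qed

text \<open>
  The outermost disc is centred at \<open>- 11/2\<close>, the centre of a half turn used later. The disc \<open>dE\<close>
  leaves outside only a short arc of the circle, which closes up the box; \<open>dW\<close> is a small disc at
  the rightmost point of the circle, and its distinguished interval lies outside the circle, so it
  stands upside down.
\<close>

definition dO :: "sign \<Rightarrow> disc" where
  "dO s = rdisc (Complex (- 11/2) 0) 40000 [] s"

definition dE :: "sign \<Rightarrow> disc" where
  "dE s = rdisc (Complex (- 20) 20) 1105 [circ 5 (- 1/3), circ 5 (- 1/2)] s"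

definition dW :: "sign \<Rightarrow> disc" where
  "dW s = rdisc (Complex (26/5) 0) (2701/2525) [circ 5 (- 1/10), circ 5 (1/10)] s"

text \<open>
  The parameters of the marks of a disc can be read off its definition; that they are the right ones
  is an identity between rational numbers.
\<close>

lemma cuts_E: "cocuts (dE s) (circ 5) (of_real (- 5)) (- 1/2) (- 1/3)"
  unfolding dE_def by (rule cocuts_rdisc) (simp_all add: power2_eq_square)

lemma cuts_W: "cuts (dW s) (circ 5) (of_real (- 5)) (- 1/10) (1/10)"
  unfolding dW_def by (rule cuts_rdisc) (simp_all add: power2_eq_square)

lemma swallows_O: "swallows (dO s) (circ 5) (of_real (- 5))"
  unfolding dO_def by (rule swallows_rdisc) (simp_all add: power2_eq_square)

lemma adapted_circle:
  assumes c: "crossing (rdisc z N ms s) (circ 5) (of_real (- 5)) S"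
    and N: "0 < N" and ev: "even (length ms)" and q: "q \<in> sphere z (sqrt N)" "0 < eps s * circleg s' q"
    and ms: "set ms = circ 5 ` S"
    and srt: "sorted_wrt (\<lambda>m m'. orient q m m' < 0) ms"
  shows "adapted (circleg s') (rdisc z N ms s)"
proof (rule adapted_rdisc[where q = q])
  have fr: "frontier (region (rdisc z N ms s)) = sphere z (sqrt N)" using N by simp
  show "set ms = {p \<in> sphere z (sqrt N). circleg s' p = 0}"
    using c unfolding crossing_def fr ms circleg_zero by auto
qed (use N ev q(1) eps_positive[OF q(2)] srt in blast)+

lemma adapted_W: "adapted (circleg s) (dW s)"
  unfolding dW_def
  by (rule adapted_circle[OF crossing_cuts[OF _ _ cuts_W[unfolded dW_def]], where q = "Complex (2777/505) (100/101)"])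
     (auto simp: circleg_def mem_sqrt power2_eq_square orient_def circ_def simp del: mem_sphere)

lemma adapted_E: "adapted (circleg s) (dE s)"
  unfolding dE_def
  by (rule adapted_circle[OF crossing_cocuts[OF _ _ cuts_E[unfolded dE_def]], where q = "Complex (- 44) 43"])
     (auto simp: circleg_def mem_sqrt power2_eq_square orient_def circ_def simp del: mem_sphere)

text \<open>
  The value is taken at the rightmost point of the disc, \<open>200 - 11/2\<close>.
\<close>

lemma adapted_O:
  assumes g: "\<And>p. p \<in> frontier (region (dO s)) \<Longrightarrow> g p \<noteq> 0"
    "0 < eps s * g (Complex (389/2) 0)"
  shows "adapted g (dO s)"
proof -
  have fr: "frontier (region (dO s)) = sphere (Complex (- 11/2) 0) (sqrt 40000)"
    by (simp add: dO_def)
  show ?thesis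
  unfolding dO_def
proof (rule adapted_rdisc[where q = "Complex (389/2) 0"])
  show q: "Complex (389/2) 0 \<in> sphere (Complex (- 11/2) 0) (sqrt 40000)"
    unfolding mem_sqrt by (simp add: power2_eq_square)
  show "g (Complex (389/2) 0) \<noteq> 0" using g(1) q unfolding fr .
  show "set [] = {p \<in> sphere (Complex (- 11/2) 0) (sqrt 40000). g p = 0}" using g(1) unfolding fr by auto
qed (use eps_positive[OF g(2)] in auto)
qed

lemma adapted_circle_O: "adapted (circleg s) (dO s)"
proof (rule adapted_O)
  show "circleg s p \<noteq> 0" if "p \<in> frontier (region (dO s))" for p
    using that swallows_O[of s] unfolding circleg_zero swallows_def frontier_def by auto
qed (simp add: circleg_def power2_eq_square)

lemma E_in_O: "region (dE s) \<subseteq> interior (region (dO s))"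
  and W_in_E: "region (dW s) \<subseteq> interior (region (dE s))"
  and dW_in_dO: "region (dW s) \<subseteq> interior (region (dO s))"
  unfolding dO_def dE_def dW_def by (rule rdisc_in; simp add: power2_eq_square)+

lemma btw_insert: "p \<in> btw D (insert a I) \<longleftrightarrow> p \<notin> interior (region a) \<and> p \<in> btw D I"
  by (auto simp: btw_def)

lemma btw_empty: "p \<in> btw D {} \<longleftrightarrow> p \<in> region D"
  by (auto simp: btw_def)

lemma closing_drawing:
  "drawing (circleg s) (\<lambda>_ :: unit. circ 5) (dO s) {dE s} {((), - 1/2, - 1/3)}"
proof (rule drawingI[OF _ _ _ _ _ circleg_zero])
  show "nested (dO s) {dE s}" using E_in_O by (rule nested_1)
  show "p \<notin> btw (dO s) {dE s}" if "p \<in> {of_real (- 5)}" for p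
    using that cuts_E[of s] by (auto simp: btw_insert cocuts_def)
  show "circ 5 t \<in> btw (dO s) {dE s} \<longleftrightarrow> (\<exists>(j', u, v)\<in>{((), - 1/2, - 1/3)}. j' = j \<and> u \<le> t \<and> t \<le> v)" for j t
    using cuts_E[of s] swallows_O[of s] interior_subset[of "region (dO s)"]
    by (auto simp: btw_insert btw_empty cocuts_def swallows_def)
  show "(\<Union>d\<in>insert (dO s) {dE s}. set (marks d)) = (\<Union>(j, u, v)\<in>{((), - 1/2, - 1/3)}. {circ 5 u, circ 5 v})"
    by (auto simp: dO_def dE_def)
qed (auto simp: adapted_circle_O adapted_E)

lemma closing_tangle: "closure_tangle 1 s (draw (circleg s) (dO s) {dE s}) (dE s)"
proof -
  note D = closing_drawing[of s]
  have "joined (draw (circleg s) (dO s) {dE s}) (circ 5 (- 1/3)) (circ 5 (- 1/2))"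
    using circle.drawing_joined'[OF D, of "()" "- 1/2" "- 1/3"] by simp
  moreover have "\<exists>c ts. disc_param (dE s) c ts \<and>
      (\<forall>w\<in>frontier (region (dO s)). connected_component (off_strings (draw (circleg s) (dO s) {dE s})) (c 0) w)"
    unfolding dE_def
  proof (rule closed_on_right[where q = "Complex (- 44) 43", OF _ _ E_in_O[unfolded dE_def] adapted_E[unfolded dE_def]])
    show "region (dO s) = cball (Complex (- 11/2) 0) (sqrt 40000)" by (simp add: dO_def)
    show "p \<in> interior (region (dO s))" if "circleg s p = 0" for p
      using that swallows_O[of s] unfolding circleg_zero swallows_def by auto
    show "circleg s (Complex (Re (Complex (- 44) 43)) y) \<noteq> 0" for y
    proof -
      have "(- 44)\<^sup>2 + y\<^sup>2 - 25 > 0" using zero_le_power2[of y] by (simp add: add_pos_nonneg)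
      then show ?thesis by (simp add: circleg_def)
    qed
  qed (auto simp: mem_sqrt power2_eq_square orient_def circ_def simp del: mem_sphere)
  ultimately show ?thesis
    unfolding closure_tangle_def
    using circle.drawing_planar[OF D] circle.drawing_no_closed[OF D]
    by (simp add: box_type_def top_mark_def bot_mark_def dE_def dO_def)
qed

lemma mult_drawing:
  assumes D1: "cocuts D1 (circ 5) (of_real (- 5)) (- \<tau>) \<tau>" "1/2 < \<tau>" "marks D1 = [circ 5 \<tau>, circ 5 (- \<tau>)]"
    and ad: "adapted (circleg s) D1" and DE: "region D1 \<subseteq> interior (region (dE s))"
    and DW: "region D1 \<inter> region (dW s) = {}"
  shows "drawing (circleg s) (\<lambda>_ :: unit. circ 5) (dE s) {D1, dW s}
    {((), - \<tau>, - 1/2), ((), - 1/3, - 1/10), ((), 1/10, \<tau>)}"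
proof (rule drawingI[OF _ _ _ _ _ circleg_zero])
  show "nested (dE s) {D1, dW s}" using DE DW W_in_E by (intro nested_insert nested_1) auto
  show "p \<notin> btw (dE s) {D1, dW s}" if "p \<in> {of_real (- 5)}" for p
    using that D1 by (auto simp: btw_insert cocuts_def)
  show "circ 5 t \<in> btw (dE s) {D1, dW s}
      \<longleftrightarrow> (\<exists>(j', u, v)\<in>{((), - \<tau>, - 1/2), ((), - 1/3, - 1/10), ((), 1/10, \<tau>)}. j' = j \<and> u \<le> t \<and> t \<le> v)" for j t
    using cuts_E[of s] cuts_W[of s] D1 by (auto simp: btw_insert btw_empty cocuts_def cuts_def)
  show "(\<Union>d\<in>insert (dE s) {D1, dW s}. set (marks d))
      = (\<Union>(j, u, v)\<in>{((), - \<tau>, - 1/2), ((), - 1/3, - 1/10), ((), 1/10, \<tau>)}. {circ 5 u, circ 5 v})"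
    using D1(3) by (auto simp: dE_def dW_def)
qed (use ad D1 in \<open>auto simp: adapted_E adapted_W\<close>)

text \<open>
  A disc \<open>D1\<close> at the left of the circle and \<open>dW\<close> at its right are both boxes on the same string, seen
  from outside the circle: inside \<open>dE\<close> they are stacked, and the arc outside \<open>dE\<close> closes the
  product up.
\<close>

lemma mult_tangle:
  assumes D1: "cocuts D1 (circ 5) (of_real (- 5)) (- \<tau>) \<tau>" "1/2 < \<tau>" "marks D1 = [circ 5 \<tau>, circ 5 (- \<tau>)]"
    "shade D1 = s"
    and ad: "adapted (circleg s) D1" and DE: "region D1 \<subseteq> interior (region (dE s))"
    and DW: "region D1 \<inter> region (dW s) = {}"
  shows "stacking_tangle 1 s (draw (circleg s) (dE s) {D1, dW s}) D1 (dW s)"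
proof -
  note D = mult_drawing[OF D1(1-3) ad DE DW]
  note J = circle.drawing_joined'[OF D] circle.drawing_joined[OF D]
  have "joined (draw (circleg s) (dE s) {D1, dW s}) (circ 5 (- 1/2)) (circ 5 (- \<tau>))"
    "joined (draw (circleg s) (dE s) {D1, dW s}) (circ 5 (- 1/10)) (circ 5 (- 1/3))"
    "joined (draw (circleg s) (dE s) {D1, dW s}) (circ 5 \<tau>) (circ 5 (1/10))"
    using J(1)[of "()" "- \<tau>" "- 1/2"] J(1)[of "()" "- 1/3" "- 1/10"] J(1)[of "()" "1/10" \<tau>]
      J(2)[of "()" "- \<tau>" "- 1/2"] J(2)[of "()" "- 1/3" "- 1/10"] J(2)[of "()" "1/10" \<tau>] by simp_all
  moreover have "D1 \<noteq> dW s"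
    using DW by (auto simp: dW_def)
  ultimately show ?thesis
    unfolding stacking_tangle_def
    using circle.drawing_planar[OF D] circle.drawing_no_closed[OF D] D1(3,4)
    by (simp add: box_type_def top_mark_def bot_mark_def dE_def dW_def)
qed

lemma pair_drawing:
  assumes D1: "cocuts D1 (circ 5) (of_real (- 5)) (- \<tau>) \<tau>" "1/2 < \<tau>" "set (marks D1) = {circ 5 \<tau>, circ 5 (- \<tau>)}"
    and ad: "adapted (circleg s) D1" and DE: "region D1 \<subseteq> interior (region (dE s))"
    and DW: "region D1 \<inter> region (dW s) = {}"
  shows "drawing (circleg s) (\<lambda>_ :: unit. circ 5) (dO s) {D1, dW s} {((), - \<tau>, - 1/10), ((), 1/10, \<tau>)}"
proof (rule drawingI[OF _ _ _ _ _ circleg_zero])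
  have "region D1 \<subseteq> interior (region (dO s))" "region (dW s) \<subseteq> interior (region (dO s))"
    using DE W_in_E[of s] E_in_O[of s] interior_subset[of "region (dE s)"] by blast+
  then show "nested (dO s) {D1, dW s}" using DW by (intro nested_insert nested_1) auto
  show "p \<notin> btw (dO s) {D1, dW s}" if "p \<in> {of_real (- 5)}" for p
    using that D1 by (auto simp: btw_insert cocuts_def)
  show "circ 5 t \<in> btw (dO s) {D1, dW s}
      \<longleftrightarrow> (\<exists>(j', u, v)\<in>{((), - \<tau>, - 1/10), ((), 1/10, \<tau>)}. j' = j \<and> u \<le> t \<and> t \<le> v)" for j t
    using swallows_O[of s] interior_subset[of "region (dO s)"] cuts_W[of s] D1
    by (auto simp: btw_insert btw_empty cocuts_def cuts_def swallows_def)
  show "(\<Union>d\<in>insert (dO s) {D1, dW s}. set (marks d))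
      = (\<Union>(j, u, v)\<in>{((), - \<tau>, - 1/10), ((), 1/10, \<tau>)}. {circ 5 u, circ 5 v})"
    using D1(3) by (auto simp: dO_def dW_def)
qed (use ad D1 in \<open>auto simp: adapted_circle_O adapted_W\<close>)

lemma half_marks_dE [simp]: "half_marks (dE s) = 1" "shade (dE s) = s" by (auto simp: dE_def)

lemma half_marks_dW [simp]: "half_marks (dW s) = 1" "shade (dW s) = s" by (auto simp: dW_def)

lemma shade_dO [simp]: "shade (dO s) = s" by (auto simp: dO_def)

context cstar_planar_algebra
begin

text \<open>
  The two-box necklace is the trace of a product. This identifies the trace pairing in both
  of the larger pictures.
\<close>

lemma trace_mult:
  assumes D1: "cocuts D1 (circ 5) (of_real (- 5)) (- \<tau>) \<tau>" "1/2 < \<tau>" "marks D1 = [circ 5 \<tau>, circ 5 (- \<tau>)]"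
    "shade D1 = s"
    and ad: "adapted (circleg s) D1" and DE: "region D1 \<subseteq> interior (region (dE s))"
    and DW: "region D1 \<inter> region (dW s) = {}"
    and f: "f D1 \<in> carrier (A 1 s)" "f (dW s) \<in> carrier (A 1 s)"
  shows "tr 0 s (Z (draw (circleg s) (dO s) {D1, dW s}) f) = tr 1 s (f D1 \<otimes>\<^bsub>A 1 s\<^esub> f (dW s))"
proof -
  note D = mult_drawing[OF D1(1-3) ad DE DW]
  have ne: "D1 \<noteq> dW s" using DW by (auto simp: dW_def)
  have hm: "half_marks D1 = 1" using D1(3) by (simp add: half_marks_def)
  have "f D1 \<otimes>\<^bsub>A 1 s\<^esub> f (dW s)
      = Z (draw (circleg s) (dE s) {D1, dW s}) (\<lambda>d. if d = D1 then f D1 else f (dW s))"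
    by (rule mult_stacking[OF mult_tangle[OF D1 ad DE DW] f])
  also have "\<dots> = Z (draw (circleg s) (dE s) {D1, dW s}) f"
    by (rule Z_draw_cong[OF circle.drawing_planar[OF D]]) (use f ne hm D1(4) in auto)
  finally have m: "Z (draw (circleg s) (dE s) {D1, dW s}) f = f D1 \<otimes>\<^bsub>A 1 s\<^esub> f (dW s)" by simp
  have "Z (draw (circleg s) (dO s) {D1, dW s}) f
      = Z (draw (circleg s) (dO s) {dE s}) (f(dE s := Z (draw (circleg s) (dE s) {D1, dW s}) f))"
    by (rule Z_plug[OF circle.drawing_planar[OF closing_drawing] _ circle.drawing_planar[OF D]])
       (use D closing_drawing f hm D1(4) in \<open>auto simp: drawing_def\<close>)
  also have "\<dots> = Z (draw (circleg s) (dO s) {dE s}) (\<lambda>_. f D1 \<otimes>\<^bsub>A 1 s\<^esub> f (dW s))"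
    unfolding m
    by (rule Z_draw_cong[OF circle.drawing_planar[OF closing_drawing]]) (use f in auto)
  finally show ?thesis
    using tr_closure[OF closing_tangle mult_closed[OF f]] by simp
qed

end

section \<open>Two circles side by side: adjointness of the convolutions\<close>

lemma adapted_two:
  fixes \<gamma> :: "bool \<Rightarrow> real \<Rightarrow> complex"
  assumes zero: "\<And>p. g p = 0 \<longleftrightarrow> (\<exists>j t. p = \<gamma> j t) \<or> p \<in> {w0, w1}"
    and c: "crossing (rdisc z N ms s) (\<gamma> False) w0 S0" "crossing (rdisc z N ms s) (\<gamma> True) w1 S1"
    and N: "0 < N" and ev: "even (length ms)" and q: "q \<in> sphere z (sqrt N)" "0 < eps s * g q"
    and ms: "set ms = \<gamma> False ` S0 \<union> \<gamma> True ` S1"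
    and srt: "sorted_wrt (\<lambda>m m'. orient q m m' < 0) ms"
  shows "adapted g (rdisc z N ms s)"
proof (rule adapted_rdisc[where q = q])
  have fr: "frontier (region (rdisc z N ms s)) = sphere z (sqrt N)" using N by simp
  note C = c[unfolded crossing_def fr]
  show "set ms = {p \<in> sphere z (sqrt N). g p = 0}"
  proof (intro equalityI subsetI)
    fix p assume "p \<in> set ms"
    then show "p \<in> {p \<in> sphere z (sqrt N). g p = 0}"
      unfolding ms zero using C by blast
  next
    fix p assume p: "p \<in> {p \<in> sphere z (sqrt N). g p = 0}"
    then obtain j t where jt: "p = \<gamma> j t" unfolding zero using C by blast
    then show "p \<in> set ms" unfolding ms using p C by (cases j) auto
  qed
qed (use N ev q(1) eps_positive[OF q(2)] srt in blast)+

text \<open>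
  The half turn about \<open>- 11/2\<close>, which exchanges the circles of radius 5 about \<open>0\<close> and \<open>- 11\<close>.
\<close>

definition turn :: "complex \<Rightarrow> complex" where
  "turn p = Complex (- 11) 0 - p"

text \<open>
  The exterior of both circles has shade \<open>s\<close>.
\<close>

definition gA :: "sign \<Rightarrow> complex \<Rightarrow> real" where
  "gA s p = eps s * (((Re p)\<^sup>2 + (Im p)\<^sup>2 - 5\<^sup>2) * ((Re (turn p))\<^sup>2 + (Im (turn p))\<^sup>2 - 5\<^sup>2))"

definition curveA :: "bool \<Rightarrow> real \<Rightarrow> complex" where
  "curveA j t = (if j then turn (circ 5 t) else circ 5 t)"

lemma curveA_simps [simp]: "curveA False = circ 5" "curveA True t = turn (circ 5 t)"
  by (auto simp: curveA_def)

lemma turn_turn [simp]: "turn (turn p) = p" by (simp add: turn_def)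

lemma turn_sel [simp]: "Re (turn p) = - 11 - Re p" "Im (turn p) = - Im p" by (auto simp: turn_def)

lemma gA_turn: "gA s (turn p) = gA s p" by (simp add: gA_def)

lemma gA_zero: "gA s p = 0 \<longleftrightarrow> (\<exists>j t. p = curveA j t) \<or> p \<in> {of_real (- 5), Complex (- 6) 0}"
proof -
  have "gA s p = 0 \<longleftrightarrow> (Re p)\<^sup>2 + (Im p)\<^sup>2 = 5\<^sup>2 \<or> (Re (turn p))\<^sup>2 + (Im (turn p))\<^sup>2 = 5\<^sup>2"
    unfolding gA_def by (simp del: turn_sel)
  also have "\<dots> \<longleftrightarrow> ((\<exists>t. p = circ 5 t) \<or> p = of_real (- 5)) \<or> ((\<exists>t. turn p = circ 5 t) \<or> turn p = of_real (- 5))"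
    using on_circle_iff[of 5 p] on_circle_iff[of 5 "turn p"] by simp
  also have "(\<exists>t. turn p = circ 5 t) \<longleftrightarrow> (\<exists>t. p = turn (circ 5 t))" by (metis turn_turn)
  also have "turn p = of_real (- 5) \<longleftrightarrow> p = Complex (- 6) 0" by (auto simp: complex_eq_iff)
  finally show ?thesis by (auto simp: curveA_def split: if_splits)
qed

lemmas adapted_A = adapted_two[where \<gamma> = curveA, unfolded curveA_simps(1), OF gA_zero]

lemma circ_Re: "- \<bar>r\<bar> \<le> Re (circ r t)" "Re (circ r t) \<le> \<bar>r\<bar>"
proof -
  have "(Re (circ r t))\<^sup>2 \<le> r\<^sup>2" using circ_on[of r t] zero_le_power2[of "Im (circ r t)"] by linarith
  then have "\<bar>Re (circ r t)\<bar> \<le> \<bar>r\<bar>" by (simp add: abs_le_square_iff)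
  then show "- \<bar>r\<bar> \<le> Re (circ r t)" "Re (circ r t) \<le> \<bar>r\<bar>" by auto
qed

lemma picture_A: "picture (gA s) curveA"
proof
  show "continuous_on UNIV (gA s)" unfolding gA_def turn_def by (intro continuous_intros)
  show "continuous_on UNIV (curveA j)" for j
    by (cases j) (auto simp: curveA_def turn_def intro!: continuous_intros continuous_circ)
  show "i = j \<and> a = b" if e: "curveA i a = curveA j b" for i j a b
  proof -
    have "circ 5 x \<noteq> turn (circ 5 y)" for x y
      using circ_Re[of 5 x] circ_Re[of 5 y] by (auto simp: complex_eq_iff)
    moreover have "turn (circ 5 x) = turn (circ 5 y) \<longleftrightarrow> x = y" for x y
      using circ_inj[of 5 x y] by (metis turn_turn zero_neq_numeral)
    moreover have "circ 5 x = circ 5 y \<longleftrightarrow> x = y" for x y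
      using circ_inj[of 5 x y] by auto
    ultimately show ?thesis using e by (cases i; cases j) (auto dest: sym)
  qed
  fix p assume g0: "gA s p = 0"
  let ?f = "\<lambda>p. (Re p)\<^sup>2 + (Im p)\<^sup>2 - 5\<^sup>2" and ?h = "\<lambda>p. (Re (turn p))\<^sup>2 + (Im (turn p))\<^sup>2 - 5\<^sup>2"
  have cont: "continuous_on UNIV ?f" "continuous_on UNIV ?h" unfolding turn_def by (intro continuous_intros)+
  have tc: "q \<in> closure {p. P (turn p)}" if "turn q \<in> closure {p. P p}" for q P
  proof -
    have "turn ` closure {p. P p} \<subseteq> closure {p. P (turn p)}"
      by (rule image_closure_subset) (auto simp: turn_def intro!: continuous_intros closure_subset[THEN subsetD])
    then show ?thesis using that by (metis imageI subsetD turn_turn)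
  qed
  have "p \<in> closure {p. ?f p * ?h p < 0} \<and> p \<in> closure {p. 0 < ?f p * ?h p}"
  proof (cases "?f p = 0")
    case True
    then have "(Re p)\<^sup>2 \<le> 5\<^sup>2" using zero_le_power2[of "Im p"] by linarith
    then have x: "Re p \<ge> - 5" unfolding abs_le_square_iff[symmetric] by linarith
    then have "?h p \<noteq> 0" using True by (simp add: power2_eq_square algebra_simps)
    then show ?thesis using circle_sign_change[of p 5] True by (intro sign_change_mult cont) auto
  next
    case False
    then have "?h p = 0" using g0 by (simp add: gA_def)
    then have "p \<in> closure {p. ?h p < 0} \<and> p \<in> closure {p. 0 < ?h p}"
      using circle_sign_change[of "turn p" 5] tc[of p "\<lambda>p. ?f p < 0"] tc[of p "\<lambda>p. 0 < ?f p"] by (simp del: turn_sel)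
    then show ?thesis using sign_change_mult[OF _ cont(1) False, of ?h] by (simp add: mult.commute del: turn_sel)
  qed
  then show "p \<in> closure {p. gA s p < 0} \<and> p \<in> closure {p. 0 < gA s p}"
    unfolding gA_def by (rule sign_change_eps)
qed

interpretation A: picture "gA s" curveA for s
  by (rule picture_A)

lemma turn_disc:
  "turn p \<in> region (rdisc (turn z) N ms s) \<longleftrightarrow> p \<in> region (rdisc z N ms' s')"
  "turn p \<in> interior (region (rdisc (turn z) N ms s)) \<longleftrightarrow> p \<in> interior (region (rdisc z N ms' s'))"
  by (simp_all add: dist_norm turn_def norm_minus_commute)

text \<open>
  Positions relative to the left circle are those of the turned disc relative to the right one.
\<close>

lemma turn_cuts:
  assumes "cuts (rdisc z N ms' s') (circ 5) (of_real (- 5)) a b" "z' = turn z"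
  shows "cuts (rdisc z' N ms s) (curveA True) (Complex (- 6) 0) a b"
proof -
  have "Complex (- 6) 0 = turn (of_real (- 5))" by (simp add: complex_eq_iff)
  then show ?thesis using assms unfolding cuts_def curveA_simps assms(2) by (simp only: turn_disc[where ms' = ms' and s' = s'] simp_thms)
qed

lemma turn_cocuts:
  assumes "cocuts (rdisc z N ms' s') (circ 5) (of_real (- 5)) a b" "z' = turn z"
  shows "cocuts (rdisc z' N ms s) (curveA True) (Complex (- 6) 0) a b"
proof -
  have "Complex (- 6) 0 = turn (of_real (- 5))" by (simp add: complex_eq_iff)
  then show ?thesis using assms unfolding cocuts_def curveA_simps assms(2) by (simp only: turn_disc[where ms' = ms' and s' = s'] simp_thms)
qed

text \<open>
  The necklace of the adjointness. The 2-box \<open>u\<close> sits at the gap between the circles, in \<open>Au\<close>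
  with its distinguished interval inside the left circle or in \<open>Av\<close> with the opposite one. The
  leftmost point of the left circle carries \<open>Ay\<close> or the smaller \<open>Ax\<close>, and the rightmost point of the
  right circle carries \<open>dW\<close>, which can hold the smaller \<open>Az\<close>. Each of \<open>A1\<close> and \<open>A2\<close> encloses the
  left circle and a part of the right one: a 1-box of shade \<open>s\<close> and, upside down, one of the
  opposite shade. The marks have the parameters \<open>\<plusminus>1\<close> to \<open>\<plusminus>3\<close>, \<open>\<plusminus>1/10\<close> and \<open>\<plusminus>1/20\<close>; centres and
  squared radii are determined by them up to the choice of a nested configuration.
\<close>

definition A1 :: "sign \<Rightarrow> disc" where
  "A1 s = rdisc (Complex (- 8) 0) 89 [circ 5 1, circ 5 (- 1)] s"
definition A2 :: "sign \<Rightarrow> disc" where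
  "A2 s = rdisc (Complex (- 19/2) 0) (233/4) [circ 5 (- 2), circ 5 2] (flip s)"
definition Au :: "sign \<Rightarrow> disc" where
  "Au s = rdisc (Complex (- 11/2) 0) (45/4) [turn (circ 5 (- 3)), circ 5 3, circ 5 (- 3), turn (circ 5 3)] (flip s)"
definition Av :: "sign \<Rightarrow> disc" where
  "Av s = rdisc (Complex (- 11/2) 0) (45/4) [circ 5 (- 3), turn (circ 5 3), turn (circ 5 (- 3)), circ 5 3] (flip s)"
definition Ay :: "sign \<Rightarrow> disc" where
  "Ay s = rdisc (Complex (- 81/5) 0) (2701/2525) [turn (circ 5 (- 1/10)), turn (circ 5 (1/10))] s"
definition Az :: "sign \<Rightarrow> disc" where
  "Az s = rdisc (Complex 5 0) (100/401) [circ 5 (1/20), circ 5 (- 1/20)] (flip s)"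
definition Ax :: "sign \<Rightarrow> disc" where
  "Ax s = rdisc (Complex (- 16) 0) (100/401) [turn (circ 5 (1/20)), turn (circ 5 (- 1/20))] (flip s)"

lemmas discA_defs = A1_def A2_def Au_def Av_def Ay_def Az_def Ax_def dO_def dE_def dW_def

lemma turn_swallows:
  assumes "swallows (rdisc z N ms' s') (circ 5) (of_real (- 5))" "z' = turn z"
  shows "swallows (rdisc z' N ms s) (curveA True) (Complex (- 6) 0)"
proof -
  have "Complex (- 6) 0 = turn (of_real (- 5))" by (simp add: complex_eq_iff)
  then show ?thesis using assms unfolding swallows_def curveA_simps assms(2) by (simp only: turn_disc[where ms' = ms' and s' = s'] simp_thms)
qed

lemma turn_misses:
  assumes "misses (rdisc z N ms' s') (circ 5) (of_real (- 5))" "z' = turn z"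
  shows "misses (rdisc z' N ms s) (curveA True) (Complex (- 6) 0)"
proof -
  have "Complex (- 6) 0 = turn (of_real (- 5))" by (simp add: complex_eq_iff)
  then show ?thesis using assms unfolding misses_def curveA_simps assms(2) by (simp only: turn_disc[where ms' = ms' and s' = s'] simp_thms)
qed

lemma A1_0: "cocuts (A1 s) (circ 5) (of_real (- 5)) (- 1) 1"
  and A2_0: "cocuts (A2 s) (circ 5) (of_real (- 5)) (- 2) 2"
  and Au_0: "cocuts (Au s) (circ 5) (of_real (- 5)) (- 3) 3"
  and Av_0: "cocuts (Av s) (circ 5) (of_real (- 5)) (- 3) 3"
  unfolding discA_defs by (rule cocuts_rdisc; simp add: power2_eq_square)+

lemma Az_0: "cuts (Az s) (circ 5) (of_real (- 5)) (- 1/20) (1/20)"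
  unfolding discA_defs by (rule cuts_rdisc; simp add: power2_eq_square)+

lemma Ay_0: "misses (Ay s) (circ 5) (of_real (- 5))"
  and Ax_0: "misses (Ax s) (circ 5) (of_real (- 5))"
  unfolding discA_defs by (rule misses_rdisc; simp add: power2_eq_square)+

lemma Au_1: "cocuts (Au s) (curveA True) (Complex (- 6) 0) (- 3) 3"
  unfolding Au_def by (rule turn_cocuts[where z = "Complex (- 11/2) 0", OF cocuts_rdisc]) (simp_all add: power2_eq_square complex_eq_iff)
lemma Av_1: "cocuts (Av s) (curveA True) (Complex (- 6) 0) (- 3) 3"
  unfolding Av_def by (rule turn_cocuts[where z = "Complex (- 11/2) 0", OF cocuts_rdisc]) (simp_all add: power2_eq_square complex_eq_iff)
lemma Ay_1: "cuts (Ay s) (curveA True) (Complex (- 6) 0) (- 1/10) (1/10)"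
  unfolding Ay_def by (rule turn_cuts[where z = "Complex (26/5) 0", OF cuts_rdisc]) (simp_all add: power2_eq_square complex_eq_iff)
lemma Ax_1: "cuts (Ax s) (curveA True) (Complex (- 6) 0) (- 1/20) (1/20)"
  unfolding Ax_def by (rule turn_cuts[where z = "Complex 5 0", OF cuts_rdisc]) (simp_all add: power2_eq_square complex_eq_iff)
lemma A1_1: "swallows (A1 s) (curveA True) (Complex (- 6) 0)"
  unfolding A1_def by (rule turn_swallows[where z = "Complex (- 3) 0", OF swallows_rdisc]) (simp_all add: power2_eq_square complex_eq_iff)
lemma A2_1: "swallows (A2 s) (curveA True) (Complex (- 6) 0)"
  unfolding A2_def by (rule turn_swallows[where z = "Complex (- 3/2) 0", OF swallows_rdisc]) (simp_all add: power2_eq_square complex_eq_iff)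
lemma dO_1: "swallows (dO s) (curveA True) (Complex (- 6) 0)"
  unfolding dO_def by (rule turn_swallows[where z = "Complex (- 11/2) 0", OF swallows_rdisc]) (simp_all add: power2_eq_square complex_eq_iff)
lemma dW_1: "misses (dW s) (curveA True) (Complex (- 6) 0)"
  unfolding dW_def by (rule turn_misses[where z = "Complex (- 81/5) 0", OF misses_rdisc]) (simp_all add: power2_eq_square complex_eq_iff)
lemma Az_1: "misses (Az s) (curveA True) (Complex (- 6) 0)"
  unfolding Az_def by (rule turn_misses[where z = "Complex (- 16) 0", OF misses_rdisc]) (simp_all add: power2_eq_square complex_eq_iff)

lemma A1_in_dE: "region (A1 s) \<subseteq> interior (region (dE s))"
  and Ay_in_A1: "region (Ay s) \<subseteq> interior (region (A1 s))"
  and Au_in_A1: "region (Au s) \<subseteq> interior (region (A1 s))"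
  and Av_in_A1: "region (Av s) \<subseteq> interior (region (A1 s))"
  and Av_in_A2: "region (Av s) \<subseteq> interior (region (A2 s))"
  and Az_in_dW: "region (Az s) \<subseteq> interior (region (dW s))"
  and A2_in_A1: "region (A2 s) \<subseteq> interior (region (A1 s))"
  and Ax_in_A2: "region (Ax s) \<subseteq> interior (region (A2 s))"
  and A2_in_dO: "region (A2 s) \<subseteq> interior (region (dO s))"
  and Au_in_dO: "region (Au s) \<subseteq> interior (region (dO s))"
  and Av_in_dO: "region (Av s) \<subseteq> interior (region (dO s))"
  and Ay_in_dO: "region (Ay s) \<subseteq> interior (region (dO s))"
  and Ax_in_dO: "region (Ax s) \<subseteq> interior (region (dO s))"
  unfolding discA_defs by (rule rdisc_in; simp add: power2_eq_square)+

lemma A1_off_dW: "region (A1 s) \<inter> region (dW s) = {}"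
  and Au_off_dW: "region (Au s) \<inter> region (dW s) = {}"
  and Av_off_dW: "region (Av s) \<inter> region (dW s) = {}"
  and Ay_off_Au: "region (Ay s) \<inter> region (Au s) = {}"
  and A2_off_dW: "region (A2 s) \<inter> region (dW s) = {}"
  and Ax_off_Av: "region (Ax s) \<inter> region (Av s) = {}"
  and Ax_off_dW: "region (Ax s) \<inter> region (dW s) = {}"
  and Ay_off_dW: "region (Ay s) \<inter> region (dW s) = {}"
  unfolding discA_defs by (rule rdisc_off; simp add: power2_eq_square)+

lemma adapted_A_O: "adapted (gA s) (dO s)"
proof (rule adapted_O)
  show "gA s p \<noteq> 0" if "p \<in> frontier (region (dO s))" for p
  proof
    assume "gA s p = 0"
    then have "p \<in> interior (region (dO s))"
      using swallows_O[of s] dO_1[of s] unfolding gA_zero swallows_def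
      by (auto simp: curveA_def split: if_splits)
    then show False using that by (simp add: frontier_def)
  qed
qed (simp add: gA_def power2_eq_square)

text \<open>
  In this lemma and its analogues \<open>q\<close> is a rational point of the boundary circle inside the
  distinguished interval. Such points are found by applying a rotation with rational sine and
  cosine, or a reflection, to the position of a mark relative to the centre.
\<close>

lemma adapted_A_A1: "adapted (gA s) (A1 s)"
  unfolding A1_def
  by (rule adapted_A[OF crossing_cocuts[OF _ _ A1_0[unfolded A1_def]] crossing_swallows[OF _ A1_1[unfolded A1_def]], where q = "Complex (- 16) (5)"])
     (auto simp: gA_def mem_sqrt power2_eq_square orient_def circ_def simp del: mem_sphere)
lemma adapted_A_A2: "adapted (gA s) (A2 s)"
  unfolding A2_def
  by (rule adapted_A[OF crossing_cocuts[OF _ _ A2_0[unfolded A2_def]] crossing_swallows[OF _ A2_1[unfolded A2_def]], where q = "Complex (- 19/10) (- 7/10)"])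
     (auto simp: gA_def mem_sqrt power2_eq_square orient_def circ_def simp del: mem_sphere)
lemma adapted_A_Au: "adapted (gA s) (Au s)"
  unfolding Au_def
  by (rule adapted_A[OF crossing_cocuts[OF _ _ Au_0[unfolded Au_def]] crossing_cocuts[OF _ _ Au_1[unfolded Au_def]], where q = "Complex (- 44/5) (3/5)"])
     (auto simp: gA_def mem_sqrt power2_eq_square orient_def circ_def simp del: mem_sphere)
lemma adapted_A_Av: "adapted (gA s) (Av s)"
  unfolding Av_def
  by (rule adapted_A[OF crossing_cocuts[OF _ _ Av_0[unfolded Av_def]] crossing_cocuts[OF _ _ Av_1[unfolded Av_def]], where q = "Complex (- 11/5) (- 3/5)"])
     (auto simp: gA_def mem_sqrt power2_eq_square orient_def circ_def simp del: mem_sphere)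
lemma adapted_A_Ay: "adapted (gA s) (Ay s)"
  unfolding Ay_def
  by (rule adapted_A[OF crossing_misses[OF _ Ay_0[unfolded Ay_def]] crossing_cuts[OF _ _ Ay_1[unfolded Ay_def]], where q = "Complex (- 8332/505) (- 100/101)"])
     (auto simp: gA_def mem_sqrt power2_eq_square orient_def circ_def simp del: mem_sphere)
lemma adapted_A_dW: "adapted (gA s) (dW s)"
  unfolding dW_def
  by (rule adapted_A[OF crossing_cuts[OF _ _ cuts_W[unfolded dW_def]] crossing_misses[OF _ dW_1[unfolded dW_def]], where q = "Complex (2777/505) (100/101)"])
     (auto simp: gA_def mem_sqrt power2_eq_square orient_def circ_def simp del: mem_sphere)
lemma adapted_A_Az: "adapted (gA s) (Az s)"
  unfolding Az_def
  by (rule adapted_A[OF crossing_cuts[OF _ _ Az_0[unfolded Az_def]] crossing_misses[OF _ Az_1[unfolded Az_def]], where q = "Complex (1805/401) (- 10/401)"])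
     (auto simp: gA_def mem_sqrt power2_eq_square orient_def circ_def simp del: mem_sphere)
lemma adapted_A_Ax: "adapted (gA s) (Ax s)"
  unfolding Ax_def
  by (rule adapted_A[OF crossing_misses[OF _ Ax_0[unfolded Ax_def]] crossing_cuts[OF _ _ Ax_1[unfolded Ax_def]], where q = "Complex (- 6216/401) (10/401)"])
     (auto simp: gA_def mem_sqrt power2_eq_square orient_def circ_def simp del: mem_sphere)

text \<open>
  The tangles cut out of this picture. The arcs are those parts of the two circles, \<open>False\<close> for the
  right and \<open>True\<close> for the left one, that remain outside all inner discs.
\<close>

lemma convl_drawing:
  "drawing (gA s) curveA (A1 s) {Ay s, Au s}
     {(False, - 3, - 1), (False, 1, 3), (True, - 3, - 1/10), (True, 1/10, 3)}" (is "drawing _ _ ?D ?I ?S")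
proof (rule drawingI[OF _ _ _ _ _ gA_zero])
  note mem = cocutsD[OF A1_0] swallowsD[OF A1_1] missesD[OF Ay_0] cutsD[OF Ay_1] cocutsD[OF Au_0] cocutsD[OF Au_1]
  show "nested ?D ?I"
    using Ay_in_A1[of s] Au_in_A1[of s] Ay_off_Au[of s]
    by (intro nested_insert nested_1) (auto simp: Int_commute)
  show "p \<notin> btw ?D ?I" if "p \<in> {of_real (- 5), Complex (- 6) 0}" for p
    using that by (elim insertE emptyE) (simp_all only: btw_insert btw_empty mem simp_thms)
  show "curveA j t \<in> btw ?D ?I
      \<longleftrightarrow> (\<exists>(j', u, v)\<in>?S. j' = j \<and> u \<le> t \<and> t \<le> v)" for j t
    by (cases j) (simp_all only: btw_insert btw_empty curveA_simps(1) mem, auto)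
  show "(\<Union>d\<in>insert ?D ?I. set (marks d))
      = (\<Union>(j, u, v)\<in>?S. {curveA j u, curveA j v})"
    by (auto simp: A1_def Ay_def Au_def)
qed (auto simp: adapted_A_A1 adapted_A_Ay adapted_A_Au)

lemma three_drawing:
  "drawing (gA s) curveA (dO s) {Ay s, Au s, dW s}
     {(False, - 3, - 1/10), (False, 1/10, 3), (True, - 3, - 1/10), (True, 1/10, 3)}" (is "drawing _ _ ?D ?I ?S")
proof (rule drawingI[OF _ _ _ _ _ gA_zero])
  note mem = swallowsD[OF swallows_O] swallowsD[OF dO_1] missesD[OF Ay_0] cutsD[OF Ay_1] cocutsD[OF Au_0] cocutsD[OF Au_1] cutsD[OF cuts_W] missesD[OF dW_1]
  show "nested ?D ?I"
    using Ay_in_dO[of s] Au_in_dO[of s] dW_in_dO[of s] Ay_off_Au[of s] Ay_off_dW[of s] Au_off_dW[of s]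
    by (intro nested_insert nested_1) (auto simp: Int_commute)
  show "p \<notin> btw ?D ?I" if "p \<in> {of_real (- 5), Complex (- 6) 0}" for p
    using that by (elim insertE emptyE) (simp_all only: btw_insert btw_empty mem simp_thms)
  show "curveA j t \<in> btw ?D ?I
      \<longleftrightarrow> (\<exists>(j', u, v)\<in>?S. j' = j \<and> u \<le> t \<and> t \<le> v)" for j t
    by (cases j) (simp_all only: btw_insert btw_empty curveA_simps(1) mem, auto)
  show "(\<Union>d\<in>insert ?D ?I. set (marks d))
      = (\<Union>(j, u, v)\<in>?S. {curveA j u, curveA j v})"
    by (auto simp: dO_def Ay_def Au_def dW_def)
qed (auto simp: adapted_A_O adapted_A_Ay adapted_A_Au adapted_A_dW)

lemma three_turned_drawing:
  "drawing (gA s) curveA (dO s) {Ax s, Av s, dW s}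
     {(False, - 3, - 1/10), (False, 1/10, 3), (True, - 3, - 1/20), (True, 1/20, 3)}" (is "drawing _ _ ?D ?I ?S")
proof (rule drawingI[OF _ _ _ _ _ gA_zero])
  note mem = swallowsD[OF swallows_O] swallowsD[OF dO_1] missesD[OF Ax_0] cutsD[OF Ax_1] cocutsD[OF Av_0] cocutsD[OF Av_1] cutsD[OF cuts_W] missesD[OF dW_1]
  show "nested ?D ?I"
    using Ax_in_dO[of s] Av_in_dO[of s] dW_in_dO[of s] Ax_off_Av[of s] Ax_off_dW[of s] Av_off_dW[of s]
    by (intro nested_insert nested_1) (auto simp: Int_commute)
  show "p \<notin> btw ?D ?I" if "p \<in> {of_real (- 5), Complex (- 6) 0}" for p
    using that by (elim insertE emptyE) (simp_all only: btw_insert btw_empty mem simp_thms)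
  show "curveA j t \<in> btw ?D ?I
      \<longleftrightarrow> (\<exists>(j', u, v)\<in>?S. j' = j \<and> u \<le> t \<and> t \<le> v)" for j t
    by (cases j) (simp_all only: btw_insert btw_empty curveA_simps(1) mem, auto)
  show "(\<Union>d\<in>insert ?D ?I. set (marks d))
      = (\<Union>(j, u, v)\<in>?S. {curveA j u, curveA j v})"
    by (auto simp: dO_def Ax_def Av_def dW_def)
qed (auto simp: adapted_A_O adapted_A_Ax adapted_A_Av adapted_A_dW)

lemma rot_W_drawing:
  "drawing (gA s) curveA (dW s) {Az s}
     {(False, - 1/10, - 1/20), (False, 1/20, 1/10)}" (is "drawing _ _ ?D ?I ?S")
proof (rule drawingI[OF _ _ _ _ _ gA_zero])
  note mem = cutsD[OF cuts_W] missesD[OF dW_1] cutsD[OF Az_0] missesD[OF Az_1]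
  show "nested ?D ?I"
    using Az_in_dW[of s]
    by (intro nested_insert nested_1) (auto simp: Int_commute)
  show "p \<notin> btw ?D ?I" if "p \<in> {of_real (- 5), Complex (- 6) 0}" for p
    using that by (elim insertE emptyE) (simp_all only: btw_insert btw_empty mem simp_thms)
  show "curveA j t \<in> btw ?D ?I
      \<longleftrightarrow> (\<exists>(j', u, v)\<in>?S. j' = j \<and> u \<le> t \<and> t \<le> v)" for j t
    by (cases j) (simp_all only: btw_insert btw_empty curveA_simps(1) mem, auto)
  show "(\<Union>d\<in>insert ?D ?I. set (marks d))
      = (\<Union>(j, u, v)\<in>?S. {curveA j u, curveA j v})"
    by (auto simp: dW_def Az_def)
qed (auto simp: adapted_A_dW adapted_A_Az)

lemma rot_A_drawing:
  "drawing (gA s) curveA (A1 s) {A2 s}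
     {(False, - 2, - 1), (False, 1, 2)}" (is "drawing _ _ ?D ?I ?S")
proof (rule drawingI[OF _ _ _ _ _ gA_zero])
  note mem = cocutsD[OF A1_0] swallowsD[OF A1_1] cocutsD[OF A2_0] swallowsD[OF A2_1]
  show "nested ?D ?I"
    using A2_in_A1[of s]
    by (intro nested_insert nested_1) (auto simp: Int_commute)
  show "p \<notin> btw ?D ?I" if "p \<in> {of_real (- 5), Complex (- 6) 0}" for p
    using that by (elim insertE emptyE) (simp_all only: btw_insert btw_empty mem simp_thms)
  show "curveA j t \<in> btw ?D ?I
      \<longleftrightarrow> (\<exists>(j', u, v)\<in>?S. j' = j \<and> u \<le> t \<and> t \<le> v)" for j t
    by (cases j) (simp_all only: btw_insert btw_empty curveA_simps(1) mem, auto)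
  show "(\<Union>d\<in>insert ?D ?I. set (marks d))
      = (\<Union>(j, u, v)\<in>?S. {curveA j u, curveA j v})"
    by (auto simp: A1_def A2_def)
qed (auto simp: adapted_A_A1 adapted_A_A2)

lemma turned_pair_drawing:
  "drawing (gA s) curveA (dO s) {A2 s, dW s}
     {(False, - 2, - 1/10), (False, 1/10, 2)}" (is "drawing _ _ ?D ?I ?S")
proof (rule drawingI[OF _ _ _ _ _ gA_zero])
  note mem = swallowsD[OF swallows_O] swallowsD[OF dO_1] cocutsD[OF A2_0] swallowsD[OF A2_1] cutsD[OF cuts_W] missesD[OF dW_1]
  show "nested ?D ?I"
    using A2_in_dO[of s] dW_in_dO[of s] A2_off_dW[of s]
    by (intro nested_insert nested_1) (auto simp: Int_commute)
  show "p \<notin> btw ?D ?I" if "p \<in> {of_real (- 5), Complex (- 6) 0}" for p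
    using that by (elim insertE emptyE) (simp_all only: btw_insert btw_empty mem simp_thms)
  show "curveA j t \<in> btw ?D ?I
      \<longleftrightarrow> (\<exists>(j', u, v)\<in>?S. j' = j \<and> u \<le> t \<and> t \<le> v)" for j t
    by (cases j) (simp_all only: btw_insert btw_empty curveA_simps(1) mem, auto)
  show "(\<Union>d\<in>insert ?D ?I. set (marks d))
      = (\<Union>(j, u, v)\<in>?S. {curveA j u, curveA j v})"
    by (auto simp: dO_def A2_def dW_def)
qed (auto simp: adapted_A_O adapted_A_A2 adapted_A_dW)

lemma convr_drawing:
  "drawing (gA s) curveA (A2 s) {Av s, Ax s}
     {(False, - 3, - 2), (False, 2, 3), (True, - 3, - 1/20), (True, 1/20, 3)}" (is "drawing _ _ ?D ?I ?S")
proof (rule drawingI[OF _ _ _ _ _ gA_zero])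
  note mem = cocutsD[OF A2_0] swallowsD[OF A2_1] cocutsD[OF Av_0] cocutsD[OF Av_1] missesD[OF Ax_0] cutsD[OF Ax_1]
  show "nested ?D ?I"
    using Av_in_A2[of s] Ax_in_A2[of s] Ax_off_Av[of s]
    by (intro nested_insert nested_1) (auto simp: Int_commute)
  show "p \<notin> btw ?D ?I" if "p \<in> {of_real (- 5), Complex (- 6) 0}" for p
    using that by (elim insertE emptyE) (simp_all only: btw_insert btw_empty mem simp_thms)
  show "curveA j t \<in> btw ?D ?I
      \<longleftrightarrow> (\<exists>(j', u, v)\<in>?S. j' = j \<and> u \<le> t \<and> t \<le> v)" for j t
    by (cases j) (simp_all only: btw_insert btw_empty curveA_simps(1) mem, auto)
  show "(\<Union>d\<in>insert ?D ?I. set (marks d))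
      = (\<Union>(j, u, v)\<in>?S. {curveA j u, curveA j v})"
    by (auto simp: A2_def Av_def Ax_def)
qed (auto simp: adapted_A_A2 adapted_A_Av adapted_A_Ax)

lemma off_neq: "adapted g a \<Longrightarrow> region a \<inter> region b = {} \<Longrightarrow> a \<noteq> b"
  by (auto simp: adapted_def)

lemma A_marks [simp]:
  "marks (A1 s) = [circ 5 1, circ 5 (- 1)]" "marks (A2 s) = [circ 5 (- 2), circ 5 2]"
  "marks (Au s) = [turn (circ 5 (- 3)), circ 5 3, circ 5 (- 3), turn (circ 5 3)]"
  "marks (Av s) = [circ 5 (- 3), turn (circ 5 3), turn (circ 5 (- 3)), circ 5 3]"
  "marks (Ay s) = [turn (circ 5 (- 1/10)), turn (circ 5 (1/10))]"
  "marks (Az s) = [circ 5 (1/20), circ 5 (- 1/20)]"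
  "marks (Ax s) = [turn (circ 5 (1/20)), turn (circ 5 (- 1/20))]"
  "marks (dW s) = [circ 5 (- 1/10), circ 5 (1/10)]"
  by (simp_all add: discA_defs)

lemma A_shade [simp]:
  "shade (A1 s) = s" "shade (A2 s) = flip s" "shade (Au s) = flip s" "shade (Av s) = flip s"
  "shade (Ay s) = s" "shade (Az s) = flip s" "shade (Ax s) = flip s"
  by (simp_all add: discA_defs)

lemma A_half [simp]:
  "half_marks (A1 s) = 1" "half_marks (A2 s) = 1" "half_marks (Au s) = 2" "half_marks (Av s) = 2"
  "half_marks (Ay s) = 1" "half_marks (Az s) = 1" "half_marks (Ax s) = 1"
  by (simp_all add: half_marks_def)

lemma A_neq:
  "Ay s \<noteq> Au s" "Ay s \<noteq> dW s" "Au s \<noteq> dW s" "Ax s \<noteq> Av s" "Ax s \<noteq> dW s" "Av s \<noteq> dW s"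
  "A1 s \<noteq> dW s" "A2 s \<noteq> dW s"
  using off_neq[OF adapted_A_Ay Ay_off_Au] off_neq[OF adapted_A_Ay Ay_off_dW] off_neq[OF adapted_A_Au Au_off_dW]
    off_neq[OF adapted_A_Ax Ax_off_Av] off_neq[OF adapted_A_Ax Ax_off_dW] off_neq[OF adapted_A_Av Av_off_dW]
    off_neq[OF adapted_A_A1 A1_off_dW] off_neq[OF adapted_A_A2 A2_off_dW] by blast+

lemma A_neq': "Az s \<noteq> Ay s" "Az s \<noteq> Au s" "Az s \<noteq> dW s"
proof -
  have "region (Az s) \<subseteq> region (dW s)" using Az_in_dW interior_subset by blast
  then have "region (Az s) \<inter> region (Ay s) = {}" "region (Az s) \<inter> region (Au s) = {}"
    using Ay_off_dW[of s] Au_off_dW[of s] by blast+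
  then show "Az s \<noteq> Ay s" "Az s \<noteq> Au s"
    using off_neq[OF adapted_A_Az] by blast+
  show "Az s \<noteq> dW s" using A_shade(6)[of s] half_marks_dW(2)[of s] by (metis flip_neq(1))
qed

lemma A_half_neq [simp]:
  "A1 s \<noteq> Ay s" "A1 s \<noteq> Au s" "A1 s \<noteq> Az s" "A1 s \<noteq> A2 s" "A1 s \<noteq> Ax s" "A1 s \<noteq> Av s"
  "A2 s \<noteq> Ax s" "A2 s \<noteq> Av s"
proof -
  have sub: "a \<noteq> b" if "region a \<subseteq> interior (region b)" "adapted g b" for a b g
  proof
    assume e: "a = b"
    have "interior (region b) \<noteq> region b" using that(2) by (auto simp: adapted_def)
    then show False using that(1) interior_subset[of "region b"] unfolding e by blast
  qed
  show "A1 s \<noteq> Ay s" "A1 s \<noteq> Au s" "A1 s \<noteq> A2 s" "A1 s \<noteq> Av s" "A2 s \<noteq> Ax s" "A2 s \<noteq> Av s"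
    using sub[OF Ay_in_A1 adapted_A_A1] sub[OF Au_in_A1 adapted_A_A1] sub[OF A2_in_A1 adapted_A_A1]
      sub[OF Av_in_A1 adapted_A_A1] sub[OF Ax_in_A2 adapted_A_A2] sub[OF Av_in_A2 adapted_A_A2] by metis+
  show "A1 s \<noteq> Az s" "A1 s \<noteq> Ax s" using A_shade(1,6,7)[of s] by (metis flip_neq(1))+
qed

text \<open>
  Inside \<open>A1\<close> the left circle joins \<open>y\<close> to the left side of \<open>u\<close>; what remains is a 1-box on the right
  circle.
\<close>

lemma A_convl: "left_convolution_tangle s (draw (gA s) (A1 s) {Ay s, Au s}) (Ay s) (Au s)"
  unfolding left_convolution_tangle_def
  using A.drawing_planar[OF convl_drawing[of s]] A.drawing_no_closed[OF convl_drawing[of s]]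
    A.drawing_joined_all[OF convl_drawing[of s]] A_neq[of s]
  by (simp add: box_type_def top_mark_def bot_mark_def)

text \<open>
  Inside \<open>A2\<close>, read upside down, the left circle joins the right side of \<open>u\<close> to the 1-box at its
  leftmost point.
\<close>

lemma A_convr: "right_convolution_tangle (flip s) (draw (gA s) (A2 s) {Av s, Ax s}) (Av s) (Ax s)"
  unfolding right_convolution_tangle_def
  using A.drawing_planar[OF convr_drawing[of s]] A.drawing_no_closed[OF convr_drawing[of s]]
    A.drawing_joined_all[OF convr_drawing[of s]] A_neq[of s]
  by (simp add: box_type_def top_mark_def bot_mark_def)

lemma A_rot_W: "rotation_tangle (flip s) (draw (gA s) (dW s) {Az s}) (Az s)"
  unfolding rotation_tangle_def
  using A.drawing_planar[OF rot_W_drawing[of s]] A.drawing_no_closed[OF rot_W_drawing[of s]]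
    A.drawing_joined_all[OF rot_W_drawing[of s]]
  by (simp add: box_type_def top_mark_def bot_mark_def)

lemma A_rot_A: "rotation_tangle (flip s) (draw (gA s) (A1 s) {A2 s}) (A2 s)"
  unfolding rotation_tangle_def
  using A.drawing_planar[OF rot_A_drawing[of s]] A.drawing_no_closed[OF rot_A_drawing[of s]]
    A.drawing_joined_all[OF rot_A_drawing[of s]]
  by (simp add: box_type_def top_mark_def bot_mark_def)

lemma adapted_circle_A1: "adapted (circleg s) (A1 s)"
  unfolding A1_def
  by (rule adapted_circle[OF crossing_cocuts[OF _ _ A1_0[unfolded A1_def]], where q = "Complex (- 16) 5"])
     (auto simp: circleg_def mem_sqrt power2_eq_square orient_def circ_def simp del: mem_sphere)

text \<open>
  Once \<open>A1\<close> covers the left circle, only the right circle is visible between the discs.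
\<close>

lemma A_pair:
  "draw (gA s) (dO s) {A1 s, dW s} = draw (circleg s) (dO s) {A1 s, dW s}"
proof (rule draw_cong)
  fix p assume "p \<in> btw (dO s) {A1 s, dW s}"
  then have "p \<notin> interior (region (A1 s))" by (simp add: btw_insert)
  moreover have "cball (Complex (- 11) 0) (sqrt 25) \<subseteq> interior (region (A1 s))"
    unfolding A1_def rdisc_simps interior_cball
    by (rule cball_sqrt_subset) (simp_all add: power2_eq_square)
  ultimately have "p \<notin> cball (Complex (- 11) 0) (sqrt 25)" by blast
  then have "0 < (Re p + 11)\<^sup>2 + (Im p)\<^sup>2 - 25" unfolding mem_sqrt by simp
  moreover have "(Re (turn p))\<^sup>2 + (Im (turn p))\<^sup>2 = (Re p + 11)\<^sup>2 + (Im p)\<^sup>2"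
    by (simp add: power2_eq_square algebra_simps)
  ultimately have "0 < (Re (turn p))\<^sup>2 + (Im (turn p))\<^sup>2 - 5\<^sup>2" by simp
  then show "sgn (gA s p) = sgn (circleg s p)"
    unfolding gA_def circleg_def by (simp add: sgn_mult del: turn_sel)
qed

lemma A_pair_planar: "planar_tangle (draw (gA s) (dO s) {A1 s, dW s})" "nested (dO s) {A1 s, dW s}"
proof -
  have D: "drawing (circleg s) (\<lambda>_ :: unit. circ 5) (dO s) {A1 s, dW s} {((), - 1, - 1/10), ((), 1/10, 1)}"
    by (rule pair_drawing[OF A1_0 _ _ adapted_circle_A1 A1_in_dE A1_off_dW]) auto
  show "planar_tangle (draw (gA s) (dO s) {A1 s, dW s})" "nested (dO s) {A1 s, dW s}"
    unfolding A_pair using circle.drawing_planar[OF D] drawing_nested[OF D] by blast+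
qed

lemma turn_cball: "turn ` cball z r = cball (turn z) r"
proof (intro equalityI subsetI)
  fix p assume "p \<in> turn ` cball z r"
  then show "p \<in> cball (turn z) r" by (auto simp: dist_norm turn_def norm_minus_commute)
next
  fix p assume "p \<in> cball (turn z) r"
  then have "turn p \<in> cball z r" by (simp add: dist_norm turn_def norm_minus_commute algebra_simps)
  then show "p \<in> turn ` cball z r" by (metis imageI turn_turn)
qed

lemma map_turn_rdisc: "map_disc turn (rdisc z N ms s) = rdisc (turn z) N (map turn ms) s"
  by (simp add: map_disc_def rdisc_def turn_cball)

lemma interior_turn: "interior (turn ` R) = turn ` interior R"
proof -
  have l: "turn ` S = (\<lambda>p. Complex (- 11) 0 + p) ` uminus ` S" for S
    by (auto simp: turn_def image_image)
  show ?thesis unfolding l interior_translation interior_negations ..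
qed

lemma map_turn_draw:
  "map_tangle turn (draw (gA s) D I) = draw (gA s) (map_disc turn D) (map_disc turn ` I)"
proof -
  have "inj turn" by (metis injI turn_turn)
  then have "turn ` btw D I = btw (map_disc turn D) (map_disc turn ` I)"
    using image_btw[of turn D I] interior_turn by (simp add: btw_def map_disc_def)
  then show ?thesis
    using image_level[of "gA s" turn "gA s" "btw D I" "\<lambda>x. x = 0"] image_level[of "gA s" turn "gA s" "btw D I" "\<lambda>x. x < 0"] gA_turn
    by (simp add: map_tangle_def draw_def)
qed

lemma map_turn_A: "map_disc turn (dO s) = dO s" "map_disc turn (Ax s) = Az s" "map_disc turn (Av s) = Au s"
    "map_disc turn (dW s) = Ay s"
proof -
  have t: "turn (Complex a b) = Complex (- 11 - a) (- b)" for a b by (simp add: complex_eq_iff)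
  show "map_disc turn (dO s) = dO s" "map_disc turn (Ax s) = Az s" "map_disc turn (Av s) = Au s"
    "map_disc turn (dW s) = Ay s"
    unfolding discA_defs map_turn_rdisc t by simp_all
qed

text \<open>
  A rotation by \<open>\<pi> t\<close> followed by a translation by \<open>- 11 t\<close>, as \<open>t\<close> runs from 0 to 1.
\<close>

lemma plane_isotopy_turn: "plane_isotopy turn"
proof -
  define k where "k = (\<lambda>(t::real, p). cis (pi * t) * p + of_real (- 11 * t))"
  have "continuous_on ({0..1} \<times> UNIV) k"
    unfolding k_def split_beta cis_conv_exp by (intro continuous_intros)
  moreover have "\<exists>g'. homeomorphism UNIV UNIV (\<lambda>p. k (t, p)) g'" for t
  proof (intro exI homeomorphismI)
    let ?g = "\<lambda>q. cis (- (pi * t)) * (q - of_real (- 11 * t))"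
    have c: "cis (pi * t) * cis (- (pi * t)) = 1" "cis (- (pi * t)) * cis (pi * t) = 1" by (simp_all add: cis_mult)
    show "continuous_on UNIV (\<lambda>p. k (t, p))" "continuous_on UNIV ?g"
      unfolding k_def prod.case by (intro continuous_intros)+
    show "?g (k (t, p)) = p" for p
      using c(2) by (simp add: k_def mult.assoc[symmetric])
    show "k (t, ?g q) = q" for q
      using c(1) by (simp add: k_def mult.assoc[symmetric])
  qed auto
  moreover have "k (0, p) = id p" "k (1, p) = turn p" for p
    by (auto simp: k_def turn_def complex_eq_iff)
  moreover have "continuous_map (prod_topology (top_of_set {0..1}) (top_of_set UNIV)) (top_of_set UNIV) k"
    unfolding prod_topology_subtopology_eu using \<open>continuous_on ({0..1} \<times> UNIV) k\<close> by simp
  ultimately show ?thesis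
    unfolding plane_isotopy_def homotopic_with_def by blast
qed

context cstar_planar_algebra
begin

lemma A_closed [simp]:
  "x \<in> carrier (A n s) \<Longrightarrow> y \<in> carrier (A n s) \<Longrightarrow> x + y \<in> carrier (A n s)"
  "x \<in> carrier (A n s) \<Longrightarrow> cscale c x \<in> carrier (A n s)"
  "x \<in> carrier (A n s) \<Longrightarrow> y \<in> carrier (A n s) \<Longrightarrow> x - y \<in> carrier (A n s)"
  "0 \<in> carrier (A n s)" "x \<in> carrier (A n s) \<Longrightarrow> - x \<in> carrier (A n s)"
  by (rule subspace_add[OF subspace_V] subspace_scale[OF subspace_V] subspace_diff[OF subspace_V]
    subspace_0[OF subspace_V] subspace_neg[OF subspace_V]; assumption)+

context
  fixes rot conv_left conv_right
  assumes rot: "is_rotation (boxes A) Z rot"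
    and left: "is_left_convolution (boxes A) Z conv_left"
    and right: "is_right_convolution (boxes A) Z conv_right"
begin

lemma left_draw:
  assumes "f (Ay s) \<in> carrier (A 1 s)" "f (Au s) \<in> carrier (A 2 (flip s))"
  shows "Z (draw (gA s) (A1 s) {Ay s, Au s}) f = conv_left s (f (Ay s)) (f (Au s))"
proof -
  have "conv_left s (f (Ay s)) (f (Au s))
      = Z (draw (gA s) (A1 s) {Ay s, Au s}) (\<lambda>d. if d = Ay s then f (Ay s) else f (Au s))"
    using left A_convl[of s] assms unfolding is_left_convolution_def by blast
  also have "\<dots> = Z (draw (gA s) (A1 s) {Ay s, Au s}) f"
    by (rule Z_draw_cong[OF A.drawing_planar[OF convl_drawing]]) (use assms A_neq in auto)
  finally show ?thesis by simp
qed

lemma right_draw: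
  assumes "f (Ax s) \<in> carrier (A 1 (flip s))" "f (Av s) \<in> carrier (A 2 (flip s))"
  shows "Z (draw (gA s) (A2 s) {Av s, Ax s}) f = conv_right (flip s) (f (Av s)) (f (Ax s))"
proof -
  have "conv_right (flip s) (f (Av s)) (f (Ax s))
      = Z (draw (gA s) (A2 s) {Av s, Ax s}) (\<lambda>d. if d = Av s then f (Av s) else f (Ax s))"
    using right A_convr[of s] assms unfolding is_right_convolution_def by blast
  also have "\<dots> = Z (draw (gA s) (A2 s) {Av s, Ax s}) f"
    by (rule Z_draw_cong[OF A.drawing_planar[OF convr_drawing]]) (use assms A_neq in auto)
  finally show ?thesis by simp
qed

lemma conv_left_closed:
  assumes "y \<in> carrier (A 1 s)" "u \<in> carrier (A 2 (flip s))"
  shows "conv_left s y u \<in> carrier (A 1 s)"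
proof -
  define f where "f d = (if d = Ay s then y else u)" for d
  have f: "f (Ay s) = y" "f (Au s) = u" using A_neq[of s] by (auto simp: f_def)
  have "Z (draw (gA s) (A1 s) {Ay s, Au s}) f \<in> carrier (A (half_marks (A1 s)) (shade (A1 s)))"
    by (rule Z_draw_closed[OF A.drawing_planar[OF convl_drawing]]) (use assms in \<open>auto simp: f\<close>)
  then show ?thesis using left_draw[of f s] assms by (simp add: f)
qed

lemma conv_right_closed:
  assumes "z \<in> carrier (A 1 (flip s))" "u \<in> carrier (A 2 (flip s))"
  shows "conv_right (flip s) u z \<in> carrier (A 1 (flip s))"
proof -
  define f where "f d = (if d = Ax s then z else u)" for d
  have f: "f (Ax s) = z" "f (Av s) = u" using A_neq[of s] by (auto simp: f_def)
  have "Z (draw (gA s) (A2 s) {Av s, Ax s}) f \<in> carrier (A (half_marks (A2 s)) (shade (A2 s)))"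
    by (rule Z_draw_closed[OF A.drawing_planar[OF convr_drawing]]) (use assms in \<open>auto simp: f\<close>)
  then show ?thesis using right_draw[of f s] assms by (simp add: f)
qed

lemma rot_W_draw:
  assumes "f (Az s) \<in> carrier (A 1 (flip s))"
  shows "Z (draw (gA s) (dW s) {Az s}) f = rot (flip s) (f (Az s))"
  unfolding rot_tangle[OF rot A_rot_W assms]
  by (rule Z_draw_cong[OF A.drawing_planar[OF rot_W_drawing]]) (use assms in auto)

lemma rot_A_draw:
  assumes "f (A2 s) \<in> carrier (A 1 (flip s))"
  shows "Z (draw (gA s) (A1 s) {A2 s}) f = rot (flip s) (f (A2 s))"
  unfolding rot_tangle[OF rot A_rot_A assms]
  by (rule Z_draw_cong[OF A.drawing_planar[OF rot_A_drawing]]) (use assms in auto)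

lemma A_trace:
  assumes "f (A1 s) \<in> carrier (A 1 s)" "f (dW s) \<in> carrier (A 1 s)"
  shows "tr 0 s (Z (draw (gA s) (dO s) {A1 s, dW s}) f) = tr 1 s (f (A1 s) \<otimes>\<^bsub>A 1 s\<^esub> f (dW s))"
  unfolding A_pair
  by (rule trace_mult[OF A1_0 _ _ _ adapted_circle_A1 A1_in_dE A1_off_dW]) (use assms in auto)

text \<open>
  Both sides are the closed necklace \<open>{Ay, Au, Az}\<close>. On the left side \<open>A1\<close> is resolved into \<open>y\<close> and
  \<open>u\<close>, and \<open>dW\<close>, carrying the half turn of \<open>z\<close>, into \<open>Az\<close>. On the right side \<open>A1\<close> is resolved into
  \<open>A2\<close>, which stands the other way, and this into \<open>u\<close> and \<open>z\<close>, while \<open>dW\<close> holds \<open>y\<close>; this necklace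
  becomes the former one under the half turn of the plane.
\<close>

lemma conv_adjoint:
  assumes y: "y \<in> carrier (A 1 s)" and u: "u \<in> carrier (A 2 (flip s))" and z: "z \<in> carrier (A 1 (flip s))"
  shows "tr 1 s (conv_left s y u \<otimes>\<^bsub>A 1 s\<^esub> rot (flip s) z)
    = tr 1 s (rot (flip s) (conv_right (flip s) u z) \<otimes>\<^bsub>A 1 s\<^esub> y)"
proof -
  define rz where "rz = rot (flip s) z"
  define l where "l = conv_left s y u"
  define v where "v = conv_right (flip s) u z"
  define rv where "rv = rot (flip s) v"
  have c: "rz \<in> carrier (A 1 s)" "l \<in> carrier (A 1 s)" "v \<in> carrier (A 1 (flip s))" "rv \<in> carrier (A 1 s)"
    using rot_closed[OF rot z] conv_left_closed[OF y u] conv_right_closed[OF z u]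
      rot_closed[OF rot conv_right_closed[OF z u]]
    by (simp_all add: rz_def l_def v_def rv_def)
  note three = A.drawing_planar[OF three_drawing[of s]] drawing_nested[OF three_drawing[of s]]
  define f where "f d = (if d = Ay s then y else if d = Au s then u else if d = Az s then z
      else if d = dW s then rz else l)" for d
  have f: "f (Ay s) = y" "f (Au s) = u" "f (Az s) = z" "f (dW s) = rz" "f (A1 s) = l"
    using A_neq[of s] A_neq'[of s] A_half(1,3)[of s] A_half_neq by (auto simp: f_def)
  have "tr 1 s (l \<otimes>\<^bsub>A 1 s\<^esub> rz) = tr 0 s (Z (draw (gA s) (dO s) {A1 s, dW s}) f)"
    using A_trace[of f s] c by (simp add: f)
  also have "Z (draw (gA s) (dO s) {A1 s, dW s}) f
      = Z (draw (gA s) (dO s) {A1 s, dW s}) (f(A1 s := Z (draw (gA s) (A1 s) {Ay s, Au s}) f))"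
    using left_draw[of f s] y u by (simp add: f l_def fun_upd_idem)
  also have "\<dots> = Z (draw (gA s) (dO s) {Ay s, Au s, dW s}) f"
    by (rule Z_plug[symmetric, OF A_pair_planar A.drawing_planar[OF convl_drawing] drawing_nested[OF convl_drawing]])
       (use A_neq[of s] y u c in \<open>auto simp: f\<close>)
  also have "\<dots> = Z (draw (gA s) (dO s) {Ay s, Au s, dW s}) (f(dW s := Z (draw (gA s) (dW s) {Az s}) f))"
    using rot_W_draw[of f s] z by (simp add: f rz_def fun_upd_idem)
  also have "\<dots> = Z (draw (gA s) (dO s) {Ay s, Au s, Az s}) f"
    by (rule Z_plug[symmetric, OF three A.drawing_planar[OF rot_W_drawing] drawing_nested[OF rot_W_drawing]])
       (use A_neq[of s] y u z in \<open>auto simp: f\<close>)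
  finally have 1: "tr 1 s (l \<otimes>\<^bsub>A 1 s\<^esub> rz) = tr 0 s (Z (draw (gA s) (dO s) {Ay s, Au s, Az s}) f)" .

  define e where "e d = (if d = Ax s then z else if d = Av s then u else if d = dW s then y
      else if d = A2 s then v else rv)" for d
  have e: "e (Ax s) = z" "e (Av s) = u" "e (dW s) = y" "e (A2 s) = v" "e (A1 s) = rv"
    using A_neq[of s] A_half_neq by (auto simp: e_def)
  note D2 = turned_pair_drawing[of s] and D3 = three_turned_drawing[of s]
  have "tr 1 s (rv \<otimes>\<^bsub>A 1 s\<^esub> y) = tr 0 s (Z (draw (gA s) (dO s) {A1 s, dW s}) e)"
    using A_trace[of e s] c y by (simp add: e)
  also have "Z (draw (gA s) (dO s) {A1 s, dW s}) e
      = Z (draw (gA s) (dO s) {A1 s, dW s}) (e(A1 s := Z (draw (gA s) (A1 s) {A2 s}) e))"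
    using rot_A_draw[of e s] c by (simp add: e rv_def fun_upd_idem)
  also have "\<dots> = Z (draw (gA s) (dO s) {A2 s, dW s}) e"
    by (rule Z_plug[symmetric, OF A_pair_planar A.drawing_planar[OF rot_A_drawing] drawing_nested[OF rot_A_drawing]])
       (use A_neq[of s] y u c in \<open>auto simp: e\<close>)
  also have "\<dots> = Z (draw (gA s) (dO s) {A2 s, dW s}) (e(A2 s := Z (draw (gA s) (A2 s) {Av s, Ax s}) e))"
    using right_draw[of e s] z u by (simp add: e v_def fun_upd_idem)
  also have "\<dots> = Z (draw (gA s) (dO s) {Ax s, Av s, dW s}) e"
    by (rule Z_plug[symmetric, OF A.drawing_planar[OF D2] drawing_nested[OF D2]
          A.drawing_planar[OF convr_drawing] drawing_nested[OF convr_drawing]])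
       (use A_neq[of s] y u z in \<open>auto simp: e\<close>)
  also have "\<dots> = Z (draw (gA s) (dO s) {Ax s, Av s, dW s}) (\<lambda>d. f (map_disc turn d))"
    by (rule Z_draw_cong[OF A.drawing_planar[OF D3]]) (use y u z in \<open>auto simp: e f map_turn_A\<close>)
  also have "\<dots> = Z (map_tangle turn (draw (gA s) (dO s) {Ax s, Av s, dW s})) f"
    by (rule Z_isotopy[symmetric, OF A.drawing_planar[OF D3] plane_isotopy_turn])
       (use y u z in \<open>auto simp: labelling_def map_turn_draw map_turn_A f\<close>)
  also have "\<dots> = Z (draw (gA s) (dO s) {Ay s, Au s, Az s}) f"
    by (simp add: map_turn_draw map_turn_A insert_commute)
  finally have "tr 1 s (rv \<otimes>\<^bsub>A 1 s\<^esub> y) = tr 0 s (Z (draw (gA s) (dO s) {Ay s, Au s, Az s}) f)" .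
  then show ?thesis using 1 by (simp add: l_def rz_def rv_def v_def)
qed

end

end

section \<open>Two concentric circles: positivity of the convolution\<close>

text \<open>
  The annulus between the circles of radius 4 and 5 has the shade opposite to \<open>s\<close>.
\<close>

definition gC :: "sign \<Rightarrow> complex \<Rightarrow> real" where
  "gC s p = eps s * (((Re p)\<^sup>2 + (Im p)\<^sup>2 - 5\<^sup>2) * ((Re p)\<^sup>2 + (Im p)\<^sup>2 - 4\<^sup>2))"

definition curveC :: "bool \<Rightarrow> real \<Rightarrow> complex" where
  "curveC j = (if j then circ 4 else circ 5)"

lemma curveC_simps [simp]: "curveC False = circ 5" "curveC True = circ 4"
  by (auto simp: curveC_def)

lemma gC_zero: "gC s p = 0 \<longleftrightarrow> (\<exists>j t. p = curveC j t) \<or> p \<in> {of_real (- 5), of_real (- 4)}"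
proof -
  have "gC s p = 0 \<longleftrightarrow> (Re p)\<^sup>2 + (Im p)\<^sup>2 = 5\<^sup>2 \<or> (Re p)\<^sup>2 + (Im p)\<^sup>2 = 4\<^sup>2"
    unfolding gC_def by simp
  also have "\<dots> \<longleftrightarrow> ((\<exists>t. p = circ 5 t) \<or> p = of_real (- 5)) \<or> ((\<exists>t. p = circ 4 t) \<or> p = of_real (- 4))"
    using on_circle_iff[of 5 p] on_circle_iff[of 4 p] by simp
  finally show ?thesis by (auto simp: curveC_def split: if_splits)
qed

lemma picture_C: "picture (gC s) curveC"
proof
  show "continuous_on UNIV (gC s)" unfolding gC_def by (intro continuous_intros)
  show "continuous_on UNIV (curveC j)" for j
    by (cases j) (auto simp: continuous_circ)
  show "i = j \<and> a = b" if e: "curveC i a = curveC j b" for i j a b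
  proof -
    have "circ 5 x \<noteq> circ 4 y" for x y
      using circ_on[of 5 x] circ_on[of 4 y] by auto
    then show ?thesis using e circ_inj[of 5 a b] circ_inj[of 4 a b] by (cases i; cases j) (auto dest: sym)
  qed
  fix p assume g0: "gC s p = 0"
  let ?f = "\<lambda>p. (Re p)\<^sup>2 + (Im p)\<^sup>2 - 5\<^sup>2" and ?h = "\<lambda>p. (Re p)\<^sup>2 + (Im p)\<^sup>2 - 4\<^sup>2"
  have cont: "continuous_on UNIV ?f" "continuous_on UNIV ?h" by (intro continuous_intros)+
  have "p \<in> closure {p. ?f p * ?h p < 0} \<and> p \<in> closure {p. 0 < ?f p * ?h p}"
  proof (cases "?f p = 0")
    case True
    then have "?h p \<noteq> 0" by simp
    then show ?thesis using circle_sign_change[of p 5] True by (intro sign_change_mult cont) auto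
  next
    case False
    then have "?h p = 0" using g0 by (simp add: gC_def)
    then show ?thesis
      using sign_change_mult[OF _ cont(1) False, of ?h] circle_sign_change[of p 4] by (simp add: mult.commute)
  qed
  then show "p \<in> closure {p. gC s p < 0} \<and> p \<in> closure {p. 0 < gC s p}"
    unfolding gC_def by (rule sign_change_eps)
qed

interpretation C: picture "gC s" curveC for s
  by (rule picture_C)

lemmas adapted_C = adapted_two[where \<gamma> = curveC, unfolded curveC_simps, OF gC_zero]

text \<open>
  The picture of the positivity. At its left the 2-box \<open>Cu\<close> lies across both circles. \<open>Cz\<close> is at the
  rightmost point of the inner circle and splits into \<open>Ce2\<close> below and \<open>Ce1\<close> above the real axis;
  \<open>dW\<close> on the outer circle splits into \<open>Cd2\<close> below and \<open>Cd1\<close> above. Alternatively \<open>Cd1\<close> and \<open>Ce1\<close>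
  form the 2-box \<open>CF1\<close>, whose mirror image \<open>CF2\<close> consists of \<open>Cd2\<close> and \<open>Ce2\<close>; the two are stacked in
  \<open>CH\<close>, and \<open>Cu\<close> and \<open>CH\<close> are stacked in \<open>CG\<close>, which leaves out one closing arc of each circle.
  The four small discs have marks at the parameters \<open>1/32\<close> and \<open>1/36\<close> up to sign. The values \<open>2/81\<close>
  and \<open>18/79\<close>, below and above these, are the half-angle tangents of \<open>2 arctan (1/8)\<close> diminished
  and increased by \<open>2 arctan (1/10)\<close>, so that \<open>CF1\<close> is symmetric about the ray of parameter \<open>1/8\<close>.
\<close>

definition C1 :: "sign \<Rightarrow> disc" where
  "C1 s = rdisc (Complex (- 1) (0)) (26) [circ 5 (1), circ 5 (- 1)] s"
definition Cu :: "sign \<Rightarrow> disc" where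
  "Cu s = rdisc (Complex (- 45/16) (0)) (1513/256) [circ 5 (7), circ 4 (3), circ 4 (- 3), circ 5 (- 7)] s"
definition Cz :: "sign \<Rightarrow> disc" where
  "Cz s = rdisc (Complex (3) (0)) (625/577) [circ 4 (1/24), circ 4 (- 1/24)] s"
definition Cd1 :: "sign \<Rightarrow> disc" where
  "Cd1 s = rdisc (Complex (1327103/265885) (78404/265885)) (16/53177) [circ 5 (1/36), circ 5 (1/32)] s"
definition Cd2 :: "sign \<Rightarrow> disc" where
  "Cd2 s = rdisc (Complex (1327103/265885) (- 78404/265885)) (16/53177) [circ 5 (- 1/32), circ 5 (- 1/36)] s"
definition Ce1 :: "sign \<Rightarrow> disc" where
  "Ce1 s = rdisc (Complex (5308412/1329425) (313616/1329425)) (256/1329425) [circ 4 (1/32), circ 4 (1/36)] s"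
definition Ce2 :: "sign \<Rightarrow> disc" where
  "Ce2 s = rdisc (Complex (5308412/1329425) (- 313616/1329425)) (256/1329425) [circ 4 (- 1/36), circ 4 (- 1/32)] s"
definition CF1 :: "sign \<Rightarrow> disc" where
  "CF1 s = rdisc (Complex (6363/1430) (808/715)) (521/484) [circ 5 (2/81), circ 4 (2/81), circ 4 (18/79), circ 5 (18/79)] s"
definition CF2 :: "sign \<Rightarrow> disc" where
  "CF2 s = rdisc (Complex (6363/1430) (- 808/715)) (521/484) [circ 5 (- 18/79), circ 4 (- 18/79), circ 4 (- 2/81), circ 5 (- 2/81)] s"
definition CH :: "sign \<Rightarrow> disc" where
  "CH s = rdisc (Complex (51/10) (0)) (601/100) [circ 5 (- 1/4), circ 4 (- 1/4), circ 4 (1/4), circ 5 (1/4)] s"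
definition CG :: "sign \<Rightarrow> disc" where
  "CG s = rdisc (Complex (0) (45/2)) (2665/4) [circ 5 (- 1/3), circ 4 (- 1/2), circ 4 (- 2), circ 5 (- 3)] s"

lemmas discC_defs = C1_def Cu_def Cz_def Cd1_def Cd2_def Ce1_def Ce2_def CF1_def CF2_def CH_def CG_def dO_def dE_def dW_def

lemma C1_5: "cocuts (C1 s) (circ 5) (of_real (- 5)) (- 1) (1)"
  and Cu_5: "cocuts (Cu s) (circ 5) (of_real (- 5)) (- 7) (7)"
  and Cu_4: "cocuts (Cu s) (circ 4) (of_real (- 4)) (- 3) (3)"
  and CG_5: "cocuts (CG s) (circ 5) (of_real (- 5)) (- 3) (- 1/3)"
  and CG_4: "cocuts (CG s) (circ 4) (of_real (- 4)) (- 2) (- 1/2)"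
  unfolding discC_defs by (rule cocuts_rdisc; simp add: power2_eq_square)+

lemma Cz_4: "cuts (Cz s) (circ 4) (of_real (- 4)) (- 1/24) (1/24)"
  and Cd1_5: "cuts (Cd1 s) (circ 5) (of_real (- 5)) (1/36) (1/32)"
  and Cd2_5: "cuts (Cd2 s) (circ 5) (of_real (- 5)) (- 1/32) (- 1/36)"
  and Ce1_4: "cuts (Ce1 s) (circ 4) (of_real (- 4)) (1/36) (1/32)"
  and Ce2_4: "cuts (Ce2 s) (circ 4) (of_real (- 4)) (- 1/32) (- 1/36)"
  and CF1_5: "cuts (CF1 s) (circ 5) (of_real (- 5)) (2/81) (18/79)"
  and CF1_4: "cuts (CF1 s) (circ 4) (of_real (- 4)) (2/81) (18/79)"
  and CF2_5: "cuts (CF2 s) (circ 5) (of_real (- 5)) (- 18/79) (- 2/81)"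
  and CF2_4: "cuts (CF2 s) (circ 4) (of_real (- 4)) (- 18/79) (- 2/81)"
  and CH_5: "cuts (CH s) (circ 5) (of_real (- 5)) (- 1/4) (1/4)"
  and CH_4: "cuts (CH s) (circ 4) (of_real (- 4)) (- 1/4) (1/4)"
  unfolding discC_defs by (rule cuts_rdisc; simp add: power2_eq_square)+

lemma C1_4: "swallows (C1 s) (circ 4) (of_real (- 4))"
  and dO_4: "swallows (dO s) (circ 4) (of_real (- 4))"
  unfolding discC_defs by (rule swallows_rdisc; simp add: power2_eq_square)+

lemma Cd1_4: "misses (Cd1 s) (circ 4) (of_real (- 4))"
  and Cd2_4: "misses (Cd2 s) (circ 4) (of_real (- 4))"
  and dW_4: "misses (dW s) (circ 4) (of_real (- 4))"
  unfolding discC_defs by (rule misses_rdisc; simp add: power2_eq_square)+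

lemma Cz_5: "misses (Cz s) (circ 5) (of_real (- 5))"
  and Ce1_5: "misses (Ce1 s) (circ 5) (of_real (- 5))"
  and Ce2_5: "misses (Ce2 s) (circ 5) (of_real (- 5))"
  unfolding discC_defs by (rule misses_rdisc_inside; simp add: power2_eq_square)+

lemma C1_in_dE: "region (C1 s) \<subseteq> interior (region (dE s))"
  and CF1_in_CH: "region (CF1 s) \<subseteq> interior (region (CH s))"
  and CF1_in_dO: "region (CF1 s) \<subseteq> interior (region (dO s))"
  and CF2_in_CH: "region (CF2 s) \<subseteq> interior (region (CH s))"
  and CF2_in_dO: "region (CF2 s) \<subseteq> interior (region (dO s))"
  and CG_in_dO: "region (CG s) \<subseteq> interior (region (dO s))"
  and CH_in_CG: "region (CH s) \<subseteq> interior (region (CG s))"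
  and CH_in_dO: "region (CH s) \<subseteq> interior (region (dO s))"
  and Cd1_in_CF1: "region (Cd1 s) \<subseteq> interior (region (CF1 s))"
  and Cd1_in_dO: "region (Cd1 s) \<subseteq> interior (region (dO s))"
  and Cd1_in_dW: "region (Cd1 s) \<subseteq> interior (region (dW s))"
  and Cd2_in_CF2: "region (Cd2 s) \<subseteq> interior (region (CF2 s))"
  and Cd2_in_dW: "region (Cd2 s) \<subseteq> interior (region (dW s))"
  and Ce1_in_CF1: "region (Ce1 s) \<subseteq> interior (region (CF1 s))"
  and Ce1_in_Cz: "region (Ce1 s) \<subseteq> interior (region (Cz s))"
  and Ce1_in_dO: "region (Ce1 s) \<subseteq> interior (region (dO s))"
  and Ce2_in_CF2: "region (Ce2 s) \<subseteq> interior (region (CF2 s))"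
  and Ce2_in_Cz: "region (Ce2 s) \<subseteq> interior (region (Cz s))"
  and Ce2_in_dO: "region (Ce2 s) \<subseteq> interior (region (dO s))"
  and Cu_in_C1: "region (Cu s) \<subseteq> interior (region (C1 s))"
  and Cu_in_CG: "region (Cu s) \<subseteq> interior (region (CG s))"
  and Cu_in_dO: "region (Cu s) \<subseteq> interior (region (dO s))"
  and Cz_in_C1: "region (Cz s) \<subseteq> interior (region (C1 s))"
  and Cz_in_dO: "region (Cz s) \<subseteq> interior (region (dO s))"
  unfolding discC_defs by (rule rdisc_in; simp add: power2_eq_square)+

lemma C1_off_dW: "region (C1 s) \<inter> region (dW s) = {}"
  and CF1_off_CF2: "region (CF1 s) \<inter> region (CF2 s) = {}"
  and CF2_off_Cd1: "region (CF2 s) \<inter> region (Cd1 s) = {}"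
  and CF2_off_Ce1: "region (CF2 s) \<inter> region (Ce1 s) = {}"
  and Cd1_off_Cd2: "region (Cd1 s) \<inter> region (Cd2 s) = {}"
  and Cd1_off_Ce1: "region (Cd1 s) \<inter> region (Ce1 s) = {}"
  and Cd2_off_Ce2: "region (Cd2 s) \<inter> region (Ce2 s) = {}"
  and Ce1_off_Ce2: "region (Ce1 s) \<inter> region (Ce2 s) = {}"
  and Ce1_off_dW: "region (Ce1 s) \<inter> region (dW s) = {}"
  and Ce2_off_Ce1: "region (Ce2 s) \<inter> region (Ce1 s) = {}"
  and Ce2_off_dW: "region (Ce2 s) \<inter> region (dW s) = {}"
  and Cu_off_CF1: "region (Cu s) \<inter> region (CF1 s) = {}"
  and Cu_off_CF2: "region (Cu s) \<inter> region (CF2 s) = {}"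
  and Cu_off_CH: "region (Cu s) \<inter> region (CH s) = {}"
  and Cu_off_Cd1: "region (Cu s) \<inter> region (Cd1 s) = {}"
  and Cu_off_Ce1: "region (Cu s) \<inter> region (Ce1 s) = {}"
  and Cu_off_Ce2: "region (Cu s) \<inter> region (Ce2 s) = {}"
  and Cu_off_Cz: "region (Cu s) \<inter> region (Cz s) = {}"
  and Cu_off_dW: "region (Cu s) \<inter> region (dW s) = {}"
  and Cz_off_dW: "region (Cz s) \<inter> region (dW s) = {}"
  unfolding discC_defs by (rule rdisc_off; simp add: power2_eq_square)+

lemma adapted_C_dO: "adapted (gC s) (dO s)"
proof (rule adapted_O)
  show "gC s p \<noteq> 0" if "p \<in> frontier (region (dO s))" for p
  proof
    assume "gC s p = 0"
    then have "p \<in> interior (region (dO s))"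
      using swallows_O[of s] dO_4[of s] unfolding gC_zero swallows_def
      by (auto simp: curveC_def split: if_splits)
    then show False using that by (simp add: frontier_def)
  qed
qed (simp add: gC_def power2_eq_square)

lemma adapted_C_C1: "adapted (gC s) (C1 s)"
  unfolding C1_def
  by (rule adapted_C[OF crossing_cocuts[OF _ _ C1_5[unfolded C1_def]] crossing_swallows[OF _ C1_4[unfolded C1_def]], where q = "Complex (- 6) (1)"])
     (auto simp: gC_def mem_sqrt power2_eq_square orient_def circ_def simp del: mem_sphere)
lemma adapted_C_Cu: "adapted (gC s) (Cu s)"
  unfolding Cu_def
  by (rule adapted_C[OF crossing_cocuts[OF _ _ Cu_5[unfolded Cu_def]] crossing_cocuts[OF _ _ Cu_4[unfolded Cu_def]], where q = "Complex (- 2097/400) (- 29/400)"])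
     (auto simp: gC_def mem_sqrt power2_eq_square orient_def circ_def simp del: mem_sphere)
lemma adapted_C_Cz: "adapted (gC s) (Cz s)"
  unfolding Cz_def
  by (rule adapted_C[OF crossing_misses[OF _ Cz_5[unfolded Cz_def]] crossing_cuts[OF _ _ Cz_4[unfolded Cz_def]], where q = "Complex (1162/577) (192/577)"])
     (auto simp: gC_def mem_sqrt power2_eq_square orient_def circ_def simp del: mem_sphere)
lemma adapted_C_Cd1: "adapted (gC s) (Cd1 s)"
  unfolding Cd1_def
  by (rule adapted_C[OF crossing_cuts[OF _ _ Cd1_5[unfolded Cd1_def]] crossing_misses[OF _ Cd1_4[unfolded Cd1_def]], where q = "Complex (1331707/265885) (78676/265885)"])
     (auto simp: gC_def mem_sqrt power2_eq_square orient_def circ_def simp del: mem_sphere)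
lemma adapted_C_Cd2: "adapted (gC s) (Cd2 s)"
  unfolding Cd2_def
  by (rule adapted_C[OF crossing_cuts[OF _ _ Cd2_5[unfolded Cd2_def]] crossing_misses[OF _ Cd2_4[unfolded Cd2_def]], where q = "Complex (1331707/265885) (- 78676/265885)"])
     (auto simp: gC_def mem_sqrt power2_eq_square orient_def circ_def simp del: mem_sphere)
lemma adapted_C_Ce1: "adapted (gC s) (Ce1 s)"
  unfolding Ce1_def
  by (rule adapted_C[OF crossing_misses[OF _ Ce1_5[unfolded Ce1_def]] crossing_cuts[OF _ _ Ce1_4[unfolded Ce1_def]], where q = "Complex (5289996/1329425) (312528/1329425)"])
     (auto simp: gC_def mem_sqrt power2_eq_square orient_def circ_def simp del: mem_sphere)
lemma adapted_C_Ce2: "adapted (gC s) (Ce2 s)"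
  unfolding Ce2_def
  by (rule adapted_C[OF crossing_misses[OF _ Ce2_5[unfolded Ce2_def]] crossing_cuts[OF _ _ Ce2_4[unfolded Ce2_def]], where q = "Complex (5289996/1329425) (- 312528/1329425)"])
     (auto simp: gC_def mem_sqrt power2_eq_square orient_def circ_def simp del: mem_sphere)
lemma adapted_C_CF1: "adapted (gC s) (CF1 s)"
  unfolding CF1_def
  by (rule adapted_C[OF crossing_cuts[OF _ _ CF1_5[unfolded CF1_def]] crossing_cuts[OF _ _ CF1_4[unfolded CF1_def]], where q = "Complex (78860/14443) (98616/72215)"])
     (auto simp: gC_def mem_sqrt power2_eq_square orient_def circ_def simp del: mem_sphere)
lemma adapted_C_CF2: "adapted (gC s) (CF2 s)"
  unfolding CF2_def
  by (rule adapted_C[OF crossing_cuts[OF _ _ CF2_5[unfolded CF2_def]] crossing_cuts[OF _ _ CF2_4[unfolded CF2_def]], where q = "Complex (78860/14443) (- 98616/72215)"])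
     (auto simp: gC_def mem_sqrt power2_eq_square orient_def circ_def simp del: mem_sphere)
lemma adapted_C_CH: "adapted (gC s) (CH s)"
  unfolding CH_def
  by (rule adapted_C[OF crossing_cuts[OF _ _ CH_5[unfolded CH_def]] crossing_cuts[OF _ _ CH_4[unfolded CH_def]], where q = "Complex (16047/2125) (4/2125)"])
     (auto simp: gC_def mem_sqrt power2_eq_square orient_def circ_def simp del: mem_sphere)
lemma adapted_C_CG: "adapted (gC s) (CG s)"
  unfolding CG_def
  by (rule adapted_C[OF crossing_cocuts[OF _ _ CG_5[unfolded CG_def]] crossing_cocuts[OF _ _ CG_4[unfolded CG_def]], where q = "Complex (- 4) (48)"])
     (auto simp: gC_def mem_sqrt power2_eq_square orient_def circ_def simp del: mem_sphere)
lemma adapted_C_dW: "adapted (gC s) (dW s)"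
  unfolding dW_def
  by (rule adapted_C[OF crossing_cuts[OF _ _ cuts_W[unfolded dW_def]] crossing_misses[OF _ dW_4[unfolded dW_def]], where q = "Complex (2777/505) (100/101)"])
     (auto simp: gC_def mem_sqrt power2_eq_square orient_def circ_def simp del: mem_sphere)

text \<open>
  Here \<open>False\<close> stands for the outer and \<open>True\<close> for the inner circle.
\<close>

lemma C_convr_drawing:
  "drawing (gC s) curveC (C1 s) {Cu s, Cz s}
     {(False, - 7, - 1), (False, 1, 7), (True, - 3, - 1/24), (True, 1/24, 3)}" (is "drawing _ _ ?D ?I ?S")
proof (rule drawingI[OF _ _ _ _ _ gC_zero])
  note mem = cocutsD[OF C1_5] swallowsD[OF C1_4] cocutsD[OF Cu_5] cocutsD[OF Cu_4] missesD[OF Cz_5] cutsD[OF Cz_4]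
  show "nested ?D ?I"
    using Cu_in_C1[of s] Cz_in_C1[of s] Cu_off_Cz[of s]
    by (intro nested_insert nested_1) (auto simp: Int_commute)
  show "p \<notin> btw ?D ?I" if "p \<in> {of_real (- 5), of_real (- 4)}" for p
    using that by (elim insertE emptyE) (simp_all only: btw_insert btw_empty mem simp_thms)
  show "curveC j t \<in> btw ?D ?I
      \<longleftrightarrow> (\<exists>(j', u, v)\<in>?S. j' = j \<and> u \<le> t \<and> t \<le> v)" for j t
    by (cases j) (simp_all only: btw_insert btw_empty curveC_simps mem, auto)
  show "(\<Union>d\<in>insert ?D ?I. set (marks d))
      = (\<Union>(j, u, v)\<in>?S. {curveC j u, curveC j v})"
    by (auto simp: C1_def Cu_def Cz_def)
qed (auto simp: adapted_C_C1 adapted_C_Cu adapted_C_Cz)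

lemma C_uzw_drawing:
  "drawing (gC s) curveC (dO s) {Cu s, Cz s, dW s}
     {(False, - 7, - 1/10), (False, 1/10, 7), (True, - 3, - 1/24), (True, 1/24, 3)}" (is "drawing _ _ ?D ?I ?S")
proof (rule drawingI[OF _ _ _ _ _ gC_zero])
  note mem = swallowsD[OF swallows_O] swallowsD[OF dO_4] cocutsD[OF Cu_5] cocutsD[OF Cu_4] missesD[OF Cz_5] cutsD[OF Cz_4] cutsD[OF cuts_W] missesD[OF dW_4]
  show "nested ?D ?I"
    using Cu_in_dO[of s] Cz_in_dO[of s] dW_in_dO[of s] Cu_off_Cz[of s] Cu_off_dW[of s] Cz_off_dW[of s]
    by (intro nested_insert nested_1) (auto simp: Int_commute)
  show "p \<notin> btw ?D ?I" if "p \<in> {of_real (- 5), of_real (- 4)}" for p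
    using that by (elim insertE emptyE) (simp_all only: btw_insert btw_empty mem simp_thms)
  show "curveC j t \<in> btw ?D ?I
      \<longleftrightarrow> (\<exists>(j', u, v)\<in>?S. j' = j \<and> u \<le> t \<and> t \<le> v)" for j t
    by (cases j) (simp_all only: btw_insert btw_empty curveC_simps mem, auto)
  show "(\<Union>d\<in>insert ?D ?I. set (marks d))
      = (\<Union>(j, u, v)\<in>?S. {curveC j u, curveC j v})"
    by (auto simp: dO_def Cu_def Cz_def dW_def)
qed (auto simp: adapted_C_dO adapted_C_Cu adapted_C_Cz adapted_C_dW)

lemma C_stack_e_drawing:
  "drawing (gC s) curveC (Cz s) {Ce2 s, Ce1 s}
     {(True, - 1/24, - 1/32), (True, - 1/36, 1/36), (True, 1/32, 1/24)}" (is "drawing _ _ ?D ?I ?S")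
proof (rule drawingI[OF _ _ _ _ _ gC_zero])
  note mem = missesD[OF Cz_5] cutsD[OF Cz_4] missesD[OF Ce2_5] cutsD[OF Ce2_4] missesD[OF Ce1_5] cutsD[OF Ce1_4]
  show "nested ?D ?I"
    using Ce2_in_Cz[of s] Ce1_in_Cz[of s] Ce2_off_Ce1[of s]
    by (intro nested_insert nested_1) (auto simp: Int_commute)
  show "p \<notin> btw ?D ?I" if "p \<in> {of_real (- 5), of_real (- 4)}" for p
    using that by (elim insertE emptyE) (simp_all only: btw_insert btw_empty mem simp_thms)
  show "curveC j t \<in> btw ?D ?I
      \<longleftrightarrow> (\<exists>(j', u, v)\<in>?S. j' = j \<and> u \<le> t \<and> t \<le> v)" for j t
    by (cases j) (simp_all only: btw_insert btw_empty curveC_simps mem, auto)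
  show "(\<Union>d\<in>insert ?D ?I. set (marks d))
      = (\<Union>(j, u, v)\<in>?S. {curveC j u, curveC j v})"
    by (auto simp: Cz_def Ce2_def Ce1_def)
qed (auto simp: adapted_C_Cz adapted_C_Ce2 adapted_C_Ce1)

lemma C_uew_drawing:
  "drawing (gC s) curveC (dO s) {Cu s, Ce1 s, Ce2 s, dW s}
     {(False, - 7, - 1/10), (False, 1/10, 7), (True, - 3, - 1/32), (True, - 1/36, 1/36), (True, 1/32, 3)}" (is "drawing _ _ ?D ?I ?S")
proof (rule drawingI[OF _ _ _ _ _ gC_zero])
  note mem = swallowsD[OF swallows_O] swallowsD[OF dO_4] cocutsD[OF Cu_5] cocutsD[OF Cu_4] missesD[OF Ce1_5] cutsD[OF Ce1_4] missesD[OF Ce2_5] cutsD[OF Ce2_4] cutsD[OF cuts_W] missesD[OF dW_4]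
  show "nested ?D ?I"
    using Cu_in_dO[of s] Ce1_in_dO[of s] Ce2_in_dO[of s] dW_in_dO[of s] Cu_off_Ce1[of s] Cu_off_Ce2[of s] Cu_off_dW[of s] Ce1_off_Ce2[of s] Ce1_off_dW[of s] Ce2_off_dW[of s]
    by (intro nested_insert nested_1) (auto simp: Int_commute)
  show "p \<notin> btw ?D ?I" if "p \<in> {of_real (- 5), of_real (- 4)}" for p
    using that by (elim insertE emptyE) (simp_all only: btw_insert btw_empty mem simp_thms)
  show "curveC j t \<in> btw ?D ?I
      \<longleftrightarrow> (\<exists>(j', u, v)\<in>?S. j' = j \<and> u \<le> t \<and> t \<le> v)" for j t
    by (cases j) (simp_all only: btw_insert btw_empty curveC_simps mem, auto)
  show "(\<Union>d\<in>insert ?D ?I. set (marks d))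
      = (\<Union>(j, u, v)\<in>?S. {curveC j u, curveC j v})"
    by (auto simp: dO_def Cu_def Ce1_def Ce2_def dW_def)
qed (auto simp: adapted_C_dO adapted_C_Cu adapted_C_Ce1 adapted_C_Ce2 adapted_C_dW)

lemma C_stack_d_drawing:
  "drawing (gC s) curveC (dW s) {Cd1 s, Cd2 s}
     {(False, - 1/10, - 1/32), (False, - 1/36, 1/36), (False, 1/32, 1/10)}" (is "drawing _ _ ?D ?I ?S")
proof (rule drawingI[OF _ _ _ _ _ gC_zero])
  note mem = cutsD[OF cuts_W] missesD[OF dW_4] cutsD[OF Cd1_5] missesD[OF Cd1_4] cutsD[OF Cd2_5] missesD[OF Cd2_4]
  show "nested ?D ?I"
    using Cd1_in_dW[of s] Cd2_in_dW[of s] Cd1_off_Cd2[of s]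
    by (intro nested_insert nested_1) (auto simp: Int_commute)
  show "p \<notin> btw ?D ?I" if "p \<in> {of_real (- 5), of_real (- 4)}" for p
    using that by (elim insertE emptyE) (simp_all only: btw_insert btw_empty mem simp_thms)
  show "curveC j t \<in> btw ?D ?I
      \<longleftrightarrow> (\<exists>(j', u, v)\<in>?S. j' = j \<and> u \<le> t \<and> t \<le> v)" for j t
    by (cases j) (simp_all only: btw_insert btw_empty curveC_simps mem, auto)
  show "(\<Union>d\<in>insert ?D ?I. set (marks d))
      = (\<Union>(j, u, v)\<in>?S. {curveC j u, curveC j v})"
    by (auto simp: dW_def Cd1_def Cd2_def)
qed (auto simp: adapted_C_dW adapted_C_Cd1 adapted_C_Cd2)

lemma C_closing_drawing:
  "drawing (gC s) curveC (dO s) {CG s}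
     {(False, - 3, - 1/3), (True, - 2, - 1/2)}" (is "drawing _ _ ?D ?I ?S")
proof (rule drawingI[OF _ _ _ _ _ gC_zero])
  note mem = swallowsD[OF swallows_O] swallowsD[OF dO_4] cocutsD[OF CG_5] cocutsD[OF CG_4]
  show "nested ?D ?I"
    using CG_in_dO[of s]
    by (intro nested_insert nested_1) (auto simp: Int_commute)
  show "p \<notin> btw ?D ?I" if "p \<in> {of_real (- 5), of_real (- 4)}" for p
    using that by (elim insertE emptyE) (simp_all only: btw_insert btw_empty mem simp_thms)
  show "curveC j t \<in> btw ?D ?I
      \<longleftrightarrow> (\<exists>(j', u, v)\<in>?S. j' = j \<and> u \<le> t \<and> t \<le> v)" for j t
    by (cases j) (simp_all only: btw_insert btw_empty curveC_simps mem, auto)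
  show "(\<Union>d\<in>insert ?D ?I. set (marks d))
      = (\<Union>(j, u, v)\<in>?S. {curveC j u, curveC j v})"
    by (auto simp: dO_def CG_def)
qed (auto simp: adapted_C_dO adapted_C_CG)

lemma C_stack_G_drawing:
  "drawing (gC s) curveC (CG s) {Cu s, CH s}
     {(False, - 7, - 3), (False, - 1/3, - 1/4), (False, 1/4, 7), (True, - 3, - 2), (True, - 1/2, - 1/4), (True, 1/4, 3)}" (is "drawing _ _ ?D ?I ?S")
proof (rule drawingI[OF _ _ _ _ _ gC_zero])
  note mem = cocutsD[OF CG_5] cocutsD[OF CG_4] cocutsD[OF Cu_5] cocutsD[OF Cu_4] cutsD[OF CH_5] cutsD[OF CH_4]
  show "nested ?D ?I"
    using Cu_in_CG[of s] CH_in_CG[of s] Cu_off_CH[of s]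
    by (intro nested_insert nested_1) (auto simp: Int_commute)
  show "p \<notin> btw ?D ?I" if "p \<in> {of_real (- 5), of_real (- 4)}" for p
    using that by (elim insertE emptyE) (simp_all only: btw_insert btw_empty mem simp_thms)
  show "curveC j t \<in> btw ?D ?I
      \<longleftrightarrow> (\<exists>(j', u, v)\<in>?S. j' = j \<and> u \<le> t \<and> t \<le> v)" for j t
    by (cases j) (simp_all only: btw_insert btw_empty curveC_simps mem, auto)
  show "(\<Union>d\<in>insert ?D ?I. set (marks d))
      = (\<Union>(j, u, v)\<in>?S. {curveC j u, curveC j v})"
    by (auto simp: CG_def Cu_def CH_def)
qed (auto simp: adapted_C_CG adapted_C_Cu adapted_C_CH)

lemma C_uH_drawing:
  "drawing (gC s) curveC (dO s) {Cu s, CH s}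
     {(False, - 7, - 1/4), (False, 1/4, 7), (True, - 3, - 1/4), (True, 1/4, 3)}" (is "drawing _ _ ?D ?I ?S")
proof (rule drawingI[OF _ _ _ _ _ gC_zero])
  note mem = swallowsD[OF swallows_O] swallowsD[OF dO_4] cocutsD[OF Cu_5] cocutsD[OF Cu_4] cutsD[OF CH_5] cutsD[OF CH_4]
  show "nested ?D ?I"
    using Cu_in_dO[of s] CH_in_dO[of s] Cu_off_CH[of s]
    by (intro nested_insert nested_1) (auto simp: Int_commute)
  show "p \<notin> btw ?D ?I" if "p \<in> {of_real (- 5), of_real (- 4)}" for p
    using that by (elim insertE emptyE) (simp_all only: btw_insert btw_empty mem simp_thms)
  show "curveC j t \<in> btw ?D ?I
      \<longleftrightarrow> (\<exists>(j', u, v)\<in>?S. j' = j \<and> u \<le> t \<and> t \<le> v)" for j t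
    by (cases j) (simp_all only: btw_insert btw_empty curveC_simps mem, auto)
  show "(\<Union>d\<in>insert ?D ?I. set (marks d))
      = (\<Union>(j, u, v)\<in>?S. {curveC j u, curveC j v})"
    by (auto simp: dO_def Cu_def CH_def)
qed (auto simp: adapted_C_dO adapted_C_Cu adapted_C_CH)

lemma C_stack_H_drawing:
  "drawing (gC s) curveC (CH s) {CF1 s, CF2 s}
     {(False, - 1/4, - 18/79), (False, - 2/81, 2/81), (False, 18/79, 1/4), (True, - 1/4, - 18/79), (True, - 2/81, 2/81), (True, 18/79, 1/4)}" (is "drawing _ _ ?D ?I ?S")
proof (rule drawingI[OF _ _ _ _ _ gC_zero])
  note mem = cutsD[OF CH_5] cutsD[OF CH_4] cutsD[OF CF1_5] cutsD[OF CF1_4] cutsD[OF CF2_5] cutsD[OF CF2_4]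
  show "nested ?D ?I"
    using CF1_in_CH[of s] CF2_in_CH[of s] CF1_off_CF2[of s]
    by (intro nested_insert nested_1) (auto simp: Int_commute)
  show "p \<notin> btw ?D ?I" if "p \<in> {of_real (- 5), of_real (- 4)}" for p
    using that by (elim insertE emptyE) (simp_all only: btw_insert btw_empty mem simp_thms)
  show "curveC j t \<in> btw ?D ?I
      \<longleftrightarrow> (\<exists>(j', u, v)\<in>?S. j' = j \<and> u \<le> t \<and> t \<le> v)" for j t
    by (cases j) (simp_all only: btw_insert btw_empty curveC_simps mem, auto)
  show "(\<Union>d\<in>insert ?D ?I. set (marks d))
      = (\<Union>(j, u, v)\<in>?S. {curveC j u, curveC j v})"
    by (auto simp: CH_def CF1_def CF2_def)
qed (auto simp: adapted_C_CH adapted_C_CF1 adapted_C_CF2)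

lemma C_uFF_drawing:
  "drawing (gC s) curveC (dO s) {Cu s, CF1 s, CF2 s}
     {(False, - 7, - 18/79), (False, - 2/81, 2/81), (False, 18/79, 7), (True, - 3, - 18/79), (True, - 2/81, 2/81), (True, 18/79, 3)}" (is "drawing _ _ ?D ?I ?S")
proof (rule drawingI[OF _ _ _ _ _ gC_zero])
  note mem = swallowsD[OF swallows_O] swallowsD[OF dO_4] cocutsD[OF Cu_5] cocutsD[OF Cu_4] cutsD[OF CF1_5] cutsD[OF CF1_4] cutsD[OF CF2_5] cutsD[OF CF2_4]
  show "nested ?D ?I"
    using Cu_in_dO[of s] CF1_in_dO[of s] CF2_in_dO[of s] Cu_off_CF1[of s] Cu_off_CF2[of s] CF1_off_CF2[of s]
    by (intro nested_insert nested_1) (auto simp: Int_commute)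
  show "p \<notin> btw ?D ?I" if "p \<in> {of_real (- 5), of_real (- 4)}" for p
    using that by (elim insertE emptyE) (simp_all only: btw_insert btw_empty mem simp_thms)
  show "curveC j t \<in> btw ?D ?I
      \<longleftrightarrow> (\<exists>(j', u, v)\<in>?S. j' = j \<and> u \<le> t \<and> t \<le> v)" for j t
    by (cases j) (simp_all only: btw_insert btw_empty curveC_simps mem, auto)
  show "(\<Union>d\<in>insert ?D ?I. set (marks d))
      = (\<Union>(j, u, v)\<in>?S. {curveC j u, curveC j v})"
    by (auto simp: dO_def Cu_def CF1_def CF2_def)
qed (auto simp: adapted_C_dO adapted_C_Cu adapted_C_CF1 adapted_C_CF2)

lemma C_F1_drawing:
  "drawing (gC s) curveC (CF1 s) {Cd1 s, Ce1 s}
     {(False, 2/81, 1/36), (False, 1/32, 18/79), (True, 2/81, 1/36), (True, 1/32, 18/79)}" (is "drawing _ _ ?D ?I ?S")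
proof (rule drawingI[OF _ _ _ _ _ gC_zero])
  note mem = cutsD[OF CF1_5] cutsD[OF CF1_4] cutsD[OF Cd1_5] missesD[OF Cd1_4] missesD[OF Ce1_5] cutsD[OF Ce1_4]
  show "nested ?D ?I"
    using Cd1_in_CF1[of s] Ce1_in_CF1[of s] Cd1_off_Ce1[of s]
    by (intro nested_insert nested_1) (auto simp: Int_commute)
  show "p \<notin> btw ?D ?I" if "p \<in> {of_real (- 5), of_real (- 4)}" for p
    using that by (elim insertE emptyE) (simp_all only: btw_insert btw_empty mem simp_thms)
  show "curveC j t \<in> btw ?D ?I
      \<longleftrightarrow> (\<exists>(j', u, v)\<in>?S. j' = j \<and> u \<le> t \<and> t \<le> v)" for j t
    by (cases j) (simp_all only: btw_insert btw_empty curveC_simps mem, auto)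
  show "(\<Union>d\<in>insert ?D ?I. set (marks d))
      = (\<Union>(j, u, v)\<in>?S. {curveC j u, curveC j v})"
    by (auto simp: CF1_def Cd1_def Ce1_def)
qed (auto simp: adapted_C_CF1 adapted_C_Cd1 adapted_C_Ce1)

lemma C_uFde_drawing:
  "drawing (gC s) curveC (dO s) {Cu s, CF2 s, Cd1 s, Ce1 s}
     {(False, - 7, - 18/79), (False, - 2/81, 1/36), (False, 1/32, 7), (True, - 3, - 18/79), (True, - 2/81, 1/36), (True, 1/32, 3)}" (is "drawing _ _ ?D ?I ?S")
proof (rule drawingI[OF _ _ _ _ _ gC_zero])
  note mem = swallowsD[OF swallows_O] swallowsD[OF dO_4] cocutsD[OF Cu_5] cocutsD[OF Cu_4] cutsD[OF CF2_5] cutsD[OF CF2_4] cutsD[OF Cd1_5] missesD[OF Cd1_4] missesD[OF Ce1_5] cutsD[OF Ce1_4]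
  show "nested ?D ?I"
    using Cu_in_dO[of s] CF2_in_dO[of s] Cd1_in_dO[of s] Ce1_in_dO[of s] Cu_off_CF2[of s] Cu_off_Cd1[of s] Cu_off_Ce1[of s] CF2_off_Cd1[of s] CF2_off_Ce1[of s] Cd1_off_Ce1[of s]
    by (intro nested_insert nested_1) (auto simp: Int_commute)
  show "p \<notin> btw ?D ?I" if "p \<in> {of_real (- 5), of_real (- 4)}" for p
    using that by (elim insertE emptyE) (simp_all only: btw_insert btw_empty mem simp_thms)
  show "curveC j t \<in> btw ?D ?I
      \<longleftrightarrow> (\<exists>(j', u, v)\<in>?S. j' = j \<and> u \<le> t \<and> t \<le> v)" for j t
    by (cases j) (simp_all only: btw_insert btw_empty curveC_simps mem, auto)
  show "(\<Union>d\<in>insert ?D ?I. set (marks d))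
      = (\<Union>(j, u, v)\<in>?S. {curveC j u, curveC j v})"
    by (auto simp: dO_def Cu_def CF2_def Cd1_def Ce1_def)
qed (auto simp: adapted_C_dO adapted_C_Cu adapted_C_CF2 adapted_C_Cd1 adapted_C_Ce1)

lemma C_F2_drawing:
  "drawing (gC s) curveC (CF2 s) {Cd2 s, Ce2 s}
     {(False, - 18/79, - 1/32), (False, - 1/36, - 2/81), (True, - 18/79, - 1/32), (True, - 1/36, - 2/81)}" (is "drawing _ _ ?D ?I ?S")
proof (rule drawingI[OF _ _ _ _ _ gC_zero])
  note mem = cutsD[OF CF2_5] cutsD[OF CF2_4] cutsD[OF Cd2_5] missesD[OF Cd2_4] missesD[OF Ce2_5] cutsD[OF Ce2_4]
  show "nested ?D ?I"
    using Cd2_in_CF2[of s] Ce2_in_CF2[of s] Cd2_off_Ce2[of s]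
    by (intro nested_insert nested_1) (auto simp: Int_commute)
  show "p \<notin> btw ?D ?I" if "p \<in> {of_real (- 5), of_real (- 4)}" for p
    using that by (elim insertE emptyE) (simp_all only: btw_insert btw_empty mem simp_thms)
  show "curveC j t \<in> btw ?D ?I
      \<longleftrightarrow> (\<exists>(j', u, v)\<in>?S. j' = j \<and> u \<le> t \<and> t \<le> v)" for j t
    by (cases j) (simp_all only: btw_insert btw_empty curveC_simps mem, auto)
  show "(\<Union>d\<in>insert ?D ?I. set (marks d))
      = (\<Union>(j, u, v)\<in>?S. {curveC j u, curveC j v})"
    by (auto simp: CF2_def Cd2_def Ce2_def)
qed (auto simp: adapted_C_CF2 adapted_C_Cd2 adapted_C_Ce2)

lemma rdisc_eq:
  "0 < N \<Longrightarrow> 0 < N' \<Longrightarrow> rdisc z N ms s = rdisc z' N' ms' s' \<longleftrightarrow> z = z' \<and> N = N' \<and> ms = ms' \<and> s = s'"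
  by (auto simp: rdisc_def cball_eq_cball_iff)

lemma C_distinct:
  "distinct [C1 s, Cu s, Cz s, Cd1 s, Cd2 s, Ce1 s, Ce2 s, CF1 s, CF2 s, CH s, CG s, dW s]"
  by (simp add: discC_defs rdisc_eq)

lemma C_distinct': "distinct [dW s, CG s, CH s, CF2 s, CF1 s, Ce2 s, Ce1 s, Cd2 s, Cd1 s, Cz s, Cu s, C1 s]"
  using C_distinct[of s] distinct_rev[of "[C1 s, Cu s, Cz s, Cd1 s, Cd2 s, Ce1 s, Ce2 s, CF1 s, CF2 s, CH s, CG s, dW s]"]
  by (simp only: rev.simps append.simps)

lemmas C_neq [simp] = C_distinct[simplified distinct.simps list.set insert_iff empty_iff de_Morgan_disj not_False_eq_True simp_thms]
  C_distinct'[simplified distinct.simps list.set insert_iff empty_iff de_Morgan_disj not_False_eq_True simp_thms]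

lemma C_marks [simp]:
  "marks (C1 s) = [circ 5 1, circ 5 (- 1)]" "marks (Cu s) = [circ 5 7, circ 4 3, circ 4 (- 3), circ 5 (- 7)]"
  "marks (Cz s) = [circ 4 (1/24), circ 4 (- 1/24)]"
  "marks (Cd1 s) = [circ 5 (1/36), circ 5 (1/32)]" "marks (Cd2 s) = [circ 5 (- 1/32), circ 5 (- 1/36)]"
  "marks (Ce1 s) = [circ 4 (1/32), circ 4 (1/36)]" "marks (Ce2 s) = [circ 4 (- 1/36), circ 4 (- 1/32)]"
  "marks (CF1 s) = [circ 5 (2/81), circ 4 (2/81), circ 4 (18/79), circ 5 (18/79)]"
  "marks (CF2 s) = [circ 5 (- 18/79), circ 4 (- 18/79), circ 4 (- 2/81), circ 5 (- 2/81)]"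
  "marks (CH s) = [circ 5 (- 1/4), circ 4 (- 1/4), circ 4 (1/4), circ 5 (1/4)]"
  "marks (CG s) = [circ 5 (- 1/3), circ 4 (- 1/2), circ 4 (- 2), circ 5 (- 3)]"
  by (simp_all add: discC_defs)

lemma C_shade [simp]:
  "shade (C1 s) = s" "shade (Cu s) = s" "shade (Cz s) = s" "shade (Cd1 s) = s" "shade (Cd2 s) = s"
  "shade (Ce1 s) = s" "shade (Ce2 s) = s" "shade (CF1 s) = s" "shade (CF2 s) = s" "shade (CH s) = s" "shade (CG s) = s"
  by (simp_all add: discC_defs)

lemma C_half [simp]:
  "half_marks (C1 s) = 1" "half_marks (Cu s) = 2" "half_marks (Cz s) = 1" "half_marks (Cd1 s) = 1" "half_marks (Cd2 s) = 1"
  "half_marks (Ce1 s) = 1" "half_marks (Ce2 s) = 1" "half_marks (CF1 s) = 2" "half_marks (CF2 s) = 2" "half_marks (CH s) = 2"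
  "half_marks (CG s) = 2"
  by (simp_all add: half_marks_def)

lemma all_less_two: "(\<forall>i<(2::nat). P i) \<longleftrightarrow> P 0 \<and> P 1"
  by (auto simp: less_2_cases_iff)

lemma C_convr: "right_convolution_tangle s (draw (gC s) (C1 s) {Cu s, Cz s}) (Cu s) (Cz s)"
  unfolding right_convolution_tangle_def
  using C.drawing_planar[OF C_convr_drawing[of s]] C.drawing_no_closed[OF C_convr_drawing[of s]]
    C.drawing_joined_all[OF C_convr_drawing[of s]]
  by (simp add: box_type_def top_mark_def bot_mark_def)

text \<open>
  \<open>Cz\<close> has its distinguished interval inside both circles and stands upright; \<open>dW\<close> is upside down, so
  there the upper disc in the plane is the lower factor.
\<close>

lemma C_stack_e: "stacking_tangle 1 s (draw (gC s) (Cz s) {Ce2 s, Ce1 s}) (Ce2 s) (Ce1 s)"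
  unfolding stacking_tangle_def
  using C.drawing_planar[OF C_stack_e_drawing[of s]] C.drawing_no_closed[OF C_stack_e_drawing[of s]]
    C.drawing_joined_all[OF C_stack_e_drawing[of s]]
  by (simp add: box_type_def top_mark_def bot_mark_def)

lemma C_stack_d: "stacking_tangle 1 s (draw (gC s) (dW s) {Cd1 s, Cd2 s}) (Cd1 s) (Cd2 s)"
  unfolding stacking_tangle_def
  using C.drawing_planar[OF C_stack_d_drawing[of s]] C.drawing_no_closed[OF C_stack_d_drawing[of s]]
    C.drawing_joined_all[OF C_stack_d_drawing[of s]]
  by (simp add: box_type_def top_mark_def bot_mark_def)

lemma C_stack_G: "stacking_tangle 2 s (draw (gC s) (CG s) {Cu s, CH s}) (Cu s) (CH s)"
  unfolding stacking_tangle_def all_less_two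
  using C.drawing_planar[OF C_stack_G_drawing[of s]] C.drawing_no_closed[OF C_stack_G_drawing[of s]]
    C.drawing_joined_all[OF C_stack_G_drawing[of s]]
  by (simp add: box_type_def top_mark_def bot_mark_def)

lemma C_stack_H: "stacking_tangle 2 s (draw (gC s) (CH s) {CF1 s, CF2 s}) (CF1 s) (CF2 s)"
  unfolding stacking_tangle_def all_less_two
  using C.drawing_planar[OF C_stack_H_drawing[of s]] C.drawing_no_closed[OF C_stack_H_drawing[of s]]
    C.drawing_joined_all[OF C_stack_H_drawing[of s]]
  by (simp add: box_type_def top_mark_def bot_mark_def)

text \<open>
  The vertical line through \<open>- 4\<close> meets the circles only below the start point \<open>- 4 + 48 \<i>\<close>.
\<close>

lemma C_closing: "closure_tangle 2 s (draw (gC s) (dO s) {CG s}) (CG s)"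
proof -
  note D = C_closing_drawing[of s]
  have "\<exists>c ts. disc_param (CG s) c ts \<and>
      (\<forall>w\<in>frontier (region (dO s)). connected_component (off_strings (draw (gC s) (dO s) {CG s})) (c 0) w)"
    unfolding CG_def
  proof (rule closed_on_right[where q = "Complex (- 4) 48", OF _ _ CG_in_dO[unfolded CG_def] adapted_C_CG[unfolded CG_def]])
    show "region (dO s) = cball (Complex (- 11/2) 0) (sqrt 40000)" by (simp add: dO_def)
    show "p \<in> interior (region (dO s))" if "gC s p = 0" for p
      using that swallows_O[of s] dO_4[of s] unfolding gC_zero swallows_def
      by (auto simp: curveC_def split: if_splits)
    show "gC s (Complex (Re (Complex (- 4) 48)) y) \<noteq> 0" if "Im (Complex (- 4) 48) \<le> y" for y
    proof -
      have "48 * 48 \<le> y * y" using that by (intro mult_mono) auto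
      then have "y * y \<noteq> 9" "y \<noteq> 0" using that by auto
      then show ?thesis by (simp add: gC_def power2_eq_square)
    qed
  qed (auto simp: mem_sqrt power2_eq_square orient_def circ_def simp del: mem_sphere)
  then show ?thesis
    unfolding closure_tangle_def all_less_two
    using C.drawing_planar[OF D] C.drawing_no_closed[OF D] C.drawing_joined_all[OF D]
    by (simp add: box_type_def top_mark_def bot_mark_def dO_def)
qed

lemma adapted_circle_C1: "adapted (circleg s) (C1 s)"
  unfolding C1_def
  by (rule adapted_circle[OF crossing_cocuts[OF _ _ C1_5[unfolded C1_def]], where q = "Complex (- 6) 1"])
     (auto simp: circleg_def mem_sqrt power2_eq_square orient_def circ_def simp del: mem_sphere)

lemma C_pair: "draw (gC s) (dO s) {C1 s, dW s} = draw (circleg s) (dO s) {C1 s, dW s}"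
proof (rule draw_cong)
  fix p assume "p \<in> btw (dO s) {C1 s, dW s}"
  then have "p \<notin> interior (region (C1 s))" by (simp add: btw_insert)
  moreover have "cball (Complex 0 0) (sqrt 16) \<subseteq> interior (region (C1 s))"
    unfolding C1_def rdisc_simps interior_cball
    by (rule cball_sqrt_subset) (simp_all add: power2_eq_square)
  ultimately have "p \<notin> cball (Complex 0 0) (sqrt 16)" by blast
  then have "0 < (Re p)\<^sup>2 + (Im p)\<^sup>2 - 4\<^sup>2" unfolding mem_sqrt by simp
  then show "sgn (gC s p) = sgn (circleg s p)"
    unfolding gC_def circleg_def by (simp add: sgn_mult)
qed

lemma C_pair_planar: "planar_tangle (draw (gC s) (dO s) {C1 s, dW s})" "nested (dO s) {C1 s, dW s}"
proof -
  have D: "drawing (circleg s) (\<lambda>_ :: unit. circ 5) (dO s) {C1 s, dW s} {((), - 1, - 1/10), ((), 1/10, 1)}"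
    by (rule pair_drawing[OF C1_5 _ _ adapted_circle_C1 C1_in_dE C1_off_dW]) auto
  show "planar_tangle (draw (gC s) (dO s) {C1 s, dW s})" "nested (dO s) {C1 s, dW s}"
    unfolding C_pair using circle.drawing_planar[OF D] drawing_nested[OF D] by blast+
qed

lemma cnj_circ: "cnj (circ r t) = circ r (- t)"
  by (simp add: circ_def complex_eq_iff)

lemma reflect_C:
  "reflect_disc (CF1 s) = CF2 s" "reflect_disc (Cd1 s) = Cd2 s" "reflect_disc (Ce1 s) = Ce2 s"
  "reflect_disc (Cd2 s) = Cd1 s" "reflect_disc (Ce2 s) = Ce1 s"
  unfolding discC_defs reflect_rdisc by (simp_all add: cnj_circ complex_cnj)

lemma reflect_C_draw:
  "reflect_tangle (draw (gC s) (CF1 s) {Cd1 s, Ce1 s}) = draw (gC s) (CF2 s) {Cd2 s, Ce2 s}"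
  by (subst reflect_draw) (simp_all add: reflect_C gC_def)

context cstar_planar_algebra
begin

text \<open>
  The product convention is stated with a labelling that names the two factors; here it is put into
  the form in which tangles are substituted into each other.
\<close>

lemma stack_value:
  assumes st: "stacking_tangle n s (draw g D I) lo up" and f: "f lo \<in> carrier (A n s)" "f up \<in> carrier (A n s)"
  shows "Z (draw g D I) f = f lo \<otimes>\<^bsub>A n s\<^esub> f up"
proof -
  have I: "I = {lo, up}" "lo \<noteq> up" "planar_tangle (draw g D I)" "box_type n s lo" "box_type n s up"
    using st unfolding stacking_tangle_def by auto
  have "f lo \<otimes>\<^bsub>A n s\<^esub> f up = Z (draw g D I) (\<lambda>d. if d = lo then f lo else f up)"
    by (rule mult_stacking[OF st f])
  also have "\<dots> = Z (draw g D I) f"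
    by (rule Z_draw_cong[OF I(3)]) (use f I in \<open>auto simp: box_type_def half_marks_def\<close>)
  finally show ?thesis by simp
qed

lemma C_F1_closed:
  assumes "f (Cd1 s) \<in> carrier (A 1 s)" "f (Ce1 s) \<in> carrier (A 1 s)"
  shows "Z (draw (gC s) (CF1 s) {Cd1 s, Ce1 s}) f \<in> carrier (A 2 s)"
proof -
  have "Z (draw (gC s) (CF1 s) {Cd1 s, Ce1 s}) f \<in> carrier (A (half_marks (CF1 s)) (shade (CF1 s)))"
    by (rule Z_draw_closed[OF C.drawing_planar[OF C_F1_drawing]]) (use assms in auto)
  then show ?thesis by simp
qed

lemma C_F2_closed:
  assumes "f (Cd2 s) \<in> carrier (A 1 s)" "f (Ce2 s) \<in> carrier (A 1 s)"
  shows "Z (draw (gC s) (CF2 s) {Cd2 s, Ce2 s}) f \<in> carrier (A 2 s)"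
proof -
  have "Z (draw (gC s) (CF2 s) {Cd2 s, Ce2 s}) f \<in> carrier (A (half_marks (CF2 s)) (shade (CF2 s)))"
    by (rule Z_draw_closed[OF C.drawing_planar[OF C_F2_drawing]]) (use assms in auto)
  then show ?thesis by simp
qed

context
  fixes conv_right
  assumes right: "is_right_convolution (boxes A) Z conv_right"
begin

lemma C_right_draw:
  assumes "f (Cu s) \<in> carrier (A 2 s)" "f (Cz s) \<in> carrier (A 1 s)"
  shows "Z (draw (gC s) (C1 s) {Cu s, Cz s}) f = conv_right s (f (Cu s)) (f (Cz s))"
proof -
  have "conv_right s (f (Cu s)) (f (Cz s))
      = Z (draw (gC s) (C1 s) {Cu s, Cz s}) (\<lambda>d. if d = Cu s then f (Cu s) else f (Cz s))"
    using right C_convr[of s] assms unfolding is_right_convolution_def by blast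
  also have "\<dots> = Z (draw (gC s) (C1 s) {Cu s, Cz s}) f"
    by (rule Z_draw_cong[OF C.drawing_planar[OF C_convr_drawing]]) (use assms in auto)
  finally show ?thesis by simp
qed

text \<open>
  Both sides are the closed tangle with the five boxes \<open>Y\<close>. The left side groups them by circles,
  the right side groups them by the half plane in which they lie.
\<close>

lemma conv_right_trace:
  assumes u: "f (Cu s) \<in> carrier (A 2 s)"
    and e: "f (Ce1 s) \<in> carrier (A 1 s)" "f (Ce2 s) \<in> carrier (A 1 s)"
    and d: "f (Cd1 s) \<in> carrier (A 1 s)" "f (Cd2 s) \<in> carrier (A 1 s)"
  shows "tr 1 s (conv_right s (f (Cu s)) (f (Ce2 s) \<otimes>\<^bsub>A 1 s\<^esub> f (Ce1 s)) \<otimes>\<^bsub>A 1 s\<^esub> (f (Cd1 s) \<otimes>\<^bsub>A 1 s\<^esub> f (Cd2 s)))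
    = tr 2 s (f (Cu s) \<otimes>\<^bsub>A 2 s\<^esub> (Z (draw (gC s) (CF1 s) {Cd1 s, Ce1 s}) f \<otimes>\<^bsub>A 2 s\<^esub> Z (draw (gC s) (CF2 s) {Cd2 s, Ce2 s}) f))"
proof -
  define Y where "Y = {Cu s, Ce1 s, Ce2 s, Cd1 s, Cd2 s}"
  define ee where "ee = f (Ce2 s) \<otimes>\<^bsub>A 1 s\<^esub> f (Ce1 s)"
  define dd where "dd = f (Cd1 s) \<otimes>\<^bsub>A 1 s\<^esub> f (Cd2 s)"
  have eec: "ee \<in> carrier (A 1 s)" and ddc: "dd \<in> carrier (A 1 s)" using e d by (auto simp: ee_def dd_def)
  define v where "v = conv_right s (f (Cu s)) ee"
  define c1 where "c1 = Z (draw (gC s) (CF1 s) {Cd1 s, Ce1 s}) f"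
  define c2 where "c2 = Z (draw (gC s) (CF2 s) {Cd2 s, Ce2 s}) f"
  have c1: "c1 \<in> carrier (A 2 s)" unfolding c1_def by (rule C_F1_closed[OF d(1) e(1)])
  have c2: "c2 \<in> carrier (A 2 s)" unfolding c2_def by (rule C_F2_closed[OF d(2) e(2)])
  define h where "h = f(dW s := dd, Cz s := ee, C1 s := v, CF1 s := c1, CF2 s := c2, CH s := c1 \<otimes>\<^bsub>A 2 s\<^esub> c2)"
  have h: "h (Cu s) = f (Cu s)" "h (Ce1 s) = f (Ce1 s)" "h (Ce2 s) = f (Ce2 s)" "h (Cd1 s) = f (Cd1 s)"
    "h (Cd2 s) = f (Cd2 s)" "h (dW s) = dd" "h (Cz s) = ee" "h (C1 s) = v"
    "h (CF1 s) = c1" "h (CF2 s) = c2" "h (CH s) = c1 \<otimes>\<^bsub>A 2 s\<^esub> c2"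
    by (simp_all add: h_def)
  have "Z (draw (gC s) (C1 s) {Cu s, Cz s}) h \<in> carrier (A (half_marks (C1 s)) (shade (C1 s)))"
    by (rule Z_draw_closed[OF C.drawing_planar[OF C_convr_drawing]]) (use u eec in \<open>auto simp: h\<close>)
  then have vc: "v \<in> carrier (A 1 s)" using C_right_draw[of h s] u eec by (simp add: h v_def)
  have "tr 1 s (v \<otimes>\<^bsub>A 1 s\<^esub> dd) = tr 0 s (Z (draw (gC s) (dO s) {C1 s, dW s}) h)"
    unfolding C_pair
    by (subst trace_mult[OF C1_5 _ _ _ adapted_circle_C1 C1_in_dE C1_off_dW]) (use vc ddc in \<open>auto simp: h\<close>)
  also have "Z (draw (gC s) (dO s) {C1 s, dW s}) h
      = Z (draw (gC s) (dO s) {C1 s, dW s}) (h(C1 s := Z (draw (gC s) (C1 s) {Cu s, Cz s}) h))"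
    using C_right_draw[of h s] u eec by (simp add: h v_def fun_upd_idem)
  also have "\<dots> = Z (draw (gC s) (dO s) {Cu s, Cz s, dW s}) h"
    by (rule Z_plug[symmetric, OF C_pair_planar C.drawing_planar[OF C_convr_drawing] drawing_nested[OF C_convr_drawing]])
       (use u eec ddc in \<open>auto simp: h\<close>)
  also have "\<dots> = Z (draw (gC s) (dO s) {Cu s, Cz s, dW s}) (h(Cz s := Z (draw (gC s) (Cz s) {Ce2 s, Ce1 s}) h))"
    using stack_value[OF C_stack_e, of h] e by (simp add: h ee_def fun_upd_idem)
  also have "\<dots> = Z (draw (gC s) (dO s) {Cu s, Ce1 s, Ce2 s, dW s}) h"
    by (rule Z_plug[symmetric, OF C.drawing_planar[OF C_uzw_drawing] drawing_nested[OF C_uzw_drawing]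
          C.drawing_planar[OF C_stack_e_drawing] drawing_nested[OF C_stack_e_drawing]])
       (use u e ddc in \<open>auto simp: h\<close>)
  also have "\<dots> = Z (draw (gC s) (dO s) {Cu s, Ce1 s, Ce2 s, dW s}) (h(dW s := Z (draw (gC s) (dW s) {Cd1 s, Cd2 s}) h))"
    using stack_value[OF C_stack_d, of h] d by (simp add: h dd_def fun_upd_idem)
  also have "\<dots> = Z (draw (gC s) (dO s) Y) h"
    by (rule Z_plug[symmetric, OF C.drawing_planar[OF C_uew_drawing] drawing_nested[OF C_uew_drawing]
          C.drawing_planar[OF C_stack_d_drawing] drawing_nested[OF C_stack_d_drawing]])
       (use u e d in \<open>auto simp: h Y_def\<close>)
  finally have 1: "tr 1 s (v \<otimes>\<^bsub>A 1 s\<^esub> dd) = tr 0 s (Z (draw (gC s) (dO s) Y) h)" .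

  have J1: "Z (draw (gC s) (CF1 s) {Cd1 s, Ce1 s}) h = c1" unfolding c1_def
    by (rule Z_draw_cong[OF C.drawing_planar[OF C_F1_drawing]]) (use e d in \<open>auto simp: h\<close>)
  have J2: "Z (draw (gC s) (CF2 s) {Cd2 s, Ce2 s}) h = c2" unfolding c2_def
    by (rule Z_draw_cong[OF C.drawing_planar[OF C_F2_drawing]]) (use e d in \<open>auto simp: h\<close>)
  have m: "f (Cu s) \<otimes>\<^bsub>A 2 s\<^esub> (c1 \<otimes>\<^bsub>A 2 s\<^esub> c2) \<in> carrier (A 2 s)" using u c1 c2 by simp
  have "tr 2 s (f (Cu s) \<otimes>\<^bsub>A 2 s\<^esub> (c1 \<otimes>\<^bsub>A 2 s\<^esub> c2))
      = tr 0 s (Z (draw (gC s) (dO s) {CG s}) (\<lambda>_. f (Cu s) \<otimes>\<^bsub>A 2 s\<^esub> (c1 \<otimes>\<^bsub>A 2 s\<^esub> c2)))"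
    by (rule tr_closure[OF C_closing m])
  also have "Z (draw (gC s) (dO s) {CG s}) (\<lambda>_. f (Cu s) \<otimes>\<^bsub>A 2 s\<^esub> (c1 \<otimes>\<^bsub>A 2 s\<^esub> c2))
      = Z (draw (gC s) (dO s) {CG s}) (h(CG s := Z (draw (gC s) (CG s) {Cu s, CH s}) h))"
    using stack_value[OF C_stack_G, of h] u c1 c2
    by (intro Z_draw_cong[OF C.drawing_planar[OF C_closing_drawing]]) (auto simp: h)
  also have "\<dots> = Z (draw (gC s) (dO s) {Cu s, CH s}) h"
    by (rule Z_plug[symmetric, OF C.drawing_planar[OF C_closing_drawing] drawing_nested[OF C_closing_drawing]
          C.drawing_planar[OF C_stack_G_drawing] drawing_nested[OF C_stack_G_drawing]])
       (use u c1 c2 in \<open>auto simp: h\<close>)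
  also have "\<dots> = Z (draw (gC s) (dO s) {Cu s, CH s}) (h(CH s := Z (draw (gC s) (CH s) {CF1 s, CF2 s}) h))"
    using stack_value[OF C_stack_H, of h] c1 c2 by (simp add: h fun_upd_idem)
  also have "\<dots> = Z (draw (gC s) (dO s) {Cu s, CF1 s, CF2 s}) h"
    by (rule Z_plug[symmetric, OF C.drawing_planar[OF C_uH_drawing] drawing_nested[OF C_uH_drawing]
          C.drawing_planar[OF C_stack_H_drawing] drawing_nested[OF C_stack_H_drawing]])
       (use u c1 c2 in \<open>auto simp: h\<close>)
  also have "\<dots> = Z (draw (gC s) (dO s) {Cu s, CF1 s, CF2 s}) (h(CF1 s := Z (draw (gC s) (CF1 s) {Cd1 s, Ce1 s}) h))"
    by (simp add: J1 h fun_upd_idem)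
  also have "\<dots> = Z (draw (gC s) (dO s) {Cu s, CF2 s, Cd1 s, Ce1 s}) h"
    by (rule Z_plug[symmetric, OF C.drawing_planar[OF C_uFF_drawing] drawing_nested[OF C_uFF_drawing]
          C.drawing_planar[OF C_F1_drawing] drawing_nested[OF C_F1_drawing]])
       (use u c2 e d in \<open>auto simp: h\<close>)
  also have "\<dots> = Z (draw (gC s) (dO s) {Cu s, CF2 s, Cd1 s, Ce1 s}) (h(CF2 s := Z (draw (gC s) (CF2 s) {Cd2 s, Ce2 s}) h))"
    by (simp add: J2 h fun_upd_idem)
  also have "\<dots> = Z (draw (gC s) (dO s) Y) h"
    by (rule Z_plug[symmetric, OF C.drawing_planar[OF C_uFde_drawing] drawing_nested[OF C_uFde_drawing]
          C.drawing_planar[OF C_F2_drawing] drawing_nested[OF C_F2_drawing]])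
       (use u e d in \<open>auto simp: h Y_def\<close>)
  finally show ?thesis using 1 by (simp add: c1_def c2_def v_def ee_def dd_def)
qed

text \<open>
  The 2-box \<open>c\<close> in the upper half plane is made of \<open>d\<close> and \<open>b\<^sup>*\<close>, the one in the lower half plane of
  \<open>d\<^sup>*\<close> and \<open>b\<close>. The picture is symmetric under reflection, so the latter is \<open>c\<^sup>*\<close>, and the trace
  becomes \<open>tr (a a\<^sup>* c c\<^sup>*) = tr (x x\<^sup>*)\<close> with \<open>x = a\<^sup>* c\<close>.
\<close>

lemma conv_right_positive:
  assumes a: "a \<in> carrier (A 2 s)" and b: "b \<in> carrier (A 1 s)" and d: "d \<in> carrier (A 1 s)"
  shows "tr 1 s (conv_right s (a \<otimes>\<^bsub>A 2 s\<^esub> star (A 2 s) a) (b \<otimes>\<^bsub>A 1 s\<^esub> star (A 1 s) b)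
      \<otimes>\<^bsub>A 1 s\<^esub> (d \<otimes>\<^bsub>A 1 s\<^esub> star (A 1 s) d)) \<in> \<real>\<^sub>\<ge>\<^sub>0"
proof -
  define f where "f e = (if e = Cu s then a \<otimes>\<^bsub>A 2 s\<^esub> star (A 2 s) a else if e = Ce2 s then b
     else if e = Ce1 s then star (A 1 s) b else if e = Cd1 s then d else star (A 1 s) d)" for e
  have f: "f (Cu s) = a \<otimes>\<^bsub>A 2 s\<^esub> star (A 2 s) a" "f (Ce2 s) = b" "f (Ce1 s) = star (A 1 s) b"
    "f (Cd1 s) = d" "f (Cd2 s) = star (A 1 s) d"
    by (simp_all add: f_def)
  define c where "c = Z (draw (gC s) (CF1 s) {Cd1 s, Ce1 s}) f"
  have c: "c \<in> carrier (A 2 s)"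
    unfolding c_def by (rule C_F1_closed) (use b d in \<open>simp_all add: f\<close>)
  interpret A2: fin_dim_cstar_algebra cscale "A 2 s" by (rule cstar)
  interpret A1: fin_dim_cstar_algebra cscale "A 1 s" by (rule cstar)
  have "star (A 2 s) c = Z (draw (gC s) (CF2 s) {Cd2 s, Ce2 s}) (\<lambda>e. star (A (half_marks e) (shade e)) (f (reflect_disc e)))"
    using star_reflection[OF C.drawing_planar[OF C_F1_drawing[of s]], of f] b d
    by (simp add: c_def labelling_def f reflect_C_draw)
  also have "\<dots> = Z (draw (gC s) (CF2 s) {Cd2 s, Ce2 s}) f"
    by (rule Z_draw_cong[OF C.drawing_planar[OF C_F2_drawing]])
       (use b d A1.star_star in \<open>auto simp: f reflect_C\<close>)
  finally have cs: "Z (draw (gC s) (CF2 s) {Cd2 s, Ce2 s}) f = star (A 2 s) c" ..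
  let ?m = "\<lambda>x y. x \<otimes>\<^bsub>A 2 s\<^esub> y"
  define x where "x = ?m (star (A 2 s) a) c"
  have "tr 1 s (conv_right s (a \<otimes>\<^bsub>A 2 s\<^esub> star (A 2 s) a) (b \<otimes>\<^bsub>A 1 s\<^esub> star (A 1 s) b)
      \<otimes>\<^bsub>A 1 s\<^esub> (d \<otimes>\<^bsub>A 1 s\<^esub> star (A 1 s) d)) = tr 2 s (?m (?m a (star (A 2 s) a)) (?m c (star (A 2 s) c)))"
    using conv_right_trace[of f s] a b d by (simp add: f c_def[symmetric] cs)
  also have "?m (?m a (star (A 2 s) a)) (?m c (star (A 2 s) c)) = ?m a (?m x (star (A 2 s) c))"
    using a c by (simp add: x_def A2.m_assoc)
  also have "tr 2 s \<dots> = tr 2 s (?m (?m x (star (A 2 s) c)) a)"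
    using a c by (intro tr_comm) (auto simp: x_def)
  also have "?m (?m x (star (A 2 s) c)) a = ?m x (star (A 2 s) x)"
    using a c by (simp add: x_def A2.m_assoc A2.star_mult A2.star_star)
  finally have e: "tr 1 s (conv_right s (a \<otimes>\<^bsub>A 2 s\<^esub> star (A 2 s) a) (b \<otimes>\<^bsub>A 1 s\<^esub> star (A 1 s) b)
      \<otimes>\<^bsub>A 1 s\<^esub> (d \<otimes>\<^bsub>A 1 s\<^esub> star (A 1 s) d)) = tr 2 s (?m x (star (A 2 s) x))" .
  have "x \<in> carrier (A 2 s)" using a c by (simp add: x_def)
  then show ?thesis
    unfolding e by (intro tr_positive) (auto simp: alg_positive_def)
qed

end

end

section \<open>Finite-dimensional algebras with a faithful trace\<close>

text \<open>
  The trace supplies an inner product, which replaces the spectral theory of positive elements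
  throughout this section.
\<close>

locale traced_algebra =
  fin_dim_cstar_algebra cscale A
  for cscale :: "complex \<Rightarrow> 'v::ab_group_add \<Rightarrow> 'v"
    and A :: "('v, 'm) star_algebra_scheme" (structure) +
  fixes tr :: "'v \<Rightarrow> complex"
  assumes tr_add: "\<lbrakk>x \<in> carrier A; y \<in> carrier A\<rbrakk> \<Longrightarrow> tr (x + y) = tr x + tr y"
    and tr_scale: "x \<in> carrier A \<Longrightarrow> tr (cscale a x) = a * tr x"
    and tr_comm: "\<lbrakk>x \<in> carrier A; y \<in> carrier A\<rbrakk> \<Longrightarrow> tr (x \<otimes> y) = tr (y \<otimes> x)"
    and tr_positive: "alg_positive A x \<Longrightarrow> tr x \<in> \<real>\<^sub>\<ge>\<^sub>0"
    and tr_faithful: "\<lbrakk>alg_positive A x; tr x = 0\<rbrakk> \<Longrightarrow> x = 0"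
begin

lemma add_closed [simp]: "x \<in> carrier A \<Longrightarrow> y \<in> carrier A \<Longrightarrow> x + y \<in> carrier A"
  by (rule subspace_add[OF subspace_carrier])

lemma scale_closed [simp]: "x \<in> carrier A \<Longrightarrow> cscale c x \<in> carrier A"
  by (rule subspace_scale[OF subspace_carrier])

lemma diff_closed [simp]: "x \<in> carrier A \<Longrightarrow> y \<in> carrier A \<Longrightarrow> x - y \<in> carrier A"
  by (rule subspace_diff[OF subspace_carrier])

lemma zero_closed [simp]: "0 \<in> carrier A"
  by (rule subspace_0[OF subspace_carrier])

lemma neg_closed [simp]: "x \<in> carrier A \<Longrightarrow> - x \<in> carrier A"
  by (rule subspace_neg[OF subspace_carrier])

declare star_closed [simp]

lemma mult_0 [simp]: "x \<in> carrier A \<Longrightarrow> x \<otimes> 0 = 0" "x \<in> carrier A \<Longrightarrow> 0 \<otimes> x = 0"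
  using mult_scale_right[of x 0 0] mult_scale_left[of 0 x 0] by simp_all

lemma mult_neg: "x \<in> carrier A \<Longrightarrow> y \<in> carrier A \<Longrightarrow> x \<otimes> (- y) = - (x \<otimes> y)"
  "x \<in> carrier A \<Longrightarrow> y \<in> carrier A \<Longrightarrow> (- x) \<otimes> y = - (x \<otimes> y)"
  using mult_scale_right[of x y "- 1"] mult_scale_left[of x y "- 1"] by simp_all

lemma mult_diff_right: "\<lbrakk>x \<in> carrier A; y \<in> carrier A; z \<in> carrier A\<rbrakk> \<Longrightarrow> z \<otimes> (x - y) = z \<otimes> x - z \<otimes> y"
  using mult_add_right[of x "- y" z] by (simp add: mult_neg)

lemma mult_diff_left: "\<lbrakk>x \<in> carrier A; y \<in> carrier A; z \<in> carrier A\<rbrakk> \<Longrightarrow> (x - y) \<otimes> z = x \<otimes> z - y \<otimes> z"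
  using mult_add_left[of x "- y" z] by (simp add: mult_neg)

lemma star_0 [simp]: "star A 0 = 0"
  using star_scale[of 0 0] by simp

lemma star_neg: "x \<in> carrier A \<Longrightarrow> star A (- x) = - star A x"
  using star_scale[of x "- 1"] by simp

lemma star_diff: "\<lbrakk>x \<in> carrier A; y \<in> carrier A\<rbrakk> \<Longrightarrow> star A (x - y) = star A x - star A y"
  using star_add[of x "- y"] by (simp add: star_neg)

lemma star_one [simp]: "star A \<one> = \<one>"
  using star_mult[of "star A \<one>" \<one>] star_star[of \<one>] r_one[of "star A \<one>"] l_one[of "star A \<one>"] by simp

lemma tr_0 [simp]: "tr 0 = 0"
  using tr_scale[of 0 0] by simp

lemma tr_diff: "\<lbrakk>x \<in> carrier A; y \<in> carrier A\<rbrakk> \<Longrightarrow> tr (x - y) = tr x - tr y"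
  using tr_add[of x "- y"] tr_scale[of y "- 1"] by simp

lemma positiveI: "a \<in> carrier A \<Longrightarrow> alg_positive A (a \<otimes> star A a)"
  by (auto simp: alg_positive_def)

lemma positiveD:
  assumes "alg_positive A x"
  shows "x \<in> carrier A" "star A x = x"
  using assms by (auto simp: alg_positive_def star_mult star_star)

lemma mult_star_eq_0:
  assumes a: "a \<in> carrier A" "a \<otimes> star A a = 0"
  shows "a = 0"
proof -
  have "(nrm A (star A a))\<^sup>2 = nrm A (a \<otimes> star A a)"
    using cstar_identity[of "star A a"] a(1) by (simp add: star_star)
  then have "nrm A (star A a) = 0" using a(2) nrm_eq_0[of 0] by simp
  then have "star A a = 0" using nrm_eq_0[of "star A a"] a(1) by simp
  then show ?thesis using star_star[OF a(1)] by simp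
qed

lemma tr_star_eq_0: "a \<in> carrier A \<Longrightarrow> tr (a \<otimes> star A a) = 0 \<Longrightarrow> a = 0"
  using tr_faithful[OF positiveI] mult_star_eq_0 by blast

lemma tr_star_eq_0': "a \<in> carrier A \<Longrightarrow> tr (star A a \<otimes> a) = 0 \<Longrightarrow> a = 0"
  using tr_star_eq_0[of "a"] tr_comm[of a "star A a"] by simp

lemma sum_positive_eq_0:
  assumes "a \<in> carrier A" "b \<in> carrier A" "a \<otimes> star A a + b \<otimes> star A b = 0"
  shows "a = 0" "b = 0"
proof -
  have "tr (a \<otimes> star A a) + tr (b \<otimes> star A b) = 0"
    using tr_add[of "a \<otimes> star A a" "b \<otimes> star A b"] assms by simp
  then have "tr (a \<otimes> star A a) = 0 \<and> tr (b \<otimes> star A b) = 0"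
    using tr_positive[OF positiveI[OF assms(1)]] tr_positive[OF positiveI[OF assms(2)]]
    by (auto simp: complex_nonneg_Reals_iff complex_eq_iff)
  then show "a = 0" "b = 0" using tr_star_eq_0 assms by blast+
qed

text \<open>
  For \<open>y = a a\<^sup>*\<close> and \<open>w = b b\<^sup>*\<close> the trace is \<open>tr (x x\<^sup>*)\<close> with \<open>x = a\<^sup>* b\<close>.
\<close>

lemma positive_mult_eq_0:
  assumes "alg_positive A y" "alg_positive A w" "tr (y \<otimes> w) = 0"
  shows "y \<otimes> w = 0"
proof -
  obtain a b where a: "a \<in> carrier A" "y = a \<otimes> star A a" and b: "b \<in> carrier A" "w = b \<otimes> star A b"
    using assms(1,2) by (auto simp: alg_positive_def)
  define x where "x = star A a \<otimes> b"
  have x: "x \<in> carrier A" "star A x = star A b \<otimes> a" using a b by (auto simp: x_def star_mult star_star)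
  have "y \<otimes> w = a \<otimes> (x \<otimes> star A b)" using a b by (simp add: x_def m_assoc)
  moreover have "tr (a \<otimes> (x \<otimes> star A b)) = tr ((x \<otimes> star A b) \<otimes> a)" using a b x by (intro tr_comm) auto
  moreover have "(x \<otimes> star A b) \<otimes> a = x \<otimes> star A x" using a b x by (simp add: m_assoc)
  ultimately have "x = 0" using tr_star_eq_0[OF x(1)] assms(3) by simp
  then show ?thesis using \<open>y \<otimes> w = a \<otimes> (x \<otimes> star A b)\<close> a b by simp
qed

text \<open>
  Compressing \<open>z = w + (z - w)\<close> by \<open>e = 1 - p\<close> gives a sum of two positive elements that is zero.
\<close>

lemma compress_eq_0:
  assumes p: "p \<in> projections A" and w: "alg_positive A w" "alg_positive A (z - w)" and z: "z \<in> carrier A" "p \<otimes> z = z"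
  shows "p \<otimes> w = w"
proof -
  obtain a b where a: "a \<in> carrier A" "w = a \<otimes> star A a" and b: "b \<in> carrier A" "z - w = b \<otimes> star A b"
    using w by (auto simp: alg_positive_def)
  define e where "e = \<one> - p"
  have pc: "p \<in> carrier A" "star A p = p" using p by (auto simp: projections_def)
  have e: "e \<in> carrier A" "star A e = e" using pc by (auto simp: e_def star_diff)
  have ez: "e \<otimes> z = 0" using z pc by (simp add: e_def mult_diff_left)
  have sq: "(e \<otimes> c) \<otimes> star A (e \<otimes> c) = e \<otimes> (c \<otimes> star A c) \<otimes> e" if "c \<in> carrier A" for c
    using that e by (simp add: star_mult m_assoc)
  have wc: "w \<in> carrier A" using a by simp
  have "(e \<otimes> a) \<otimes> star A (e \<otimes> a) + (e \<otimes> b) \<otimes> star A (e \<otimes> b) = e \<otimes> w \<otimes> e + e \<otimes> (z - w) \<otimes> e"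
    using sq[OF a(1)] sq[OF b(1)] a(2) b(2) by simp
  also have "\<dots> = e \<otimes> z \<otimes> e" using e z wc by (simp add: mult_diff_right mult_diff_left)
  finally have "e \<otimes> a = 0" using sum_positive_eq_0[of "e \<otimes> a" "e \<otimes> b"] ez e a b by simp
  then have "e \<otimes> w = 0" unfolding a(2) using m_assoc[of e a "star A a"] e a by simp
  then show ?thesis using pc wc by (simp add: e_def mult_diff_left)
qed

lemma projection_le_iff:
  assumes p: "p \<in> projections A" and q: "q \<in> projections A"
  shows "alg_le A p q \<longleftrightarrow> q \<otimes> p = p"
proof
  have c: "p \<in> carrier A" "star A p = p" "p \<otimes> p = p" "q \<in> carrier A" "star A q = q" "q \<otimes> q = q"
    using p q by (auto simp: projections_def)
  show "q \<otimes> p = p" if "alg_le A p q"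
    by (rule compress_eq_0[OF q, of p q]) (use that c positiveI[of p] in \<open>auto simp: alg_le_def\<close>)
  show "alg_le A p q" if e: "q \<otimes> p = p"
  proof -
    have "p \<otimes> q = star A (q \<otimes> p)" using c star_mult by simp
    then have "p \<otimes> q = p" using e c by simp
    then have "(q - p) \<otimes> star A (q - p) = q - p"
      using e c by (simp add: star_diff mult_diff_left mult_diff_right)
    then show ?thesis using positiveI[of "q - p"] c by (simp add: alg_le_def)
  qed
qed

lemma projection_antisym:
  assumes "p \<in> projections A" "q \<in> projections A" "alg_le A p q" "alg_le A q p"
  shows "p = q"
proof -
  have "q \<otimes> p = p" "p \<otimes> q = q" using assms projection_le_iff by blast+
  then show ?thesis using star_mult[of q p] assms(1,2) by (auto simp: projections_def)
qed

lemma orthogonal_to_span: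
  assumes "F \<subseteq> carrier A" "x \<in> carrier A" "\<And>f. f \<in> F \<Longrightarrow> tr (star A f \<otimes> x) = 0" "u \<in> span F"
  shows "tr (star A u \<otimes> x) = 0"
proof -
  have "subspace {u \<in> carrier A. tr (star A u \<otimes> x) = 0}"
    using assms(2) by (auto simp: subspace_def star_add star_scale mult_add_left mult_scale_left tr_add tr_scale)
  then have "span F \<subseteq> {u \<in> carrier A. tr (star A u \<otimes> x) = 0}"
    using assms(1,3) by (intro span_minimal) auto
  then show ?thesis using assms(4) by blast
qed

text \<open>
  Gram-Schmidt for the inner product \<open>(u, v) \<mapsto> tr (u\<^sup>* v)\<close>. The coefficient uses division by the
  squared length of \<open>h\<close>; for \<open>h = 0\<close> the quotient \<open>0\<close> is harmless.
\<close>

lemma orthogonal_projection: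
  assumes "finite F" "F \<subseteq> carrier A" "v \<in> carrier A"
  shows "\<exists>w\<in>span F. \<forall>u\<in>span F. tr (star A u \<otimes> (v - w)) = 0"
  using assms
proof (induction F arbitrary: v rule: finite_induct)
  case empty
  then show ?case by (intro bexI[of _ 0]) auto
next
  case (insert f F)
  have sc: "span F \<subseteq> carrier A" "span (insert f F) \<subseteq> carrier A"
    using insert.prems by (intro span_minimal subspace_carrier; simp)+
  obtain w where w: "w \<in> span F" "\<And>u. u \<in> span F \<Longrightarrow> tr (star A u \<otimes> (v - w)) = 0"
    using insert.IH[of v] insert.prems by auto
  obtain g where g: "g \<in> span F" "\<And>u. u \<in> span F \<Longrightarrow> tr (star A u \<otimes> (f - g)) = 0"
    using insert.IH[of f] insert.prems by auto
  define h where "h = f - g"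
  have wc: "w \<in> carrier A" "g \<in> carrier A" "f \<in> carrier A" "v \<in> carrier A"
    using w g sc insert.prems by auto
  then have hc: "h \<in> carrier A" by (simp add: h_def)
  have spF: "span F \<subseteq> span (insert f F)" by (rule span_mono) auto
  have hs: "h \<in> span (insert f F)" unfolding h_def using g spF span_base[of f "insert f F"] by (intro span_diff) auto
  define c where "c = tr (star A h \<otimes> (v - w)) / tr (star A h \<otimes> h)"
  have cs: "tr (star A h \<otimes> (v - w)) = c * tr (star A h \<otimes> h)"
  proof (cases "h = 0")
    case False
    then show ?thesis using tr_star_eq_0'[OF hc] by (auto simp: c_def)
  qed (use wc in simp)
  define x where "x = v - (w + cscale c h)"
  have x: "x = (v - w) - cscale c h" "x \<in> carrier A" using wc hc by (auto simp: x_def)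
  have F0: "tr (star A u \<otimes> x) = 0" if u: "u \<in> span F" for u
  proof -
    have "u \<in> carrier A" using u sc by blast
    then show ?thesis
      unfolding x(1) using wc hc w(2)[OF u] g(2)[OF u]
      by (simp add: mult_diff_right mult_scale_right tr_diff tr_scale flip: h_def)
  qed
  have h0: "tr (star A h \<otimes> x) = 0"
    unfolding x(1) using wc hc cs by (simp add: mult_diff_right mult_scale_right tr_diff tr_scale)
  have f0: "tr (star A f \<otimes> x) = 0"
  proof -
    have "f = h + g" by (simp add: h_def)
    then show ?thesis using F0[OF g(1)] h0 wc hc x(2) by (simp add: star_add mult_add_left tr_add)
  qed
  have "tr (star A u \<otimes> x) = 0" if "u \<in> span (insert f F)" for u
    by (rule orthogonal_to_span[OF insert.prems(1) x(2) _ that]) (use f0 F0 span_base in auto)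
  moreover have "w + cscale c h \<in> span (insert f F)"
    using w(1) spF hs by (intro span_add span_scale) auto
  ultimately show ?case unfolding x_def by blast
qed

text \<open>
  The range projection of \<open>a\<close> is the orthogonal projection \<open>p\<close> of the unit to the right ideal \<open>a A\<close>.
  Indeed \<open>1 - p\<close> is orthogonal to the ideal, hence \<open>(a d)\<^sup>* (1 - p) = 0\<close> for all \<open>d\<close>, and adjoints
  give \<open>p\<^sup>* a d = a d\<close>. For \<open>a d = p\<close> this reads \<open>p = p\<^sup>* p\<close>, so \<open>p\<close> is a projection.
\<close>

lemma range_ex:
  assumes a: "a \<in> carrier A"
  shows "\<exists>p\<in>projections A. p \<otimes> a = a \<and> (\<exists>c\<in>carrier A. p = a \<otimes> c)"
proof -
  obtain B where B: "finite B" "span B = carrier A" using finite_dimensional by blast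
  let ?F = "(\<lambda>b. a \<otimes> b) ` B"
  have Bc: "B \<subseteq> carrier A" using B(2) span_base by blast
  have "subspace {b \<in> carrier A. a \<otimes> b \<in> span ?F}"
    using a by (auto simp: subspace_def mult_add_right mult_scale_right span_add span_scale span_zero)
  then have "span B \<subseteq> {b \<in> carrier A. a \<otimes> b \<in> span ?F}"
    using Bc by (intro span_minimal) (auto intro: span_base)
  then have aF: "a \<otimes> b \<in> span ?F" if "b \<in> carrier A" for b using that B(2) by blast
  have "subspace ((\<lambda>b. a \<otimes> b) ` carrier A)"
    unfolding subspace_def
  proof (intro conjI ballI allI)
    show "0 \<in> (\<lambda>b. a \<otimes> b) ` carrier A" using a by (intro image_eqI[of _ _ 0]) auto
    show "x + y \<in> (\<lambda>b. a \<otimes> b) ` carrier A" if "x \<in> (\<lambda>b. a \<otimes> b) ` carrier A" "y \<in> (\<lambda>b. a \<otimes> b) ` carrier A" for x y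
      using that a by (auto simp flip: mult_add_right)
    show "cscale c x \<in> (\<lambda>b. a \<otimes> b) ` carrier A" if "x \<in> (\<lambda>b. a \<otimes> b) ` carrier A" for c x
      using that a by (auto simp flip: mult_scale_right)
  qed
  then have Fa: "span ?F \<subseteq> (\<lambda>b. a \<otimes> b) ` carrier A" using Bc by (intro span_minimal) auto
  have "?F \<subseteq> carrier A" using a Bc by auto
  then obtain p where p: "p \<in> span ?F" "\<And>u. u \<in> span ?F \<Longrightarrow> tr (star A u \<otimes> (\<one> - p)) = 0"
    using orthogonal_projection[of ?F \<one>] B(1) by auto
  obtain c where c: "c \<in> carrier A" "p = a \<otimes> c" using p(1) Fa by blast
  have pc: "p \<in> carrier A" using c a by simp
  \<comment> \<open>the element \<open>y\<close> is orthogonal to itself\<close>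
  have key: "a \<otimes> d = star A p \<otimes> (a \<otimes> d)" if d: "d \<in> carrier A" for d
  proof -
    define y where "y = star A (a \<otimes> d) \<otimes> (\<one> - p)"
    have y: "y \<in> carrier A" using a d pc by (simp add: y_def)
    have "star A y \<otimes> y = star A (a \<otimes> (d \<otimes> y)) \<otimes> (\<one> - p)"
      using a d pc y by (simp add: y_def star_mult m_assoc)
    then have "tr (star A y \<otimes> y) = 0" using p(2) aF d y by simp
    then have "y = 0" by (rule tr_star_eq_0'[OF y])
    then have "star A (a \<otimes> d) = star A (a \<otimes> d) \<otimes> p"
      using a d pc by (simp add: y_def mult_diff_right)
    then have "star A (star A (a \<otimes> d)) = star A (star A (a \<otimes> d) \<otimes> p)" by simp
    moreover have "star A (star A (a \<otimes> d)) = a \<otimes> d" using a d by (simp add: star_star)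
    moreover have "star A (star A (a \<otimes> d) \<otimes> p) = star A p \<otimes> (a \<otimes> d)"
      using star_mult[of "star A (a \<otimes> d)" p] star_star[of "a \<otimes> d"] a d pc by simp
    ultimately show ?thesis by simp
  qed
  have pp: "p = star A p \<otimes> p" using key[OF c(1)] c(2) by simp
  then have sp: "star A p = p"
    using star_mult[of "star A p" p] star_star[of p] pc by simp
  have "p \<in> projections A" using pp sp pc by (simp add: projections_def)
  moreover have "p \<otimes> a = a" using key[of \<one>] a sp by simp
  ultimately show ?thesis using c by blast
qed

lemma range_projection:
  assumes a: "a \<in> carrier A"
  shows "range_projection A a \<in> projections A" "range_projection A a \<otimes> a = a"
    "\<exists>c\<in>carrier A. range_projection A a = a \<otimes> c"
proof -
  obtain p c where p: "p \<in> projections A" "p \<otimes> a = a" "c \<in> carrier A" "p = a \<otimes> c"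
    using range_ex[OF a] by blast
  have le: "alg_le A p q" if q: "q \<in> projections A" "q \<otimes> a = a" for q
  proof -
    have "q \<otimes> p = p" using q p(3,4) a m_assoc[of q a c] by (simp add: projections_def)
    then show ?thesis using projection_le_iff[OF p(1) q(1)] by blast
  qed
  have "range_projection A a = p" unfolding range_projection_def
  proof (rule the_equality)
    show "p \<in> projections A \<and> p \<otimes> a = a \<and> (\<forall>q\<in>projections A. q \<otimes> a = a \<longrightarrow> alg_le A p q)"
      using p le by blast
    show "q = p" if "q \<in> projections A \<and> q \<otimes> a = a \<and> (\<forall>q'\<in>projections A. q' \<otimes> a = a \<longrightarrow> alg_le A q q')" for q
      using that p le projection_antisym by blast
  qed
  then show "range_projection A a \<in> projections A" "range_projection A a \<otimes> a = a"
    "\<exists>c\<in>carrier A. range_projection A a = a \<otimes> c" using p by auto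
qed

lemma range_projection_le:
  assumes "a \<in> carrier A" "q \<in> projections A"
  shows "alg_le A (range_projection A a) q \<longleftrightarrow> q \<otimes> a = a"
proof -
  note R = range_projection[OF assms(1)]
  obtain c where c: "c \<in> carrier A" "range_projection A a = a \<otimes> c" using R(3) by blast
  have qc: "q \<in> carrier A" and rc: "range_projection A a \<in> carrier A" using assms(2) R(1) by (auto simp: projections_def)
  have "q \<otimes> range_projection A a = range_projection A a \<longleftrightarrow> q \<otimes> a = a"
  proof
    assume "q \<otimes> range_projection A a = range_projection A a"
    then show "q \<otimes> a = a" using m_assoc[of q "range_projection A a" a] R(2) qc rc assms(1) by simp
  next
    assume "q \<otimes> a = a"
    then show "q \<otimes> range_projection A a = range_projection A a"
      using m_assoc[of q a c] c qc assms(1) by simp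
  qed
  then show ?thesis using projection_le_iff[OF R(1) assms(2)] by blast
qed

text \<open>
  Let \<open>B\<close> be a maximal independent subset of \<open>S\<close>, which is finite, and let \<open>m\<close> be its sum. The range
  projection of \<open>m\<close> fixes each \<open>b \<in> B\<close>, since a vanishing sum of positive elements vanishes termwise;
  so it fixes the span of \<open>B\<close>, which contains \<open>S\<close>. It is the join because every projection above
  all the ranges fixes \<open>m\<close>.
\<close>

lemma join_of_ranges:
  assumes S: "\<And>y. y \<in> S \<Longrightarrow> alg_positive A y"
  obtains B m c where "finite B" "B \<subseteq> S" "m = (\<Sum>y\<in>B. y)" "c \<in> carrier A"
    "projection_join A (range_projection A ` S) = m \<otimes> c"
    "projection_join A (range_projection A ` S) \<in> projections A"
proof -
  have Sc: "S \<subseteq> carrier A" using S positiveD by blast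
  obtain B where B: "B \<subseteq> S" "independent B" "S \<subseteq> span B"
    using maximal_independent_subset by blast
  obtain D where D: "finite D" "span D = carrier A" using finite_dimensional by blast
  have finB: "finite B" using independent_span_bound[OF D(1) B(2)] B(1) Sc D(2) by blast
  define m where "m = (\<Sum>y\<in>B. y)"
  have sumc: "(\<Sum>y\<in>C. y) \<in> carrier A" if "C \<subseteq> B" for C
    by (rule subspace_sum[OF subspace_carrier]) (use that B(1) Sc in blast)
  have mc: "m \<in> carrier A" using sumc by (simp add: m_def)
  note R = range_projection[OF mc]
  let ?p = "range_projection A m"
  have pc: "?p \<in> carrier A" using R(1) by (simp add: projections_def)
  \<comment> \<open>the fixed points of a left multiplication form a subspace\<close>
  have fixed_span: "q \<otimes> y = y" if q: "q \<in> projections A" "\<And>b. b \<in> B \<Longrightarrow> q \<otimes> b = b" and y: "y \<in> span B" for q y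
  proof -
    have "subspace {x \<in> carrier A. q \<otimes> x = x}"
      using q(1) by (auto simp: subspace_def projections_def mult_add_right mult_scale_right)
    then have "span B \<subseteq> {x \<in> carrier A. q \<otimes> x = x}"
      using q(2) B(1) Sc by (intro span_minimal) auto
    then show ?thesis using y by blast
  qed
  have pb: "?p \<otimes> b = b" if b: "b \<in> B" for b
  proof -
    define e where "e = \<one> - ?p"
    have e: "e \<in> carrier A" "star A e = e"
      using R(1) by (auto simp: e_def projections_def star_diff)
    have em: "e \<otimes> m = 0" using R(2) pc mc by (simp add: e_def mult_diff_left)
    have pos: "\<exists>a\<in>carrier A. y = a \<otimes> star A a \<and> e \<otimes> y \<otimes> e = (e \<otimes> a) \<otimes> star A (e \<otimes> a)" if "y \<in> B" for y
    proof -
      have "y \<in> S" using B(1) that by (rule subsetD)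
      then have "alg_positive A y" by (rule S)
      then obtain a where "a \<in> carrier A" "y = a \<otimes> star A a" unfolding alg_positive_def by blast
      moreover have "e \<otimes> (a \<otimes> star A a) \<otimes> e = (e \<otimes> a) \<otimes> star A (e \<otimes> a)"
        using e \<open>a \<in> carrier A\<close> by (simp add: star_mult m_assoc)
      ultimately show ?thesis by blast
    qed
    have nn: "tr (e \<otimes> y \<otimes> e) \<in> \<real>\<^sub>\<ge>\<^sub>0" if yB: "y \<in> B" for y
    proof -
      obtain a where a: "a \<in> carrier A" "e \<otimes> y \<otimes> e = (e \<otimes> a) \<otimes> star A (e \<otimes> a)" using pos[OF yB] by blast
      show ?thesis unfolding a(2) by (rule tr_positive[OF positiveI]) (use a e in simp)
    qed
    have "tr (e \<otimes> (\<Sum>y\<in>C. y) \<otimes> e) = (\<Sum>y\<in>C. tr (e \<otimes> y \<otimes> e))" if "C \<subseteq> B" for C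
      using finite_subset[OF that finB] that
    proof (induction C rule: finite_induct)
      case (insert y C)
      have "y \<in> carrier A" "(\<Sum>y\<in>C. y) \<in> carrier A" using insert.prems B(1) Sc sumc by auto
      then show ?case using insert e by (simp add: mult_add_right mult_add_left tr_add)
    qed (use e in simp)
    from this[OF subset_refl] have "(\<Sum>y\<in>B. tr (e \<otimes> y \<otimes> e)) = tr (e \<otimes> m \<otimes> e)"
      unfolding m_def by (rule sym)
    then have "(\<Sum>y\<in>B. tr (e \<otimes> y \<otimes> e)) = 0" using em e by simp
    then have "(\<Sum>y\<in>B. Re (tr (e \<otimes> y \<otimes> e))) = 0" by (simp only: Re_sum[symmetric] zero_complex.sel)
    moreover have "0 \<le> Re (tr (e \<otimes> y \<otimes> e))" if "y \<in> B" for y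
      using nn[OF that] unfolding complex_nonneg_Reals_iff by (rule conjunct1)
    ultimately have "\<forall>y\<in>B. Re (tr (e \<otimes> y \<otimes> e)) = 0"
      using sum_nonneg_eq_0_iff[OF finB, of "\<lambda>y. Re (tr (e \<otimes> y \<otimes> e))"] by blast
    then have "Re (tr (e \<otimes> b \<otimes> e)) = 0" using b by (rule bspec)
    then have t0: "tr (e \<otimes> b \<otimes> e) = 0" using nn[OF b] unfolding complex_nonneg_Reals_iff by (simp add: complex_eq_iff)
    obtain a where a: "a \<in> carrier A" "b = a \<otimes> star A a" "e \<otimes> b \<otimes> e = (e \<otimes> a) \<otimes> star A (e \<otimes> a)"
      using pos[OF b] by blast
    have "e \<otimes> a = 0" using tr_star_eq_0[of "e \<otimes> a"] t0 a e by simp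
    then have "e \<otimes> b = 0" unfolding a(2) using m_assoc[of e a "star A a"] e a(1) by simp
    then show ?thesis using pc a(1,2) by (simp add: e_def mult_diff_left)
  qed
  have join: "projection_join A (range_projection A ` S) = ?p"
    unfolding projection_join_def
  proof (rule the_equality)
    have up: "alg_le A (range_projection A y) ?p" if "y \<in> S" for y
      using fixed_span[OF R(1) pb] B(3) that range_projection_le[of y ?p] R(1) Sc by blast
    have least: "alg_le A ?p q" if q: "q \<in> projections A" "\<forall>r\<in>range_projection A ` S. alg_le A r q" for q
    proof -
      have "q \<otimes> b = b" if "b \<in> B" for b
        using q that B(1) Sc range_projection_le[of b q] by blast
      moreover have "m \<in> span B" unfolding m_def by (intro span_sum span_base)
      ultimately have "q \<otimes> m = m" using fixed_span[OF q(1)] by blast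
      then show ?thesis using range_projection_le[OF mc q(1)] by blast
    qed
    show "?p \<in> projections A \<and> (\<forall>q\<in>range_projection A ` S. alg_le A q ?p) \<and>
        (\<forall>p'\<in>projections A. (\<forall>q\<in>range_projection A ` S. alg_le A q p') \<longrightarrow> alg_le A ?p p')"
      using R(1) up least by blast
    show "q = ?p" if "q \<in> projections A \<and> (\<forall>r\<in>range_projection A ` S. alg_le A r q) \<and>
        (\<forall>p'\<in>projections A. (\<forall>r\<in>range_projection A ` S. alg_le A r p') \<longrightarrow> alg_le A q p')" for q
      using that R(1) up least projection_antisym by blast
  qed
  obtain c where c: "c \<in> carrier A" "?p = m \<otimes> c" using R(3) by blast
  show ?thesis
    by (rule that[OF finB B(1) m_def c(1)]) (use join c R(1) in simp_all)
qed

lemma nrm_nonneg: "x \<in> carrier A \<Longrightarrow> 0 \<le> nrm A x"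
  using nrm_triangle[of x "- x"] nrm_scale[of x "- 1"] nrm_eq_0[of 0] by simp

text \<open>
  If \<open>cmod l\<close> exceeds the norm, then \<open>y = x - l\<close> is not a zero divisor on either side, by the
  submultiplicativity of the norm. A range projection \<open>p = y c\<close> satisfies \<open>(1 - p) y = 0\<close>, so \<open>y\<close>
  is invertible.
\<close>

lemma spectrum_bounded:
  assumes x: "x \<in> carrier A" and l: "l \<in> spectrum cscale A x"
  shows "cmod l \<le> nrm A x"
proof (rule ccontr)
  assume gt: "\<not> cmod l \<le> nrm A x"
  define y where "y = x - cscale l \<one>"
  have y: "y \<in> carrier A" using x by (simp add: y_def)
  have left: "b = 0" if b: "b \<in> carrier A" "b \<otimes> y = 0" for b
  proof -
    have "b \<otimes> x = cscale l b" using b x by (simp add: y_def mult_diff_right mult_scale_right)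
    then have "cmod l * nrm A b \<le> nrm A b * nrm A x"
      using nrm_scale[OF b(1), of l] nrm_mult[OF b(1) x] by simp
    then have "(cmod l - nrm A x) * nrm A b \<le> 0" by (simp add: algebra_simps)
    then have "nrm A b \<le> 0" using gt by (simp add: mult_le_0_iff)
    then show ?thesis using nrm_nonneg[OF b(1)] nrm_eq_0[OF b(1)] by simp
  qed
  obtain p c where p: "p \<in> projections A" "p \<otimes> y = y" "c \<in> carrier A" "p = y \<otimes> c"
    using range_ex[OF y] by blast
  have pc: "p \<in> carrier A" using p(1) by (simp add: projections_def)
  have "(\<one> - p) \<otimes> y = 0" using p y pc by (simp add: mult_diff_left)
  then have "\<one> - p = 0" using left[of "\<one> - p"] pc by simp
  then have yc: "y \<otimes> c = \<one>" using p(4) by simp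
  have "y \<otimes> (c \<otimes> y - \<one>) = 0" using yc p(3) y by (simp add: mult_diff_right m_assoc[symmetric])
  moreover have "b = 0" if b: "b \<in> carrier A" "y \<otimes> b = 0" for b
  proof -
    have "x \<otimes> b = cscale l b" using b x by (simp add: y_def mult_diff_left mult_scale_left)
    then have "cmod l * nrm A b \<le> nrm A x * nrm A b"
      using nrm_scale[OF b(1), of l] nrm_mult[OF x b(1)] by simp
    then have "(cmod l - nrm A x) * nrm A b \<le> 0" by (simp add: algebra_simps)
    then have "nrm A b \<le> 0" using gt by (simp add: mult_le_0_iff)
    then show ?thesis using nrm_nonneg[OF b(1)] nrm_eq_0[OF b(1)] by simp
  qed
  ultimately have "c \<otimes> y = \<one>" using p(3) y by (metis diff_closed eq_iff_diff_eq_0 m_closed one_closed)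
  then have "y \<in> Units A" using yc p(3) y by (auto simp: Units_def)
  then show False using l by (simp add: spectrum_def y_def)
qed

lemma spectral_radius_nonneg:
  assumes "x \<in> carrier A"
  shows "0 \<le> spectral_radius cscale A x"
proof -
  have "bdd_above (insert 0 (cmod ` spectrum cscale A x))"
    using spectrum_bounded[OF assms] by (auto intro!: bdd_aboveI[of _ "nrm A x"])
  then show ?thesis unfolding spectral_radius_def by (intro cSup_upper) auto
qed

end

section \<open>Perron-Frobenius statements for the convolution\<close>

text \<open>Facts about 1-boxes mention the literal \<open>1\<close>, which has to survive simplification.\<close>

declare One_nat_def [simp del]

context cstar_planar_algebra
begin

lemma traced: "traced_algebra cscale (A n s) (tr n s)"
  by (intro traced_algebra.intro traced_algebra_axioms.intro cstar tr_add tr_scale tr_comm tr_positive tr_faithful)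

context
  fixes rot conv_left conv_right and s :: sign and xh pmax :: 'v and r :: real
  assumes rot: "is_rotation (boxes A) Z rot"
    and left: "is_left_convolution (boxes A) Z conv_left"
    and right: "is_right_convolution (boxes A) Z conv_right"
    and xh: "alg_positive (A 2 (flip s)) xh"
    and pmax: "pmax = max_range_projection cscale (A 1 s) (\<lambda>y. conv_left s y xh) r"
begin

interpretation P: traced_algebra cscale "A 1 s" "tr 1 s" by (rule traced)
interpretation M: traced_algebra cscale "A 1 (flip s)" "tr 1 (flip s)" by (rule traced)
interpretation U: traced_algebra cscale "A 2 (flip s)" "tr 2 (flip s)" by (rule traced)

text \<open>
  The set \<open>\<E>\<^sup>+\<close> of positive eigenvectors whose range projections have the join \<open>pmax\<close>.
\<close>

definition fixed_positive :: "'v set" where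
  "fixed_positive = {y \<in> carrier (A 1 s). conv_left s y xh = cscale (of_real r) y \<and> alg_positive (A 1 s) y}"

lemma rot_carrier [simp]:
  "y \<in> carrier (A 1 s) \<Longrightarrow> rot s y \<in> carrier (A 1 (flip s))"
  "z \<in> carrier (A 1 (flip s)) \<Longrightarrow> rot (flip s) z \<in> carrier (A 1 s)"
  using rot_closed[OF rot, of y s] rot_closed[OF rot, of z "flip s"] by simp_all

lemma rot_positive: "alg_positive (A 1 (flip s)) w \<Longrightarrow> alg_positive (A 1 s) (rot (flip s) w)"
proof -
  assume "alg_positive (A 1 (flip s)) w"
  then obtain g where g: "g \<in> carrier (A 1 (flip s))" "w = g \<otimes>\<^bsub>A 1 (flip s)\<^esub> star (A 1 (flip s)) g"
    by (auto simp: alg_positive_def)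
  have "rot (flip s) w = rot (flip s) (star (A 1 (flip s)) g) \<otimes>\<^bsub>A 1 s\<^esub> rot (flip s) g"
    unfolding g(2) using rot_mult[OF rot, of g "flip s" "star (A 1 (flip s)) g"] g by simp
  also have "rot (flip s) (star (A 1 (flip s)) g) = star (A 1 s) (rot (flip s) g)"
    using rot_star[OF rot g(1)] by simp
  finally have "rot (flip s) w = star (A 1 s) (rot (flip s) g) \<otimes>\<^bsub>A 1 s\<^esub> star (A 1 s) (star (A 1 s) (rot (flip s) g))"
    using P.star_star[of "rot (flip s) g"] g by simp
  then show ?thesis using P.positiveI[of "star (A 1 s) (rot (flip s) g)"] g by simp
qed

lemma adjoint:
  assumes y: "y \<in> fixed_positive" and z: "z \<in> carrier (A 1 (flip s))"
  shows "tr 1 s (y \<otimes>\<^bsub>A 1 s\<^esub> rot (flip s) (conv_right (flip s) xh z)) = of_real r * tr 1 s (y \<otimes>\<^bsub>A 1 s\<^esub> rot (flip s) z)"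
proof -
  have yc: "y \<in> carrier (A 1 s)" "conv_left s y xh = cscale (of_real r) y" using y by (auto simp: fixed_positive_def)
  have vc: "conv_right (flip s) xh z \<in> carrier (A 1 (flip s))"
    using conv_right_closed[OF rot left right z U.positiveD(1)[OF xh]] .
  have "tr 1 s (y \<otimes>\<^bsub>A 1 s\<^esub> rot (flip s) (conv_right (flip s) xh z)) = tr 1 s (conv_left s y xh \<otimes>\<^bsub>A 1 s\<^esub> rot (flip s) z)"
    using conv_adjoint[OF rot left right yc(1) U.positiveD(1)[OF xh] z] P.tr_comm[of y "rot (flip s) (conv_right (flip s) xh z)"] yc vc
    by simp
  also have "\<dots> = of_real r * tr 1 s (y \<otimes>\<^bsub>A 1 s\<^esub> rot (flip s) z)"
    using yc z P.mult_scale_left[of y "rot (flip s) z" "of_real r"] P.tr_scale[of "y \<otimes>\<^bsub>A 1 s\<^esub> rot (flip s) z" "of_real r"] by simp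
  finally show ?thesis .
qed

text \<open>
  By faithfulness every \<open>y\<close> in the set annihilates the half turn of \<open>w\<close>; so does their finite sum
  \<open>m\<close>, and so does \<open>pmax = m c\<close>. A half turn of this relation gives the first claim and its adjoint
  the second one.
\<close>

lemma pmax_kills:
  assumes w: "alg_positive (A 1 (flip s)) w"
    and y: "\<And>y. y \<in> fixed_positive \<Longrightarrow> tr 1 s (y \<otimes>\<^bsub>A 1 s\<^esub> rot (flip s) w) = 0"
  shows "rot s pmax \<otimes>\<^bsub>A 1 (flip s)\<^esub> w = 0" "w \<otimes>\<^bsub>A 1 (flip s)\<^esub> rot s pmax = 0"
    "rot s pmax \<in> projections (A 1 (flip s))"
proof -
  have S: "\<And>y. y \<in> fixed_positive \<Longrightarrow> alg_positive (A 1 s) y" by (auto simp: fixed_positive_def)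
  have pm: "pmax = projection_join (A 1 s) (range_projection (A 1 s) ` fixed_positive)"
    by (simp add: pmax max_range_projection_def fixed_positive_def)
  obtain B m c where B: "finite B" "B \<subseteq> fixed_positive" "m = (\<Sum>y\<in>B. y)" "c \<in> carrier (A 1 s)"
    "pmax = m \<otimes>\<^bsub>A 1 s\<^esub> c" "pmax \<in> projections (A 1 s)"
    using P.join_of_ranges[OF S] pm by metis
  have wc: "w \<in> carrier (A 1 (flip s))" "star (A 1 (flip s)) w = w" using M.positiveD[OF w] by auto
  let ?w = "rot (flip s) w"
  have rw: "?w \<in> carrier (A 1 s)" "alg_positive (A 1 s) ?w" using wc rot_positive[OF w] by auto
  have ws: "star (A 1 s) ?w = ?w" using P.positiveD[OF rw(2)] by simp
  have y0: "?w \<otimes>\<^bsub>A 1 s\<^esub> y = 0" if "y \<in> B" for y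
  proof (rule P.positive_mult_eq_0[OF rw(2)])
    have yf: "y \<in> fixed_positive" using that B(2) by blast
    then show "alg_positive (A 1 s) y" by (rule S)
    have "y \<in> carrier (A 1 s)" using P.positiveD[OF S[OF yf]] by simp
    then show "tr 1 s (?w \<otimes>\<^bsub>A 1 s\<^esub> y) = 0" using y[OF yf] P.tr_comm[of ?w y] rw by simp
  qed
  have "?w \<otimes>\<^bsub>A 1 s\<^esub> (\<Sum>y\<in>C. y) = 0 \<and> (\<Sum>y\<in>C. y) \<in> carrier (A 1 s)" if "C \<subseteq> B" for C
    using finite_subset[OF that B(1)] that
  proof (induction C rule: finite_induct)
    case (insert y C)
    have "y \<in> carrier (A 1 s)" using insert.prems B(2) by (auto simp: fixed_positive_def)
    then show ?case using insert y0 rw P.mult_add_right[of y "\<Sum>y\<in>C. y" ?w] by simp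
  qed (use rw in simp)
  then have m: "?w \<otimes>\<^bsub>A 1 s\<^esub> m = 0" "m \<in> carrier (A 1 s)" using B(3) by auto
  have pc: "pmax \<in> carrier (A 1 s)" "star (A 1 s) pmax = pmax" "pmax \<otimes>\<^bsub>A 1 s\<^esub> pmax = pmax"
    using B(6) by (auto simp: projections_def)
  have wp: "?w \<otimes>\<^bsub>A 1 s\<^esub> pmax = 0"
    unfolding B(5) using P.m_assoc[of ?w m c] m rw B(4) by simp
  have rp: "rot s pmax \<in> carrier (A 1 (flip s))" using pc by simp
  have r0: "rot s 0 = 0" using rot_scale[OF rot, of 0 s 0] by simp
  have "rot s (?w \<otimes>\<^bsub>A 1 s\<^esub> pmax) = rot s pmax \<otimes>\<^bsub>A 1 (flip s)\<^esub> w"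
    using rot_mult[OF rot rw(1) pc(1)] rot_rot[OF rot wc(1)] by simp
  then show p0: "rot s pmax \<otimes>\<^bsub>A 1 (flip s)\<^esub> w = 0" using wp r0 by simp
  have ps: "star (A 1 (flip s)) (rot s pmax) = rot s pmax" using rot_star[OF rot pc(1)] pc by simp
  then show "w \<otimes>\<^bsub>A 1 (flip s)\<^esub> rot s pmax = 0"
    using M.star_mult[of "rot s pmax" w] p0 rp wc by simp
  show "rot s pmax \<in> projections (A 1 (flip s))"
    using rot_mult[OF rot pc(1) pc(1)] pc rp ps by (simp add: projections_def)
qed

text \<open>
  The case \<open>w = 0\<close> of the preceding lemma.
\<close>

lemma pmax_projection: "rot s pmax \<in> projections (A 1 (flip s))"
proof -
  have "alg_positive (A 1 (flip s)) 0" using M.positiveI[of 0] by simp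
  moreover have "rot (flip s) 0 = 0" using rot_scale[OF rot, of 0 "flip s" 0] by simp
  ultimately show ?thesis
    using pmax_kills(3)[of 0] by (auto simp: fixed_positive_def)
qed

lemma dominated:
  assumes "a \<in> carrier (A 1 (flip s))" "alg_le (A 1 (flip s)) (range_projection (A 1 (flip s)) a) (rot s pmax)"
  shows "rot s pmax \<otimes>\<^bsub>A 1 (flip s)\<^esub> a = a"
  using M.range_projection_le[OF assms(1) pmax_projection] assms(2) by simp

lemma tr_rot_diff:
  assumes "y \<in> carrier (A 1 s)" "a \<in> carrier (A 1 (flip s))" "b \<in> carrier (A 1 (flip s))"
  shows "tr 1 s (y \<otimes>\<^bsub>A 1 s\<^esub> rot (flip s) (a - b)) = tr 1 s (y \<otimes>\<^bsub>A 1 s\<^esub> rot (flip s) a) - tr 1 s (y \<otimes>\<^bsub>A 1 s\<^esub> rot (flip s) b)"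
proof -
  have "rot (flip s) (a - b) = rot (flip s) (a + cscale (- 1) b)" by simp
  also have "\<dots> = rot (flip s) a + cscale (- 1) (rot (flip s) b)"
    using rot_add[OF rot assms(2), of "cscale (- 1) b"] rot_scale[OF rot assms(3), of "- 1"] M.scale_closed[OF assms(3), of "- 1"] by simp
  finally have "rot (flip s) (a - b) = rot (flip s) a - rot (flip s) b" by simp
  then show ?thesis using assms by (simp add: P.mult_diff_right P.tr_diff)
qed

lemma tr_rot_scale:
  assumes "y \<in> carrier (A 1 s)" "a \<in> carrier (A 1 (flip s))"
  shows "tr 1 s (y \<otimes>\<^bsub>A 1 s\<^esub> rot (flip s) (cscale k a)) = k * tr 1 s (y \<otimes>\<^bsub>A 1 s\<^esub> rot (flip s) a)"
  using assms rot_scale[OF rot assms(2), of k] by (simp add: P.mult_scale_right P.tr_scale)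

lemma right_closed: "z \<in> carrier (A 1 (flip s)) \<Longrightarrow> conv_right (flip s) xh z \<in> carrier (A 1 (flip s))"
  using conv_right_closed[OF rot left right _ U.positiveD(1)[OF xh]] .

text \<open>
  With \<open>v = xh * z\<close> and \<open>w = r z - v\<close> one has \<open>z w = 0\<close>, so \<open>tr (v w) = - tr (w w)\<close> is both
  nonnegative and nonpositive.
\<close>

lemma supersolution:
  assumes z: "alg_positive (A 1 (flip s)) z"
    and le: "alg_le (A 1 (flip s)) (conv_right (flip s) xh z) (cscale (of_real r) z)"
    and R: "alg_le (A 1 (flip s)) (range_projection (A 1 (flip s)) z) (rot s pmax)"
  shows "conv_right (flip s) xh z = cscale (of_real r) z"
proof -
  let ?m = "\<lambda>x y. x \<otimes>\<^bsub>A 1 (flip s)\<^esub> y" and ?p = "rot s pmax"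
  define v where "v = conv_right (flip s) xh z"
  define w where "w = cscale (of_real r) z - v"
  have zc: "z \<in> carrier (A 1 (flip s))" "star (A 1 (flip s)) z = z" using M.positiveD[OF z] by auto
  have vc: "v \<in> carrier (A 1 (flip s))" using right_closed[OF zc(1)] by (simp add: v_def)
  have wpos: "alg_positive (A 1 (flip s)) w" using le by (simp add: alg_le_def w_def v_def)
  then have wc: "w \<in> carrier (A 1 (flip s))" "star (A 1 (flip s)) w = w" using M.positiveD by auto
  have "tr 1 s (y \<otimes>\<^bsub>A 1 s\<^esub> rot (flip s) w) = 0" if y: "y \<in> fixed_positive" for y
    using y adjoint[OF y zc(1)] zc vc
    by (simp add: w_def tr_rot_diff tr_rot_scale v_def fixed_positive_def)
  note kill = pmax_kills[OF wpos this]
  have pc: "?p \<in> carrier (A 1 (flip s))" "star (A 1 (flip s)) ?p = ?p" using pmax_projection by (auto simp: projections_def)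
  have pz: "?m ?p z = z" by (rule dominated[OF zc(1) R])
  then have "?m z ?p = z" using M.star_mult[OF pc(1) zc(1)] zc(2) pc(2) by simp
  then have zw: "?m z w = 0" using M.m_assoc[of z ?p w] kill(1) zc pc wc by simp
  obtain a where a: "a \<in> carrier (A 2 (flip s))" "xh = a \<otimes>\<^bsub>A 2 (flip s)\<^esub> star (A 2 (flip s)) a" using xh by (auto simp: alg_positive_def)
  obtain b where b: "b \<in> carrier (A 1 (flip s))" "z = ?m b (star (A 1 (flip s)) b)" using z by (auto simp: alg_positive_def)
  obtain d where d: "d \<in> carrier (A 1 (flip s))" "w = ?m d (star (A 1 (flip s)) d)" using wpos by (auto simp: alg_positive_def)
  have vw: "tr 1 (flip s) (?m v w) \<in> \<real>\<^sub>\<ge>\<^sub>0"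
    using conv_right_positive[OF right a(1) b(1) d(1)] unfolding v_def a(2)[symmetric] b(2)[symmetric] d(2)[symmetric] .
  have "v = cscale (of_real r) z - w" by (simp add: w_def)
  then have "?m v w = - ?m w w"
    using zw zc wc by (simp add: M.mult_diff_left M.mult_scale_left)
  then have "tr 1 (flip s) (?m v w) = - tr 1 (flip s) (?m w w)"
    using M.tr_scale[of "?m w w" "- 1"] wc by simp
  moreover have "tr 1 (flip s) (?m w w) \<in> \<real>\<^sub>\<ge>\<^sub>0"
    using M.tr_positive[OF M.positiveI[OF wc(1)]] wc(2) by simp
  ultimately have "tr 1 (flip s) (?m w w) = 0"
    using vw by (auto simp: complex_nonneg_Reals_iff complex_eq_iff)
  then have "w = 0" using M.tr_star_eq_0[OF wc(1)] wc(2) by simp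
  then show ?thesis by (simp add: w_def v_def)
qed

text \<open>
  Here \<open>v - w = r z = c c\<^sup>*\<close> with \<open>c = \<surd>r b\<close> if \<open>z = b b\<^sup>*\<close>, so \<open>w \<le> v\<close> and \<open>w\<close> is dominated by the
  half turn of \<open>pmax\<close>, which also annihilates it.
\<close>

lemma subsolution:
  assumes r: "0 \<le> r" and z: "alg_positive (A 1 (flip s)) z"
    and le: "alg_le (A 1 (flip s)) (cscale (of_real r) z) (conv_right (flip s) xh z)"
    and R: "alg_le (A 1 (flip s)) (range_projection (A 1 (flip s)) (conv_right (flip s) xh z)) (rot s pmax)"
  shows "conv_right (flip s) xh z = cscale (of_real r) z"
proof -
  let ?m = "\<lambda>x y. x \<otimes>\<^bsub>A 1 (flip s)\<^esub> y" and ?p = "rot s pmax"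
  define v where "v = conv_right (flip s) xh z"
  define w where "w = v - cscale (of_real r) z"
  have zc: "z \<in> carrier (A 1 (flip s))" "star (A 1 (flip s)) z = z" using M.positiveD[OF z] by auto
  have vc: "v \<in> carrier (A 1 (flip s))" using right_closed[OF zc(1)] by (simp add: v_def)
  have wpos: "alg_positive (A 1 (flip s)) w" using le by (simp add: alg_le_def w_def v_def)
  then have wc: "w \<in> carrier (A 1 (flip s))" "star (A 1 (flip s)) w = w" using M.positiveD by auto
  have "tr 1 s (y \<otimes>\<^bsub>A 1 s\<^esub> rot (flip s) w) = 0" if y: "y \<in> fixed_positive" for y
    using y adjoint[OF y zc(1)] zc vc
    by (simp add: w_def tr_rot_diff tr_rot_scale v_def fixed_positive_def)
  note kill = pmax_kills[OF wpos this]
  obtain b where b: "b \<in> carrier (A 1 (flip s))" "z = ?m b (star (A 1 (flip s)) b)" using z by (auto simp: alg_positive_def)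
  define c where "c = cscale (of_real (sqrt r)) b"
  have c: "c \<in> carrier (A 1 (flip s))" using b by (simp add: c_def)
  have "?m c (star (A 1 (flip s)) c) = cscale (of_real (sqrt r) * of_real (sqrt r)) z"
    using b by (simp add: c_def M.star_scale M.mult_scale_left M.mult_scale_right)
  also have "of_real (sqrt r) * of_real (sqrt r) = (of_real r :: complex)"
    using r by (simp flip: of_real_mult)
  finally have vw: "v - w = ?m c (star (A 1 (flip s)) c)" by (simp add: w_def)
  have "?m ?p w = w"
    by (rule M.compress_eq_0[OF pmax_projection wpos _ vc])
       (use vw M.positiveI[OF c] dominated[OF vc] R in \<open>auto simp: v_def\<close>)
  then have "w = 0" using kill(1) by simp
  then show ?thesis by (simp add: w_def v_def)
qed

lemma eigenvalue:
  assumes z: "z \<noteq> 0" "alg_positive (A 1 (flip s)) z" and k: "conv_right (flip s) xh z = cscale k z"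
    and R: "alg_le (A 1 (flip s)) (range_projection (A 1 (flip s)) z) (rot s pmax)"
  shows "k = of_real r"
proof (rule ccontr)
  assume ne: "k \<noteq> of_real r"
  have zc: "z \<in> carrier (A 1 (flip s))" using M.positiveD[OF z(2)] by simp
  have "tr 1 s (y \<otimes>\<^bsub>A 1 s\<^esub> rot (flip s) z) = 0" if y: "y \<in> fixed_positive" for y
    using y adjoint[OF y zc] zc ne by (simp add: k tr_rot_scale fixed_positive_def)
  then have "rot s pmax \<otimes>\<^bsub>A 1 (flip s)\<^esub> z = 0" using pmax_kills(1)[OF z(2)] by blast
  then show False using dominated[OF zc R] z(1) by simp
qed

end

end

theorem theorem3p14:
  fixes cscale :: "complex \<Rightarrow> 'v::ab_group_add \<Rightarrow> 'v"
    and A :: "nat \<Rightarrow> sign \<Rightarrow> 'v star_algebra"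
    and Z :: "tangle \<Rightarrow> (disc \<Rightarrow> 'v) \<Rightarrow> 'v"
    and tr :: "nat \<Rightarrow> sign \<Rightarrow> 'v \<Rightarrow> complex"
    and fourier :: "sign \<Rightarrow> 'v \<Rightarrow> 'v"
    and conv_left conv_right :: "sign \<Rightarrow> 'v \<Rightarrow> 'v \<Rightarrow> 'v"
    and rot :: "sign \<Rightarrow> 'v \<Rightarrow> 'v"
    and s :: sign and x xh pmax :: 'v and r :: real
  assumes "cstar_planar_algebra cscale A Z tr"
    and "is_fourier_transform (\<lambda>n s. carrier (A n s)) Z fourier"
    and "is_left_convolution (\<lambda>n s. carrier (A n s)) Z conv_left"
    and "is_right_convolution (\<lambda>n s. carrier (A n s)) Z conv_right"
    and "is_rotation (\<lambda>n s. carrier (A n s)) Z rot"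
    and "x \<in> carrier (A 2 s)"
    and "xh = fourier s x"
    and "alg_positive (A 2 (flip s)) xh"
    and "r = spectral_radius cscale (A 2 s) x"
    and "pmax = max_range_projection cscale (A 1 s) (\<lambda>y. conv_left s y xh) r"
  shows
    "(\<forall>z\<in>carrier (A 1 (flip s)). z \<noteq> 0 \<and> alg_positive (A 1 (flip s)) z \<and>
        alg_le (A 1 (flip s)) (conv_right (flip s) xh z) (cscale (of_real r) z) \<and>
        alg_le (A 1 (flip s)) (range_projection (A 1 (flip s)) z) (rot s pmax) \<longrightarrow>
        conv_right (flip s) xh z = cscale (of_real r) z) \<and>
     (\<forall>z\<in>carrier (A 1 (flip s)). z \<noteq> 0 \<and> alg_positive (A 1 (flip s)) z \<and>
        alg_le (A 1 (flip s)) (cscale (of_real r) z) (conv_right (flip s) xh z) \<and>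
        alg_le (A 1 (flip s)) (range_projection (A 1 (flip s)) (conv_right (flip s) xh z)) (rot s pmax) \<longrightarrow>
        conv_right (flip s) xh z = cscale (of_real r) z) \<and>
     (\<forall>z\<in>carrier (A 1 (flip s)). \<forall>r'::complex. z \<noteq> 0 \<and> alg_positive (A 1 (flip s)) z \<and>
        conv_right (flip s) xh z = cscale r' z \<and>
        alg_le (A 1 (flip s)) (range_projection (A 1 (flip s)) z) (rot s pmax) \<longrightarrow>
        r' = of_real r)"
proof -
  interpret cstar_planar_algebra cscale A Z tr by (rule assms(1))
  interpret X: traced_algebra cscale "A 2 s" "tr 2 s" by (rule traced)
  have r: "0 \<le> r" unfolding assms(9) by (rule X.spectral_radius_nonneg[OF assms(6)])
  note ctx = assms(5,3,4,8,10)
  show ?thesis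
    using supersolution[OF ctx] subsolution[OF ctx r] eigenvalue[OF ctx] by blast
qed

end
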